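(* There is a polynomial-time algorithm that takes an RP-$d$-SP instance $(U_1,\dots,U_p,\mathcal{S},k)$ as input and either correctly determines that it is a YES-instance, or returns an equivalent RP-$d$-SP instance with at most $g_d(k)$ sets and a hitting set of size at most $k\cdot d$. Hence, for every constant $d$, RP-$d$-SP admits a kernel of size $g_d(k)=\mathcal{O}\bigl((k^{d+1})^d\bigr)$.
   Context: An instance of Rejection-Proof $d$-Set Packing (RP-$d$-SP) consists of a finite universe $U=U_1\cup\dots\cup U_p$ partitioned among $p$ agents, a collection $\mathcal{S}\subseteq 2^U$ of sets each of size at most $d$, and an integer $k$. A set $S$ is $i$-internal if $S\subseteq U_i$. For a collection $\mathcal{X}\subseteq\mathcal{S}$ of pairwise disjoint sets, agent $i$ rejects $\mathcal{X}$ if there exist $\mathcal{X}_{\mathrm{rej}}\subseteq\mathcal{X}$ and a collection $\mathcal{X}_{\mathrm{int}}\subseteq\mathcal{S}$ of $i$-internal sets such that $(\mathcal{X}\setminus\mathcal{X}_{\mathrm{rej}})\cup\mathcal{X}_{\mathrm{int}}$ consists of pairwise disjoint sets and covers more elements of $U_i$ than $\mathcal{X}$; $\mathcal{X}$ is rejection-proof if no agent rejects it. The instance is a YES-instance if there is a rejection-proof collection of pairwise disjoint sets of $\mathcal{S}$ covering at least $k$ elements. Two instances are equivalent if both are YES-instances or both are NO-instances. A hitting set of $\mathcal{S}$ is a subset of $U$ meeting every set of $\mathcal{S}$. Define $f_d(k)=d\cdot d!\,(d(kd-1)+1)^d$ and $g_d(k)=d\cdot d!\,\bigl(d^{d-1}(d(kd-1)+1)+d\cdot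 k\cdot f_d(k)\bigr)^d$. *)

theory Defs
  imports "HOL-Library.Landau_Symbols" "HOL-Computational_Algebra.Polynomial"
begin

section \<open>Rejection-proof set packing\<close>

text \<open>The agents are the positions of the list \<open>parts\<close>; parts may be empty.\<close>

record 'a rpsp =
  parts :: "'a set list"
  family :: "'a set set"
  target :: int

definition universe :: "'a rpsp \<Rightarrow> 'a set" where
  "universe I = \<Union> (set (parts I))"

definition rpsp_instance :: "nat \<Rightarrow> 'a rpsp \<Rightarrow> bool" where
  "rpsp_instance d I \<longleftrightarrow>
     finite (universe I) \<and>
     (\<forall>i < length (parts I). \<forall>j < length (parts I).
        i \<noteq> j \<longrightarrow> parts I ! i \<inter> parts I ! j = {}) \<and>
     family I \<subseteq> Pow (universe I) \<and>
     (\<forall>S \<in> family I. card S \<le> d)"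

definition internal :: "'a rpsp \<Rightarrow> nat \<Rightarrow> 'a set \<Rightarrow> bool" where
  "internal I i S \<longleftrightarrow> S \<subseteq> parts I ! i"

definition packing :: "'a rpsp \<Rightarrow> 'a set set \<Rightarrow> bool" where
  "packing I X \<longleftrightarrow> X \<subseteq> family I \<and> pairwise disjnt X"

definition rejects :: "'a rpsp \<Rightarrow> nat \<Rightarrow> 'a set set \<Rightarrow> bool" where
  "rejects I i X \<longleftrightarrow>
     (\<exists>X_rej X_int. X_rej \<subseteq> X \<and> X_int \<subseteq> family I \<and> (\<forall>S \<in> X_int. internal I i S) \<and>
        pairwise disjnt ((X - X_rej) \<union> X_int) \<and>
        card (\<Union> ((X - X_rej) \<union> X_int) \<inter> parts I ! i) > card (\<Union> X \<inter> parts I ! i))"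

definition rejection_proof :: "'a rpsp \<Rightarrow> 'a set set \<Rightarrow> bool" where
  "rejection_proof I X \<longleftrightarrow> packing I X \<and> (\<forall>i < length (parts I). \<not> rejects I i X)"

definition yes_instance :: "'a rpsp \<Rightarrow> bool" where
  "yes_instance I \<longleftrightarrow> (\<exists>X. rejection_proof I X \<and> int (card (\<Union> X)) \<ge> target I)"

definition equivalent :: "'a rpsp \<Rightarrow> 'b rpsp \<Rightarrow> bool" where
  "equivalent I J \<longleftrightarrow> (yes_instance I \<longleftrightarrow> yes_instance J)"

definition hitting_set :: "'a rpsp \<Rightarrow> 'a set \<Rightarrow> bool" where
  "hitting_set I H \<longleftrightarrow> H \<subseteq> universe I \<and> (\<forall>S \<in> family I. S \<inter> H \<noteq> {})"

text \<open>Both bounds are integer-valued because \<open>k * d - 1\<close> must not be truncated at \<open>k = 0\<close>.\<close>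

definition f_bound :: "nat \<Rightarrow> int \<Rightarrow> int" where
  "f_bound d k = int d * fact d * (int d * (k * int d - 1) + 1) ^ d"

definition g_bound :: "nat \<Rightarrow> int \<Rightarrow> int" where
  "g_bound d k = int d * fact d *
     (int d ^ (d - 1) * (int d * (k * int d - 1) + 1) + int d * k * f_bound d k) ^ d"


section \<open>Polynomial time\<close>

text \<open>
  The machine model is a while-language over binary trees, in the style of Jones's WHILE. A program
  transforms a single tree; the finitely many variables of a textbook program are the components of
  that tree. Every construct is charged at least the size of the tree it is applied to, so that no
  value can be copied or compared for free (the result of a run is never larger than its cost, see
  \<open>runs_size\<close>). A step on a tree of size \<open>n\<close> is thus simulated by a Turing machine in time polynomial
  in \<open>n\<close>, and conversely a Turing machine step is a bounded number of tree operations;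
  polynomial time in this model is polynomial time on Turing machines.
\<close>

datatype val = Atom | Pair val val

fun left :: "val \<Rightarrow> val" where
  "left Atom = Atom"
| "left (Pair a b) = a"

fun right :: "val \<Rightarrow> val" where
  "right Atom = Atom"
| "right (Pair a b) = b"

definition same :: "val \<Rightarrow> val" where
  "same x = (if left x = right x then Pair Atom Atom else Atom)"

datatype prog =
    Ident
  | Nought
  | Left
  | Right
  | Same
  | Fork prog prog
  | Seq prog prog
  | Cond prog prog prog
  | While prog prog

text \<open>\<open>runs P x t y\<close>: program \<open>P\<close> started on \<open>x\<close> halts with result \<open>y\<close> at cost \<open>t\<close>.
  In tests, \<open>Atom\<close> is false and every other tree is true.\<close>

inductive runs :: "prog \<Rightarrow> val \<Rightarrow> nat \<Rightarrow> val \<Rightarrow> bool" where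
  Ident: "runs Ident x (Suc (size x)) x"
| Nought: "runs Nought x (Suc (size x)) Atom"
| Left: "runs Left x (Suc (size x)) (left x)"
| Right: "runs Right x (Suc (size x)) (right x)"
| Same: "runs Same x (Suc (size x)) (same x)"
| Fork: "runs p x s y \<Longrightarrow> runs q x t z \<Longrightarrow> runs (Fork p q) x (Suc (size x) + s + t) (Pair y z)"
| Seq: "runs p x s y \<Longrightarrow> runs q y t z \<Longrightarrow> runs (Seq p q) x (Suc (size x) + s + t) z"
| Cond_true: "runs b x s v \<Longrightarrow> v \<noteq> Atom \<Longrightarrow> runs p x t y \<Longrightarrow>
    runs (Cond b p q) x (Suc (size x) + s + t) y"
| Cond_false: "runs b x s Atom \<Longrightarrow> runs q x t y \<Longrightarrow>
    runs (Cond b p q) x (Suc (size x) + s + t) y"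
| While_false: "runs b x s Atom \<Longrightarrow> runs (While b p) x (Suc (size x) + s) x"
| While_true: "runs b x s v \<Longrightarrow> v \<noteq> Atom \<Longrightarrow> runs p x t y \<Longrightarrow> runs (While b p) y u z \<Longrightarrow>
    runs (While b p) x (Suc (size x) + s + t + u) z"

lemma runs_deterministic:
  "runs P x t y \<Longrightarrow> runs P x t' y' \<Longrightarrow> t' = t \<and> y' = y"
proof (induction arbitrary: t' y' rule: runs.induct)
  case (Fork p x s y q t z)
  from Fork.prems show ?case by cases (auto dest!: Fork.IH)
next
  case (Seq p x s y q t z)
  from Seq.prems show ?case by cases (auto dest!: Seq.IH)
next
  case (Cond_true b x s v p t y q)
  from Cond_true.prems show ?case by cases (use Cond_true.hyps in \<open>auto dest!: Cond_true.IH\<close>)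
next
  case (Cond_false b x s q t y p)
  from Cond_false.prems show ?case by cases (auto dest!: Cond_false.IH)
next
  case (While_false b x s p)
  from While_false.prems show ?case by cases (auto dest!: While_false.IH)
next
  case (While_true b x s v p t y u z)
  from While_true.prems show ?case
  proof cases
    case (While_false s')
    then show ?thesis using While_true.IH(1) While_true.hyps by blast
  next
    case (While_true s' v' t'' y'' u')
    then show ?thesis using While_true.IH by metis
  qed
qed (erule runs.cases; simp)+

lemma runs_size: "runs P x t y \<Longrightarrow> size y \<le> t"
proof (induction rule: runs.induct)
  case (Left x)
  show ?case by (cases x) auto
next
  case (Right x)
  show ?case by (cases x) auto
qed (auto simp: same_def)

text \<open>\<open>P\<close> solves the search problem \<open>R\<close> on the inputs \<open>D\<close> in polynomial time, inputs and outputs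
  being presented by \<open>enc\<close> and \<open>enc'\<close>.\<close>

definition polytime_solves ::
    "prog \<Rightarrow> ('a \<Rightarrow> val) \<Rightarrow> ('b \<Rightarrow> val) \<Rightarrow> 'a set \<Rightarrow> ('a \<Rightarrow> 'b \<Rightarrow> bool) \<Rightarrow> bool" where
  "polytime_solves P enc enc' D R \<longleftrightarrow>
     (\<exists>q :: nat poly. \<forall>x \<in> D. \<exists>t y.
        runs P (enc x) t (enc' y) \<and> t \<le> poly q (size (enc x)) \<and> R x y)"


section \<open>Encoding instances\<close>

fun enc_list :: "('a \<Rightarrow> val) \<Rightarrow> 'a list \<Rightarrow> val" where
  "enc_list e [] = Atom"
| "enc_list e (x # xs) = Pair (e x) (enc_list e xs)"

definition enc_bool :: "bool \<Rightarrow> val" where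
  "enc_bool b = (if b then Pair Atom Atom else Atom)"

text \<open>Numbers are written in binary, least significant bit first.\<close>

fun enc_nat :: "nat \<Rightarrow> val" where
  "enc_nat n = (if n = 0 then Atom else Pair (enc_bool (odd n)) (enc_nat (n div 2)))"

declare enc_nat.simps [simp del]

definition enc_int :: "int \<Rightarrow> val" where
  "enc_int k = Pair (enc_bool (k < 0)) (enc_nat (nat \<bar>k\<bar>))"

fun enc_option :: "('a \<Rightarrow> val) \<Rightarrow> 'a option \<Rightarrow> val" where
  "enc_option e None = Atom"
| "enc_option e (Some x) = Pair Atom (e x)"

definition enc_pair :: "('a \<Rightarrow> val) \<Rightarrow> ('b \<Rightarrow> val) \<Rightarrow> 'a \<times> 'b \<Rightarrow> val" where
  "enc_pair e e' p = Pair (e (fst p)) (e' (snd p))"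

text \<open>A description lists the elements of each part, the elements of each set, and \<open>k\<close>;
  elements are named by natural numbers.\<close>

type_synonym desc = "nat list list \<times> nat list list \<times> int"

definition inst_of :: "desc \<Rightarrow> nat rpsp" where
  "inst_of = (\<lambda>(Us, Ss, k). \<lparr>parts = map set Us, family = set ` set Ss, target = k\<rparr>)"

definition descriptions :: "nat \<Rightarrow> desc set" where
  "descriptions d = {(Us, Ss, k).
     (\<forall>V \<in> set Us. distinct V) \<and> (\<forall>V \<in> set Ss. distinct V) \<and> distinct (map set Ss) \<and>
     rpsp_instance d (inst_of (Us, Ss, k))}"

definition enc_desc :: "desc \<Rightarrow> val" where
  "enc_desc = enc_pair (enc_list (enc_list enc_nat))
     (enc_pair (enc_list (enc_list enc_nat)) enc_int)"

text \<open>An outcome is either the verdict YES (\<open>None\<close>) or an instance with a list of elements.\<close>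

definition enc_outcome :: "(desc \<times> nat list) option \<Rightarrow> val" where
  "enc_outcome = enc_option (enc_pair enc_desc (enc_list enc_nat))"

lemma inj_enc_list:
  assumes "inj e"
  shows "inj (enc_list e)"
proof (rule injI)
  fix xs ys
  show "enc_list e xs = enc_list e ys \<Longrightarrow> xs = ys"
  proof (induction xs arbitrary: ys)
    case Nil
    then show ?case by (cases ys) auto
  next
    case (Cons x xs)
    then show ?case using assms by (cases ys) (auto dest: injD)
  qed
qed

lemma enc_bool_eq_iff [simp]: "enc_bool a = enc_bool b \<longleftrightarrow> a = b"
  by (auto simp: enc_bool_def)

lemma inj_enc_nat: "inj enc_nat"
proof (rule injI)
  fix m n
  show "enc_nat m = enc_nat n \<Longrightarrow> m = n"
  proof (induction m arbitrary: n rule: less_induct)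
    case (less m)
    show ?case
    proof (cases "m = 0 \<or> n = 0")
      case True
      with less.prems show ?thesis
        by (auto simp: enc_nat.simps[of m] enc_nat.simps[of n] split: if_splits)
    next
      case False
      with less.prems have "odd m = odd n" "enc_nat (m div 2) = enc_nat (n div 2)"
        by (simp_all add: enc_nat.simps[of m] enc_nat.simps[of n])
      moreover from this False have "m div 2 = n div 2"
        by (intro less.IH) auto
      ultimately show ?thesis
        by (metis even_two_times_div_two odd_two_times_div_two_succ)
    qed
  qed
qed

lemma inj_enc_int: "inj enc_int"
proof (rule injI)
  fix j k
  assume "enc_int j = enc_int k"
  then have "(j < 0) = (k < 0)" "nat \<bar>j\<bar> = nat \<bar>k\<bar>"
    using inj_enc_nat by (auto simp: enc_int_def dest: injD)
  then show "j = k" by linarith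
qed

lemma inj_enc_pair: "inj e \<Longrightarrow> inj e' \<Longrightarrow> inj (enc_pair e e')"
  by (auto simp: inj_def enc_pair_def)

lemma inj_enc_option:
  assumes "inj e"
  shows "inj (enc_option e)"
proof (rule injI)
  fix x y
  show "enc_option e x = enc_option e y \<Longrightarrow> x = y"
    using assms by (cases x; cases y) (auto dest: injD)
qed

lemma inj_enc_desc: "inj enc_desc"
  unfolding enc_desc_def
  by (intro inj_enc_pair inj_enc_list inj_enc_nat inj_enc_int)

lemma inj_enc_outcome: "inj enc_outcome"
  unfolding enc_outcome_def
  by (intro inj_enc_option inj_enc_pair inj_enc_desc inj_enc_list inj_enc_nat)


section \<open>Kernels\<close>

text \<open>
  The size \<open>h\<close> of a kernel counts sets. To be a kernel in the usual sense, the output must in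
  addition have an encoding whose length is bounded in terms of the parameter alone; it is required
  to be polynomial in \<open>h k\<close> and \<open>k\<close>. This also bounds the new parameter. The conversion \<open>nat\<close> only
  matters for nonpositive \<open>k\<close>, where the formula for the bound may be negative.
\<close>

definition admits_kernel :: "nat \<Rightarrow> (int \<Rightarrow> int) \<Rightarrow> bool" where
  "admits_kernel d h \<longleftrightarrow>
     (\<exists>P. \<exists>q :: nat poly. polytime_solves P enc_desc enc_desc (descriptions d)
        (\<lambda>D D'. D' \<in> descriptions d \<and>
           equivalent (inst_of D) (inst_of D') \<and>
           card (family (inst_of D')) \<le> nat (h (target (inst_of D))) \<and>
           size (enc_desc D') \<le>
             poly q (nat (h (target (inst_of D))) + nat (target (inst_of D)))))"

end

theory Submission
  imports Defs "HOL-Library.FuncSet"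
begin

text \<open>
  Adding a set disjoint from a rejection-proof packing keeps it rejection-proof, so some
  rejection-proof packing is inclusion-maximal and its elements hit every nonempty set. Hence a
  greedy maximal packing with at least \<open>k\<close> sets certifies YES; otherwise its elements form a hitting
  set \<open>H\<close> of size at most \<open>(k - 1) d\<close>, and no packing has more than \<open>card H\<close> sets.

  A set \<open>S\<close> of a large enough sunflower with equal-sized sets can always be exchanged for one whose
  petal avoids the rest of a given packing. If the sunflower consists of internal sets, it lies in one
  part and the exchange affects neither coverage nor rejections, so \<open>S\<close> may be deleted. Once few
  internal sets are left, discard the petals meeting one of them and keep petals with equal shares on
  the parts met by the core: a rejection that drops the new set can then be imitated after dropping
  the old one if the part meets the core, and otherwise dropping it frees nothing useful.

  The counting does not need a largest sunflower: if for every core a single greedily found family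
  with disjoint petals is small, branching over its petal elements bounds the family as in the
  sunflower lemma. Searching over all cores of at most \<open>d\<close> elements is therefore polynomial.
\<close>

section \<open>Polynomial-time functions\<close>

text \<open>Rejection-proofness is not monotone in the family: deleting a set can destroy a good
  packing, but also a threat against a packing. Only internal sets are threats. So they are pruned
  first, and the second pass, whose petals avoid all elements of the surviving internal sets, never
  deletes a threat. This order also explains the constants. A greedy packing with fewer than
  \<open>k\<close> sets gives \<open>d * card H \<le> d * (k * d - 1) + 1\<close>; sunflower
  counting with this threshold, summed over \<open>d\<close> set sizes, leaves at most
  \<open>f_bound d k\<close> internal sets. Their at most \<open>d * f_bound d k\<close> elements
  can spoil one petal each, and each of the \<open>d ^ (d - 1)\<close> share vectors admits at most
  \<open>d * card H\<close> petals; the sum is bounded by the base of the power in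
  \<open>g_bound\<close>. A bound on the number of sets does not bound the encoding length, as idle
  elements and long names remain, hence the restriction and renaming at the end. Running times are
  not computed on programs: closure rules for total functions on encodable types build the program
  along the definitions.\<close>

class encodable =
  fixes enc :: "'a \<Rightarrow> val"
  assumes inj_enc: "inj enc"

lemma enc_eq_iff [simp]: "enc x = enc y \<longleftrightarrow> x = y"
  using inj_enc by (auto dest: injD)

instantiation unit :: encodable
begin
definition enc_unit_eq: "enc (u :: unit) = Atom"
instance by standard (simp add: inj_def)
end

instantiation bool :: encodable
begin
definition enc_bool_eq: "enc = enc_bool"
instance by standard (simp add: inj_def enc_bool_eq)
end

instantiation nat :: encodable
begin
definition enc_nat_eq: "enc = enc_nat"
instance by standard (simp add: enc_nat_eq inj_enc_nat)
end

instantiation int :: encodable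
begin
definition enc_int_eq: "enc = enc_int"
instance by standard (simp add: enc_int_eq inj_enc_int)
end

instantiation list :: (encodable) encodable
begin
definition enc_list_eq: "enc = enc_list enc"
instance by standard (simp add: enc_list_eq inj_enc_list inj_enc)
end

instantiation prod :: (encodable, encodable) encodable
begin
definition enc_prod_eq: "enc = enc_pair enc enc"
instance by standard (simp add: enc_prod_eq inj_enc_pair inj_enc)
end

instantiation option :: (encodable) encodable
begin
definition enc_option_eq: "enc = enc_option enc"
instance by standard (simp add: enc_option_eq inj_enc_option inj_enc)
end

lemma enc_simps [simp]:
  "enc (a, b) = Pair (enc a) (enc b)"
  "enc ([] :: 'a :: encodable list) = Atom"
  "enc (x # xs) = Pair (enc x) (enc xs)"
  "enc True = Pair Atom Atom"
  "enc False = Atom"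
  "enc (u :: unit) = Atom"
  "enc (None :: 'a option) = Atom"
  "enc (Some x) = Pair Atom (enc x)"
  by (simp_all add: enc_prod_eq enc_pair_def enc_list_eq enc_bool_eq enc_bool_def enc_unit_eq
      enc_option_eq)

abbreviation esize :: "'a :: encodable \<Rightarrow> nat" where
  "esize x \<equiv> size (enc x)"

lemma esize_append [simp]: "esize (xs @ ys) = esize xs + esize ys"
  by (induction xs) auto

lemma esize_member: "x \<in> set xs \<Longrightarrow> esize x < esize xs"
  by (induction xs) auto

lemma length_le_esize: "length xs \<le> esize xs"
  by (induction xs) auto

section \<open>Polynomial growth relative to a size measure\<close>

lemma poly_mono_nat:
  fixes q :: "nat poly"
  assumes "m \<le> n"
  shows "poly q m \<le> poly q n"
  using assms by (induction q) (auto intro!: mult_mono add_mono)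

definition pbounded :: "('a \<Rightarrow> nat) \<Rightarrow> ('a \<Rightarrow> nat) \<Rightarrow> bool" where
  "pbounded m f \<longleftrightarrow> (\<exists>q :: nat poly. \<forall>x. f x \<le> poly q (m x))"

lemma pbounded_const: "pbounded m (\<lambda>x. c)"
  unfolding pbounded_def by (rule exI[of _ "[:c:]"]) simp

lemma pbounded_self: "pbounded m m"
  unfolding pbounded_def by (rule exI[of _ "[:0, 1:]"]) simp

lemma pbounded_add:
  assumes "pbounded m f" "pbounded m g"
  shows "pbounded m (\<lambda>x. f x + g x)"
proof -
  obtain p q :: "nat poly" where "\<forall>x. f x \<le> poly p (m x)" "\<forall>x. g x \<le> poly q (m x)"
    using assms unfolding pbounded_def by blast
  then have "\<forall>x. f x + g x \<le> poly (p + q) (m x)" by (simp add: add_mono)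
  then show ?thesis unfolding pbounded_def by blast
qed

lemma pbounded_Suc: "pbounded m f \<Longrightarrow> pbounded m (\<lambda>x. Suc (f x))"
  using pbounded_add[OF _ pbounded_const[of m 1], of f] by simp

lemma pbounded_mult:
  assumes "pbounded m f" "pbounded m g"
  shows "pbounded m (\<lambda>x. f x * g x)"
proof -
  obtain p q :: "nat poly" where "\<forall>x. f x \<le> poly p (m x)" "\<forall>x. g x \<le> poly q (m x)"
    using assms unfolding pbounded_def by blast
  then have "\<forall>x. f x * g x \<le> poly (p * q) (m x)" by (simp add: mult_mono)
  then show ?thesis unfolding pbounded_def by blast
qed

text \<open>Substituting one bound into another needs monotonicity, which polynomials over
  \<open>nat\<close> have because no coefficient is negative.\<close>

lemma pbounded_poly:
  assumes "pbounded m f"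
  shows "pbounded m (\<lambda>x. poly q (f x))"
proof -
  obtain p :: "nat poly" where "\<forall>x. f x \<le> poly p (m x)"
    using assms unfolding pbounded_def by blast
  then have "\<forall>x. poly q (f x) \<le> poly (pcompose q p) (m x)"
    by (simp add: poly_pcompose poly_mono_nat)
  then show ?thesis unfolding pbounded_def by blast
qed

lemma pbounded_mono:
  assumes "pbounded m f" "\<And>x. g x \<le> f x"
  shows "pbounded m g"
  using assms unfolding pbounded_def by (meson order_trans)

lemma pbounded_comp:
  assumes "pbounded m' g" "pbounded m (\<lambda>x. m' (h x))"
  shows "pbounded m (\<lambda>x. g (h x))"
proof -
  obtain q :: "nat poly" where "\<forall>x. g x \<le> poly q (m' x)"
    using assms unfolding pbounded_def by blast
  then show ?thesis
    by (intro pbounded_mono[OF pbounded_poly[OF assms(2), of q]]) simp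
qed

lemmas pbounded_intros = pbounded_const pbounded_self pbounded_Suc pbounded_add pbounded_mult
  pbounded_poly

definition computes ::
    "prog \<Rightarrow> ('a \<Rightarrow> nat) \<Rightarrow> ('a :: encodable \<Rightarrow> 'b :: encodable) \<Rightarrow> bool" where
  "computes P T f \<longleftrightarrow> (\<forall>x. \<exists>t \<le> T x. runs P (enc x) t (enc (f x)))"

text \<open>The bound is demanded on the whole type, ill-formed instances included, so functions
  compose without side conditions.\<close>

definition polytime :: "('a :: encodable \<Rightarrow> 'b :: encodable) \<Rightarrow> bool" where
  "polytime f \<longleftrightarrow> (\<exists>P T. pbounded esize T \<and> computes P T f)"

lemma polytimeI:
  assumes "\<And>x. \<exists>t \<le> T x. runs P (enc x) t (enc (f x))" "pbounded esize T"
  shows "polytime f"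
  using assms unfolding polytime_def computes_def by blast

lemma polytimeE:
  assumes "polytime f"
  obtains P T where "\<And>x. \<exists>t \<le> T x. runs P (enc x) t (enc (f x))" "pbounded esize T"
  using assms unfolding polytime_def computes_def by blast

text \<open>A result is never larger than the cost of producing it (\<open>runs_size\<close>).
  Composition needs this, since the second running time is measured in the size of the intermediate
  value.\<close>

lemma polytime_size:
  assumes "polytime f"
  shows "pbounded esize (\<lambda>x. esize (f x))"
proof -
  obtain P T where P: "\<And>x. \<exists>t \<le> T x. runs P (enc x) t (enc (f x))" "pbounded esize T"
    using assms by (rule polytimeE) blast
  show ?thesis
    by (rule pbounded_mono[OF P(2)]) (use P(1) runs_size order_trans in blast)
qed

lemma polytime_basic:
  assumes "\<And>x. runs P (enc x) (Suc (esize x)) (enc (f x))"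
  shows "polytime f"
  by (rule polytimeI[of "\<lambda>x. Suc (esize x)" P]) (use assms in \<open>auto intro: pbounded_intros\<close>)

named_theorems polytime_intros

lemma polytime_id [polytime_intros]: "polytime (\<lambda>x. x)"
  by (rule polytime_basic[of Ident]) (rule runs.Ident)

lemma polytime_comp:
  assumes "polytime g" "polytime f"
  shows "polytime (\<lambda>x. g (f x))"
proof -
  obtain P S where P: "\<And>x. \<exists>t \<le> S x. runs P (enc x) t (enc (f x))" "pbounded esize S"
    using assms(2) by (rule polytimeE) blast
  obtain Q T where Q: "\<And>x. \<exists>t \<le> T x. runs Q (enc x) t (enc (g x))" "pbounded esize T"
    using assms(1) by (rule polytimeE) blast
  show ?thesis
  proof (rule polytimeI)
    fix x
    obtain s t where "s \<le> S x" "runs P (enc x) s (enc (f x))"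
      "t \<le> T (f x)" "runs Q (enc (f x)) t (enc (g (f x)))"
      using P(1) Q(1) by meson
    then show "\<exists>t \<le> Suc (esize x) + S x + T (f x). runs (Seq P Q) (enc x) t (enc (g (f x)))"
      using runs.Seq by (intro exI[of _ "Suc (esize x) + s + t"]) fastforce
    show "pbounded esize (\<lambda>x. Suc (esize x) + S x + T (f x))"
      by (intro pbounded_intros P(2) pbounded_comp[OF Q(2)] polytime_size assms(2))
  qed
qed

lemma polytime_Pair [polytime_intros]:
  assumes "polytime f" "polytime g"
  shows "polytime (\<lambda>x. (f x, g x))"
proof -
  obtain P S where P: "\<And>x. \<exists>t \<le> S x. runs P (enc x) t (enc (f x))" "pbounded esize S"
    using assms(1) by (rule polytimeE) blast
  obtain Q T where Q: "\<And>x. \<exists>t \<le> T x. runs Q (enc x) t (enc (g x))" "pbounded esize T"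
    using assms(2) by (rule polytimeE) blast
  show ?thesis
  proof (rule polytimeI)
    fix x
    obtain s t where "s \<le> S x" "runs P (enc x) s (enc (f x))"
      "t \<le> T x" "runs Q (enc x) t (enc (g x))"
      using P(1) Q(1) by meson
    then show "\<exists>t \<le> Suc (esize x) + S x + T x. runs (Fork P Q) (enc x) t (enc (f x, g x))"
      using runs.Fork by (intro exI[of _ "Suc (esize x) + s + t"]) fastforce
    show "pbounded esize (\<lambda>x. Suc (esize x) + S x + T x)"
      by (intro pbounded_intros P(2) Q(2))
  qed
qed

lemma polytime_app2:
  assumes "polytime (\<lambda>p. f (fst p) (snd p))" "polytime a" "polytime b"
  shows "polytime (\<lambda>x. f (a x) (b x))"
  using polytime_comp[OF assms(1) polytime_Pair[OF assms(2,3)]] by simp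

lemma polytime_app3:
  assumes "polytime (\<lambda>p. f (fst p) (fst (snd p)) (snd (snd p)))" "polytime a" "polytime b" "polytime c"
  shows "polytime (\<lambda>x. f (a x) (b x) (c x))"
  using polytime_comp[OF assms(1) polytime_Pair[OF assms(2) polytime_Pair[OF assms(3,4)]]] by simp

lemma polytime_fst [polytime_intros]:
  assumes "polytime f"
  shows "polytime (\<lambda>x. fst (f x))"
proof (rule polytime_comp[OF _ assms], rule polytime_basic)
  fix p :: "'b \<times> 'c"
  show "runs Left (enc p) (Suc (esize p)) (enc (fst p))"
    using runs.Left[of "enc p"] by (cases p) auto
qed

lemma polytime_snd [polytime_intros]:
  assumes "polytime f"
  shows "polytime (\<lambda>x. snd (f x))"
proof (rule polytime_comp[OF _ assms], rule polytime_basic)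
  fix p :: "'b \<times> 'c"
  show "runs Right (enc p) (Suc (esize p)) (enc (snd p))"
    using runs.Right[of "enc p"] by (cases p) auto
qed

lemma runs_constant: "\<exists>P c. \<forall>x. \<exists>t \<le> c * Suc (size x). runs P x t v"
proof (induction v)
  case Atom
  show ?case by (intro exI[of _ Nought] exI[of _ 1]) (auto intro: runs.Nought)
next
  case (Pair v w)
  obtain P c where P: "\<forall>x. \<exists>t \<le> c * Suc (size x). runs P x t v" using Pair by blast
  obtain Q c' where Q: "\<forall>x. \<exists>t \<le> c' * Suc (size x). runs Q x t w" using Pair by blast
  have "\<exists>t \<le> (Suc (c + c')) * Suc (size x). runs (Fork P Q) x t (Pair v w)" for x
  proof -
    obtain s t where "s \<le> c * Suc (size x)" "runs P x s v" "t \<le> c' * Suc (size x)" "runs Q x t w"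
      using P Q by meson
    then show ?thesis
      using runs.Fork by (intro exI[of _ "Suc (size x) + s + t"]) (fastforce simp: algebra_simps)
  qed
  then show ?case by blast
qed

lemma polytime_const [polytime_intros]: "polytime (\<lambda>x. c)"
proof -
  obtain P n where "\<forall>x. \<exists>t \<le> n * Suc (size x). runs P x t (enc c)"
    using runs_constant by blast
  then show ?thesis
    by (intro polytimeI[of "\<lambda>x. n * Suc (esize x)" P] pbounded_intros) auto
qed

text \<open>Comparing encodings decides equality of values because \<open>enc\<close> is
  injective.\<close>

lemma polytime_eq [polytime_intros]:
  assumes "polytime f" "polytime g"
  shows "polytime (\<lambda>x. f x = g x)"
proof (rule polytime_app2[OF _ assms], rule polytime_basic)
  fix p :: "'b \<times> 'b"
  show "runs Same (enc p) (Suc (esize p)) (enc (fst p = snd p))"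
    using runs.Same[of "enc p"] by (cases p) (auto simp: same_def split: if_splits)
qed

lemma polytime_if [polytime_intros]:
  assumes "polytime b" "polytime f" "polytime g"
  shows "polytime (\<lambda>x. if b x then f x else g x)"
proof -
  obtain B R where B: "\<And>x. \<exists>t \<le> R x. runs B (enc x) t (enc (b x))" "pbounded esize R"
    using assms(1) by (rule polytimeE) blast
  obtain P S where P: "\<And>x. \<exists>t \<le> S x. runs P (enc x) t (enc (f x))" "pbounded esize S"
    using assms(2) by (rule polytimeE) blast
  obtain Q T where Q: "\<And>x. \<exists>t \<le> T x. runs Q (enc x) t (enc (g x))" "pbounded esize T"
    using assms(3) by (rule polytimeE) blast
  show ?thesis
  proof (rule polytimeI)
    fix x
    obtain r s t where *: "r \<le> R x" "runs B (enc x) r (enc (b x))" "s \<le> S x"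
      "runs P (enc x) s (enc (f x))" "t \<le> T x" "runs Q (enc x) t (enc (g x))"
      using B(1) P(1) Q(1) by meson
    show "\<exists>t \<le> Suc (esize x) + R x + (S x + T x).
        runs (Cond B P Q) (enc x) t (enc (if b x then f x else g x))"
    proof (cases "b x")
      case True
      with * have "runs (Cond B P Q) (enc x) (Suc (esize x) + r + s) (enc (f x))"
        by (intro runs.Cond_true) auto
      with True * show ?thesis by (intro exI[of _ "Suc (esize x) + r + s"]) auto
    next
      case False
      with * have "runs (Cond B P Q) (enc x) (Suc (esize x) + r + t) (enc (g x))"
        by (intro runs.Cond_false) auto
      with False * show ?thesis by (intro exI[of _ "Suc (esize x) + r + t"]) auto
    qed
    show "pbounded esize (\<lambda>x. Suc (esize x) + R x + (S x + T x))"
      by (intro pbounded_intros P(2) Q(2) B(2))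
  qed
qed

lemma polytime_not [polytime_intros]: "polytime b \<Longrightarrow> polytime (\<lambda>x. \<not> b x)"
  using polytime_if[of b "\<lambda>_. False" "\<lambda>_. True"]
  by (simp add: polytime_const if_bool_eq_conj)

lemma polytime_conj [polytime_intros]:
  assumes "polytime a" "polytime b"
  shows "polytime (\<lambda>x. a x \<and> b x)"
proof -
  have "(\<lambda>x. a x \<and> b x) = (\<lambda>x. if a x then b x else False)" by auto
  then show ?thesis using assms by (simp only: polytime_if polytime_const)
qed

lemma polytime_disj [polytime_intros]:
  assumes "polytime a" "polytime b"
  shows "polytime (\<lambda>x. a x \<or> b x)"
proof -
  have "(\<lambda>x. a x \<or> b x) = (\<lambda>x. if a x then True else b x)" by auto
  then show ?thesis using assms by (simp only: polytime_if polytime_const)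
qed

lemma polytime_imp [polytime_intros]:
  assumes "polytime a" "polytime b"
  shows "polytime (\<lambda>x. a x \<longrightarrow> b x)"
proof -
  have "(\<lambda>x. a x \<longrightarrow> b x) = (\<lambda>x. if a x then b x else True)" by auto
  then show ?thesis using assms by (simp only: polytime_if polytime_const)
qed

text \<open>A nonempty list and the pair of its head and tail have the same encoding, so
  \<open>Ident\<close> suffices.\<close>

lemma polytime_Cons [polytime_intros]:
  assumes "polytime f" "polytime g"
  shows "polytime (\<lambda>x. f x # g x)"
proof (rule polytime_app2[OF _ assms], rule polytime_basic)
  fix p :: "'b \<times> 'b list"
  show "runs Ident (enc p) (Suc (esize p)) (enc (fst p # snd p))"
    using runs.Ident[of "enc p"] by (cases p) auto
qed

lemma polytime_Some [polytime_intros]: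
  assumes "polytime f"
  shows "polytime (\<lambda>x. Some (f x))"
proof -
  have "polytime (\<lambda>p :: unit \<times> 'b. Some (snd p))"
  proof (rule polytime_basic)
    fix p :: "unit \<times> 'b"
    show "runs Ident (enc p) (Suc (esize p)) (enc (Some (snd p)))"
      using runs.Ident[of "enc p"] by (cases p) auto
  qed
  from polytime_comp[OF this polytime_Pair[OF polytime_const[of "()"] assms]]
  show ?thesis by simp
qed

lemma polytime_tl [polytime_intros]:
  assumes "polytime f"
  shows "polytime (\<lambda>x. tl (f x))"
proof (rule polytime_comp[OF _ assms], rule polytime_basic)
  fix p :: "'b list"
  show "runs Right (enc p) (Suc (esize p)) (enc (tl p))"
    using runs.Right[of "enc p"] by (cases p) auto
qed

text \<open>The encoded list is its own test, since exactly the empty list is \<open>Atom\<close>. A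
  nonempty one already is the pair \<open>(y, ys)\<close>, so \<open>Fork Ident B\<close> yields the
  argument \<open>(x, y, ys)\<close> of the branch.\<close>

lemma polytime_case_list [polytime_intros]:
  fixes l :: "'a :: encodable \<Rightarrow> 'b :: encodable list"
  assumes "polytime l" "polytime f" "polytime (\<lambda>p. g (fst p) (fst (snd p)) (snd (snd p)))"
  shows "polytime (\<lambda>x. case l x of [] \<Rightarrow> f x | y # ys \<Rightarrow> g x y ys)"
proof -
  obtain B R where B: "\<And>x. \<exists>t \<le> R x. runs B (enc x) t (enc (l x))" "pbounded esize R"
    using assms(1) by (rule polytimeE) blast
  obtain P S where P: "\<And>x. \<exists>t \<le> S x. runs P (enc x) t (enc (f x))" "pbounded esize S"
    using assms(2) by (rule polytimeE) blast
  obtain Q T where Q: "\<And>p. \<exists>t \<le> T p. runs Q (enc p) t (enc (g (fst p) (fst (snd p)) (snd (snd p))))"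
      "pbounded esize T"
    using assms(3) by (rule polytimeE) blast
  obtain q where q: "\<And>p. T p \<le> poly q (esize p)" using Q(2) unfolding pbounded_def by blast
  let ?Q = "Seq (Fork Ident B) Q"
  let ?C = "\<lambda>x. Suc (esize x) + (Suc (esize x) + Suc (esize x) + R x)
    + poly q (Suc (esize x + esize (l x)))"
  show ?thesis
  proof (rule polytimeI)
    fix x
    obtain r s where *: "r \<le> R x" "runs B (enc x) r (enc (l x))" "s \<le> S x"
      "runs P (enc x) s (enc (f x))"
      using B(1) P(1) by meson
    show "\<exists>t \<le> Suc (esize x) + R x + (S x + ?C x).
        runs (Cond B ?Q P) (enc x) t (enc (case l x of [] \<Rightarrow> f x | y # ys \<Rightarrow> g x y ys))"
    proof (cases "l x")
      case Nil
      with * have "runs (Cond B ?Q P) (enc x) (Suc (esize x) + r + s) (enc (f x))"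
        by (intro runs.Cond_false) auto
      with Nil * show ?thesis by (intro exI[of _ "Suc (esize x) + r + s"]) auto
    next
      case (Cons y ys)
      obtain t where t: "t \<le> T (x, y, ys)" "runs Q (enc (x, y, ys)) t (enc (g x y ys))"
        using Q(1)[of "(x, y, ys)"] by auto
      have "t \<le> poly q (Suc (esize x + esize (l x)))"
        using t(1) q[of "(x, y, ys)"] Cons by simp
      moreover have "runs (Cond B ?Q P) (enc x) (Suc (esize x) + r +
          (Suc (esize x) + (Suc (esize x) + Suc (esize x) + r) + t)) (enc (g x y ys))"
        using runs.Cond_true[OF *(2) _ runs.Seq[OF runs.Fork[OF runs.Ident *(2)]], of Q t] t(2) Cons
        by simp
      ultimately show ?thesis using Cons * by (intro exI conjI) auto
    qed
    show "pbounded esize (\<lambda>x. Suc (esize x) + R x + (S x + ?C x))"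
      by (intro pbounded_intros P(2) B(2) polytime_size assms(1))
  qed
qed

section \<open>Iteration over lists\<close>

lemma esize_fold:
  assumes "\<And>y a. esize (h y a) \<le> esize a + c y" "\<And>y. y \<in> set ys \<Longrightarrow> c y \<le> b"
  shows "esize (fold h ys a) \<le> esize a + length ys * b"
  using assms(2)
proof (induction ys arbitrary: a)
  case (Cons y ys)
  have "esize (fold h (y # ys) a) \<le> esize (h y a) + length ys * b"
    using Cons by simp
  also have "\<dots> \<le> esize a + b + length ys * b"
    using assms(1)[of y a] Cons.prems[of y] by simp
  finally show ?case by simp
qed simp

text \<open>The additive growth condition keeps the accumulator polynomially bounded; iterating a merely
  polynomial growth could square the accumulator in every round.\<close>

lemma polytime_fold:
  fixes h :: "'a :: encodable \<Rightarrow> 'b :: encodable \<Rightarrow> 'c :: encodable \<Rightarrow> 'c"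
  assumes l: "polytime l" and z: "polytime z"
    and h: "polytime (\<lambda>p. h (fst p) (fst (snd p)) (snd (snd p)))"
    and growth: "pbounded esize c" "\<And>x y a. esize (h x y a) \<le> esize a + c (x, y)"
  shows "polytime (\<lambda>x. fold (h x) (l x) (z x))"
proof -
  \<comment> \<open>The loop state holds the remaining list, the accumulator and the fixed input.
    Typing the remaining list as a head-tail pair makes \<open>body\<close> total without changing
    the encoding.\<close>
  define body :: "('b \<times> 'b list) \<times> 'c \<times> 'a \<Rightarrow> 'b list \<times> 'c \<times> 'a"
    where "body = (\<lambda>p. (snd (fst p), h (snd (snd p)) (fst (fst p)) (fst (snd p)), snd (snd p)))"
  have "polytime body"
    unfolding body_def by (intro polytime_intros polytime_app3[OF h])
  then obtain P T where P: "\<And>p. \<exists>t \<le> T p. runs P (enc p) t (enc (body p))" "pbounded esize T"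
    by (rule polytimeE) blast
  obtain q where q: "\<And>p. T p \<le> poly q (esize p)" using P(2) unfolding pbounded_def by blast
  obtain r where r: "\<And>p. c p \<le> poly r (esize p)" using growth(1) unfolding pbounded_def by blast
  define W where "W = While Left P"
  \<comment> \<open>\<open>D x\<close> bounds the growth per round, \<open>B x\<close> the size of
    every loop state, \<open>K x\<close> the cost of a round. The final failing test accounts for
    the \<open>Suc\<close> in \<open>Suc (length ys)\<close>.\<close>
  define D where "D x = poly r (Suc (esize x + esize (l x)))" for x
  define B where "B x = Suc (Suc (esize (l x) + (esize (z x) + length (l x) * D x) + esize x))" for x
  define K where "K x = Suc (B x) + Suc (B x) + poly q (B x)" for x
  have loop: "\<exists>t \<le> Suc (length ys) * K x.
      runs W (enc (ys, fold (h x) us (z x), x)) t (enc ([] :: 'b list, fold (h x) (l x) (z x), x))"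
    if "l x = us @ ys" for x us ys
    using that
  proof (induction ys arbitrary: us)
    case Nil
    let ?s = "enc ([] :: 'b list, fold (h x) (l x) (z x), x)"
    have test: "runs Left ?s (Suc (size ?s)) Atom"
      using runs.Left[of ?s] by simp
    have "size ?s \<le> B x"
      using esize_fold[of "h x" "\<lambda>y. c (x, y)" "l x" "D x" "z x"] growth(2)
        order_trans[OF r poly_mono_nat] by (force simp: D_def B_def dest: esize_member)
    moreover have "runs W ?s (Suc (size ?s) + Suc (size ?s)) ?s"
      unfolding W_def by (rule runs.While_false[OF test])
    moreover have "us = l x" using Nil by simp
    ultimately show ?case
      by (intro exI[of _ "Suc (size ?s) + Suc (size ?s)"]) (simp add: K_def)
  next
    case (Cons y ys)
    let ?a = "fold (h x) us (z x)"
    let ?s = "enc (y # ys, ?a, x)"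
    have test: "runs Left ?s (Suc (size ?s)) (enc (y, ys))"
      using runs.Left[of ?s] by simp
    have c: "c (x, u) \<le> D x" if "u \<in> set us" for u
      unfolding D_def using that Cons.prems
      by (intro order_trans[OF r poly_mono_nat]) (auto dest!: esize_member)
    have "esize ?a \<le> esize (z x) + length us * D x"
      by (rule esize_fold[of "h x" "\<lambda>y. c (x, y)"]) (use growth(2) c in auto)
    also have "\<dots> \<le> esize (z x) + length (l x) * D x"
      using Cons.prems by (intro add_left_mono mult_right_mono) auto
    finally have s: "size ?s \<le> B x" using Cons.prems by (simp add: B_def)
    obtain t where t: "t \<le> T ((y, ys), ?a, x)" "runs P ?s t (enc (ys, fold (h x) (us @ [y]) (z x), x))"
      using P(1)[of "((y, ys), ?a, x)"] by (auto simp: body_def)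
    have "t \<le> poly q (B x)"
      using t(1) q[of "((y, ys), ?a, x)"] poly_mono_nat[OF s, of q] by simp
    moreover obtain u where u: "u \<le> Suc (length ys) * K x"
      "runs W (enc (ys, fold (h x) (us @ [y]) (z x), x)) u (enc ([] :: 'b list, fold (h x) (l x) (z x), x))"
      using Cons.IH[of "us @ [y]"] Cons.prems by auto
    moreover have "runs W ?s (Suc (size ?s) + Suc (size ?s) + t + u)
        (enc ([] :: 'b list, fold (h x) (l x) (z x), x))"
      unfolding W_def using u(2) by (intro runs.While_true[OF test _ t(2)]) (auto simp: W_def)
    ultimately show ?case using s
      by (intro exI[of _ "Suc (size ?s) + Suc (size ?s) + t + u"]) (auto simp: K_def)
  qed
  have "polytime (\<lambda>x. (l x, z x, x))"
    by (intro polytime_intros l z)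
  moreover have "polytime (\<lambda>x. ([] :: 'b list, fold (h x) (l x) (z x), x))"
  proof -
    obtain Q S where Q: "\<And>x. \<exists>t \<le> S x. runs Q (enc x) t (enc (l x, z x, x))" "pbounded esize S"
      using \<open>polytime (\<lambda>x. (l x, z x, x))\<close> by (rule polytimeE) blast
    show ?thesis
    proof (rule polytimeI)
      fix x
      obtain s where "s \<le> S x" "runs Q (enc x) s (enc (l x, z x, x))" using Q(1) by blast
      moreover obtain t where "t \<le> Suc (length (l x)) * K x"
        "runs W (enc (l x, z x, x)) t (enc ([] :: 'b list, fold (h x) (l x) (z x), x))"
        using loop[of x "[]" "l x"] by auto
      ultimately show "\<exists>t \<le> Suc (esize x) + S x + Suc (length (l x)) * K x.
          runs (Seq Q W) (enc x) t (enc ([] :: 'b list, fold (h x) (l x) (z x), x))"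
        using runs.Seq by (intro exI[of _ "Suc (esize x) + s + t"]) fastforce
      have len: "pbounded esize (\<lambda>x. length (l x))"
        by (rule pbounded_mono[OF polytime_size[OF l] length_le_esize])
      show "pbounded esize (\<lambda>x. Suc (esize x) + S x + Suc (length (l x)) * K x)"
        unfolding K_def B_def D_def
        by (intro pbounded_intros Q(2) len polytime_size l z)
    qed
  qed
  ultimately have "polytime (\<lambda>x. fst (snd ([] :: 'b list, fold (h x) (l x) (z x), x)))"
    by (intro polytime_fst polytime_snd)
  then show ?thesis by simp
qed

section \<open>List operations and bounded quantifiers as iterations\<close>

lemma polytime_rev [polytime_intros]:
  assumes "polytime l"
  shows "polytime (\<lambda>x. rev (l x))"
proof -
  have "polytime (\<lambda>x. fold (\<lambda>y a. y # a) (l x) [])"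
    by (rule polytime_fold[OF assms, where c = "\<lambda>p. Suc (esize (snd p))"])
      (intro polytime_intros pbounded_intros polytime_size | simp)+
  then show ?thesis by (simp add: fold_Cons_rev)
qed

lemma polytime_append [polytime_intros]:
  assumes "polytime l" "polytime m"
  shows "polytime (\<lambda>x. l x @ m x)"
proof -
  have "polytime (\<lambda>x. fold (\<lambda>y a. y # a) (rev (l x)) (m x))"
    by (rule polytime_fold[OF polytime_rev[OF assms(1)] assms(2), where c = "\<lambda>p. Suc (esize (snd p))"])
      (intro polytime_intros pbounded_intros polytime_size | simp)+
  then show ?thesis by (simp add: fold_Cons_rev)
qed

lemma polytime_map [polytime_intros]:
  assumes "polytime (\<lambda>p. f (fst p) (snd p))" "polytime l"
  shows "polytime (\<lambda>x. map (f x) (l x))"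
proof -
  have "polytime (\<lambda>x. fold (\<lambda>y a. f x y # a) (l x) [])"
    by (rule polytime_fold[OF assms(2), where c = "\<lambda>p. Suc (esize (f (fst p) (snd p)))"])
      (intro polytime_intros polytime_app2[OF assms(1)] pbounded_intros polytime_size | simp)+
  moreover have "fold (\<lambda>y a. g y # a) xs zs = rev (map g xs) @ zs" for g :: "'b \<Rightarrow> 'c" and xs zs
    by (induction xs arbitrary: zs) auto
  ultimately have "polytime (\<lambda>x. rev (map (f x) (l x)))" by simp
  from polytime_rev[OF this] show ?thesis by simp
qed

lemma polytime_filter [polytime_intros]:
  assumes "polytime (\<lambda>p. f (fst p) (snd p))" "polytime l"
  shows "polytime (\<lambda>x. filter (f x) (l x))"
proof -
  have "polytime (\<lambda>x. fold (\<lambda>y a. if f x y then y # a else a) (l x) [])"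
    by (rule polytime_fold[OF assms(2), where c = "\<lambda>p. Suc (esize (snd p))"])
      (intro polytime_intros polytime_app2[OF assms(1)] pbounded_intros polytime_size | simp)+
  moreover have "fold (\<lambda>y a. if g y then y # a else a) xs zs = rev (filter g xs) @ zs"
    for g :: "'b \<Rightarrow> bool" and xs zs
    by (induction xs arbitrary: zs) auto
  ultimately have "polytime (\<lambda>x. rev (filter (f x) (l x)))" by simp
  from polytime_rev[OF this] show ?thesis by simp
qed

lemma polytime_concat [polytime_intros]:
  assumes "polytime l"
  shows "polytime (\<lambda>x. concat (l x))"
proof -
  have "polytime (\<lambda>x. fold (\<lambda>y a. a @ y) (l x) [])"
    by (rule polytime_fold[OF assms, where c = "\<lambda>p. esize (snd p)"])
      (intro polytime_intros pbounded_intros polytime_size | simp)+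
  moreover have "fold (\<lambda>y a. a @ y) xs zs = zs @ concat xs" for xs :: "'b list list" and zs
    by (induction xs arbitrary: zs) auto
  ultimately show ?thesis by simp
qed

lemma polytime_Bex [polytime_intros]:
  assumes "polytime (\<lambda>p. f (fst p) (snd p))" "polytime l"
  shows "polytime (\<lambda>x. \<exists>y \<in> set (l x). f x y)"
proof -
  have "polytime (\<lambda>x. filter (f x) (l x) \<noteq> [])"
    by (intro polytime_intros assms)
  then show ?thesis by (simp add: filter_empty_conv)
qed

lemma polytime_Ball [polytime_intros]:
  assumes "polytime (\<lambda>p. f (fst p) (snd p))" "polytime l"
  shows "polytime (\<lambda>x. \<forall>y \<in> set (l x). f x y)"
proof -
  have "polytime (\<lambda>x. \<not> (\<exists>y \<in> set (l x). \<not> f x y))"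
    by (intro polytime_intros assms)
  then show ?thesis by simp
qed

lemma polytime_member [polytime_intros]:
  assumes "polytime f" "polytime l"
  shows "polytime (\<lambda>x. f x \<in> set (l x))"
proof -
  have "polytime (\<lambda>x. \<exists>y \<in> set (l x). y = f x)"
    by (intro polytime_intros polytime_comp[OF assms(1)] assms(2))
  then show ?thesis by simp
qed

lemma polytime_subset [polytime_intros]:
  assumes "polytime l" "polytime m"
  shows "polytime (\<lambda>x. set (l x) \<subseteq> set (m x))"
proof -
  have "polytime (\<lambda>x. \<forall>y \<in> set (l x). y \<in> set (m x))"
    by (intro polytime_intros polytime_comp[OF assms(2)] assms(1))
  then show ?thesis by (simp add: subset_iff Ball_def)
qed

text \<open>Dropping one entry of the second list per entry of the first leaves something exactly if
  the second is longer, so lengths are compared without counters.\<close>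

lemma polytime_length_less [polytime_intros]:
  assumes "polytime l" "polytime m"
  shows "polytime (\<lambda>x. length (l x) < length (m x))"
proof -
  have "esize (tl a) \<le> esize a" for a :: "'c list"
    by (cases a) auto
  then have "polytime (\<lambda>x. fold (\<lambda>_ a. tl a) (l x) (m x))"
    by (intro polytime_fold[OF assms(1,2), where c = "\<lambda>_. 0"])
      (intro polytime_intros pbounded_intros | simp)+
  then have "polytime (\<lambda>x. fold (\<lambda>_ a. tl a) (l x) (m x) \<noteq> [])"
    by (intro polytime_intros)
  moreover have "fold (\<lambda>_ a. tl a) xs ys = drop (length xs) ys" for xs :: "'b list" and ys :: "'c list"
    by (induction xs arbitrary: ys) (auto simp: drop_Suc)
  ultimately show ?thesis by (simp add: not_le)
qed

lemma polytime_length_eq [polytime_intros]: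
  assumes "polytime l" "polytime m"
  shows "polytime (\<lambda>x. length (l x) = length (m x))"
proof -
  have "polytime (\<lambda>x. \<not> length (l x) < length (m x) \<and> \<not> length (m x) < length (l x))"
    by (intro polytime_intros assms)
  then show ?thesis by (simp add: linorder_neq_iff[symmetric] not_less order_eq_iff conj_commute)
qed

section \<open>Binary numbers against lengths of lists\<close>

fun bits :: "nat \<Rightarrow> bool list" where
  "bits n = (if n = 0 then [] else odd n # bits (n div 2))"

declare bits.simps [simp del]

text \<open>A number and the list of its digits are the same tree, so digits are available to list
  iteration without conversion.\<close>

lemma enc_bits: "enc (bits n) = enc n"
proof (induction n rule: less_induct)
  case (less n)
  then show ?case
    by (subst bits.simps) (simp add: enc_nat_eq enc_bool_eq enc_nat.simps[of n])
qed

lemma esize_unit_list [simp]: "esize (us :: unit list) = length us"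
  by (induction us) auto

text \<open>\<open>k\<close> may be exponential in the input size, so its binary digits are only expanded to a unary list
  truncated at \<open>length c + 1\<close>.\<close>

definition capped :: "'a list \<Rightarrow> bool list \<Rightarrow> unit list" where
  "capped c bs = fold (\<lambda>b v. if length c < length (v @ v @ (if b then [()] else []))
     then () # map (\<lambda>_. ()) c else v @ v @ (if b then [()] else [])) (rev bs) []"

text \<open>This is Horner evaluation from the most significant digit. A value above the cap stays
  above it when doubled, so truncating in every round agrees with truncating once at the
  end.\<close>

lemma length_capped_bits: "length (capped c (bits n)) = min n (Suc (length c))"
proof (induction n rule: less_induct)
  case (less n)
  show ?case
  proof (cases "n = 0")
    case True
    then show ?thesis by (subst bits.simps) (simp add: capped_def)
  next
    case False
    define w where "w = capped c (bits (n div 2))"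
    have "length w = min (n div 2) (Suc (length c))"
      unfolding w_def using less.IH[of "n div 2"] False by simp
    moreover have "capped c (bits n) = (if length c < length (w @ w @ (if odd n then [()] else []))
        then () # map (\<lambda>_. ()) c else w @ w @ (if odd n then [()] else []))"
      using False by (subst bits.simps) (simp add: capped_def w_def)
    moreover have "n = n div 2 + n div 2 + (if odd n then 1 else 0)" by presburger
    ultimately show ?thesis by (cases "odd n") (simp_all add: min_def)
  qed
qed

lemma polytime_capped:
  fixes l :: "'a :: encodable \<Rightarrow> 'b :: encodable list"
  assumes "polytime l" "polytime b"
  shows "polytime (\<lambda>x. capped (l x) (b x))"
  unfolding capped_def
proof (rule polytime_fold[where c = "\<lambda>p. Suc (esize (l (fst p)))"], goal_cases)
  \<comment> \<open>The new accumulator has at most \<open>length (l x) + 1\<close> entries whatever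
    \<open>a\<close> is; plain doubling would violate the additive growth condition.\<close>
  case (5 x y a)
  show ?case using length_le_esize[of "l x"] by (cases y) auto
qed (intro polytime_intros assms polytime_comp[OF assms(1)] pbounded_intros polytime_size)+

lemma polytime_le_length [polytime_intros]:
  fixes k :: "'a :: encodable \<Rightarrow> int" and l :: "'a \<Rightarrow> 'b :: encodable list"
  assumes "polytime k" "polytime l"
  shows "polytime (\<lambda>x. k x \<le> int (length (l x)))"
proof -
  have "polytime (\<lambda>k :: int. k < 0)"
  proof (rule polytime_basic)
    fix k :: int
    show "runs Left (enc k) (Suc (esize k)) (enc (k < 0))"
      using runs.Left[of "enc k"] by (simp add: enc_int_eq enc_int_def enc_bool_eq)
  qed
  moreover have "polytime (\<lambda>k :: int. bits (nat \<bar>k\<bar>))"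
  proof (rule polytime_basic)
    fix k :: int
    show "runs Right (enc k) (Suc (esize k)) (enc (bits (nat \<bar>k\<bar>)))"
      using runs.Right[of "enc k"] unfolding enc_bits by (simp add: enc_int_eq enc_int_def enc_nat_eq)
  qed
  \<comment> \<open>A value capped at one more than \<open>length (l x)\<close> still shows whether
    it exceeds that length.\<close>
  ultimately have "polytime (\<lambda>x. k x < 0 \<or> \<not> length (l x) < length (capped (l x) (bits (nat \<bar>k x\<bar>))))"
    by (intro polytime_intros polytime_capped polytime_comp[OF _ assms(1)] assms(2))
  moreover have "k x < 0 \<or> \<not> length (l x) < length (capped (l x) (bits (nat \<bar>k x\<bar>)))
      \<longleftrightarrow> k x \<le> int (length (l x))" for x
    unfolding length_capped_bits by (auto simp: min_def)
  ultimately show ?thesis by simp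
qed

section \<open>The kernelization algorithm\<close>

text \<open>The result is a sunflower with core \<open>C\<close> that no member of \<open>F\<close>
  containing \<open>C\<close> can extend. With core \<open>[]\<close> it is a maximal
  packing.\<close>

definition greedy :: "nat list \<Rightarrow> nat list list \<Rightarrow> nat list list" where
  "greedy C F = fold (\<lambda>S L. if set C \<subseteq> set S \<and> (\<forall>T \<in> set L. \<forall>x \<in> set S. x \<in> set T \<longrightarrow> x \<in> set C)
     then S # L else L) F []"

fun cores :: "nat \<Rightarrow> nat list \<Rightarrow> nat list list" where
  "cores 0 E = [[]]"
| "cores (Suc n) E = cores n E @ concat (map (\<lambda>x. map (\<lambda>C. x # C) (cores n E)) E)"

definition candidates :: "nat list \<Rightarrow> nat list \<Rightarrow> nat list \<Rightarrow> nat list list \<Rightarrow> nat list list" where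
  "candidates W C S F = filter (\<lambda>T. \<forall>x \<in> set T. x \<in> set W \<longrightarrow> x \<in> set C)
     (greedy C (filter (\<lambda>T. length T = length S) F))"

text \<open>Shares are compared only on parts meeting the core. There are at most as many such parts
  as core elements, so the number of classes depends on \<open>d\<close> alone.\<close>

definition similar :: "nat list list \<Rightarrow> nat list \<Rightarrow> nat list \<Rightarrow> nat list \<Rightarrow> bool" where
  "similar Us C S T \<longleftrightarrow> (\<forall>U \<in> set Us. (\<exists>x \<in> set C. x \<in> set U) \<longrightarrow>
     length (filter (\<lambda>x. x \<in> set U) S) = length (filter (\<lambda>x. x \<in> set U) T))"

text \<open>Only the length of \<open>m\<close> matters: thresholds are unary lists. \<open>W\<close> lists the elements that petals
  must avoid, \<open>Cs\<close> the cores to be tried.\<close>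

definition redundant ::
    "nat list list \<Rightarrow> nat list \<Rightarrow> nat list \<Rightarrow> nat list list \<Rightarrow> nat list list \<Rightarrow> nat list \<Rightarrow> bool" where
  "redundant Us W m Cs F S \<longleftrightarrow> (\<exists>C \<in> set Cs. S \<in> set (candidates W C S F) \<and>
     length m < length (filter (\<lambda>T. similar Us C S T) (candidates W C S F)))"

text \<open>Sets go one at a time, because each deletion can shrink the sunflowers that made other
  sets redundant.\<close>

definition prune_step ::
    "nat list list \<Rightarrow> nat list \<Rightarrow> nat list \<Rightarrow> nat list list \<Rightarrow> nat list list \<Rightarrow> nat list list" where
  "prune_step Us W m Cs F = (case filter (\<lambda>S. redundant Us W m Cs F S) F of [] \<Rightarrow> F
     | S # _ \<Rightarrow> filter (\<lambda>T. T \<noteq> S) F)"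

text \<open>The first \<open>F\<close> is a clock: every effective round deletes a set, so as many
  rounds as there are sets reach a fixed point.\<close>

definition prune ::
    "nat list list \<Rightarrow> nat list \<Rightarrow> nat list \<Rightarrow> nat list list \<Rightarrow> nat list list \<Rightarrow> nat list list" where
  "prune Us W m Cs F = fold (\<lambda>_ G. prune_step Us W m Cs G) F F"

definition is_internal :: "nat list list \<Rightarrow> nat list \<Rightarrow> bool" where
  "is_internal Us S \<longleftrightarrow> (\<exists>U \<in> set Us. set S \<subseteq> set U)"

definition max_packing :: "nat list list \<Rightarrow> nat list list" where
  "max_packing Ss = greedy [] (filter (\<lambda>S. S \<noteq> []) Ss)"

definition hitting :: "nat list list \<Rightarrow> nat list" where
  "hitting Ss = concat (max_packing Ss)"

definition reduced_internal :: "nat \<Rightarrow> nat list list \<Rightarrow> nat list list \<Rightarrow> nat list list" where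
  "reduced_internal d Us Ss = prune Us [] (concat (replicate d (hitting Ss))) (cores d (concat Ss))
     (filter (\<lambda>S. S \<noteq> [] \<and> is_internal Us S) Ss)"

definition reduced :: "nat \<Rightarrow> nat list list \<Rightarrow> nat list list \<Rightarrow> nat list list" where
  "reduced d Us Ss = prune Us (concat (reduced_internal d Us Ss)) (concat (replicate d (hitting Ss)))
     (cores d (concat Ss)) (reduced_internal d Us Ss @ filter (\<lambda>S. S \<noteq> [] \<and> \<not> is_internal Us S) Ss)"

text \<open>The names \<open>2 ^ i - 1\<close> are unary in the given encoding of numbers, so the next name is obtained
  without carry.\<close>

definition name :: "nat list \<Rightarrow> nat \<Rightarrow> nat" where
  "name E x = fold (\<lambda>y n. if y = x then 0 else 2 * n + 1) E 0"

text \<open>Idle elements and parts without used elements do not affect attainability but would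
  spoil the encoding length.\<close>

definition compress :: "nat list list \<Rightarrow> nat list list \<Rightarrow> int \<Rightarrow> nat list \<Rightarrow> desc \<times> nat list" where
  "compress Us G k H =
    ((map (\<lambda>U. map (\<lambda>x. name (concat G) x) U)
        (filter (\<lambda>U. U \<noteq> []) (map (\<lambda>U. filter (\<lambda>x. x \<in> set (concat G)) U) Us)),
      map (\<lambda>S. map (\<lambda>x. name (concat G) x) S) G, k),
     map (\<lambda>x. name (concat G) x) (filter (\<lambda>x. x \<in> set (concat G)) H))"

definition kernel :: "nat \<Rightarrow> desc \<Rightarrow> desc \<times> nat list" where
  "kernel d D = compress (fst D) (reduced d (fst D) (fst (snd D))) (snd (snd D)) (hitting (fst (snd D)))"

definition surely_yes :: "desc \<Rightarrow> bool" where
  "surely_yes D \<longleftrightarrow> snd (snd D) \<le> int (length (max_packing (fst (snd D))))"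

section \<open>Running time of the kernelization\<close>

lemma polytime_greedy [polytime_intros]:
  assumes "polytime C" "polytime F"
  shows "polytime (\<lambda>x. greedy (C x) (F x))"
  unfolding greedy_def
  by (rule polytime_fold[where c = "\<lambda>p. Suc (esize (snd p))"])
    (intro polytime_intros polytime_comp[OF assms(1)] assms pbounded_intros polytime_size | simp)+

lemma polytime_cores [polytime_intros]:
  assumes "polytime E"
  shows "polytime (\<lambda>x. cores n (E x))"
proof -
  have "polytime (cores n)"
  proof (induction n)
    case 0
    show ?case by (simp add: polytime_const)
  next
    case (Suc n)
    show ?case
      unfolding cores.simps by (intro polytime_intros polytime_comp[OF Suc])
  qed
  then show ?thesis by (rule polytime_comp[OF _ assms])
qed

lemma polytime_candidates [polytime_intros]:
  assumes "polytime W" "polytime C" "polytime S" "polytime F"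
  shows "polytime (\<lambda>x. candidates (W x) (C x) (S x) (F x))"
proof -
  have "polytime (\<lambda>p. candidates (fst p) (fst (snd p)) (fst (snd (snd p))) (snd (snd (snd p))))"
    unfolding candidates_def by (intro polytime_intros)
  from polytime_comp[OF this, of "\<lambda>x. (W x, C x, S x, F x)"] show ?thesis
    using assms by (simp add: polytime_Pair)
qed

lemma polytime_similar [polytime_intros]:
  assumes "polytime Us" "polytime C" "polytime S" "polytime T"
  shows "polytime (\<lambda>x. similar (Us x) (C x) (S x) (T x))"
proof -
  have "polytime (\<lambda>p. similar (fst p) (fst (snd p)) (fst (snd (snd p))) (snd (snd (snd p))))"
    unfolding similar_def by (intro polytime_intros)
  from polytime_comp[OF this, of "\<lambda>x. (Us x, C x, S x, T x)"] show ?thesis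
    using assms by (simp add: polytime_Pair)
qed

lemma polytime_redundant [polytime_intros]:
  assumes "polytime Us" "polytime W" "polytime m" "polytime Cs" "polytime F" "polytime S"
  shows "polytime (\<lambda>x. redundant (Us x) (W x) (m x) (Cs x) (F x) (S x))"
proof -
  have "polytime (\<lambda>p. redundant (fst p) (fst (snd p)) (fst (snd (snd p))) (fst (snd (snd (snd p))))
      (fst (snd (snd (snd (snd p))))) (snd (snd (snd (snd (snd p))))))"
    unfolding redundant_def by (intro polytime_intros)
  from polytime_comp[OF this, of "\<lambda>x. (Us x, W x, m x, Cs x, F x, S x)"] show ?thesis
    using assms by (simp add: polytime_Pair)
qed

lemma polytime_prune_step [polytime_intros]:
  assumes "polytime Us" "polytime W" "polytime m" "polytime Cs" "polytime F"
  shows "polytime (\<lambda>x. prune_step (Us x) (W x) (m x) (Cs x) (F x))"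
proof -
  have "polytime (\<lambda>p. prune_step (fst p) (fst (snd p)) (fst (snd (snd p))) (fst (snd (snd (snd p))))
      (snd (snd (snd (snd p)))))"
    unfolding prune_step_def by (intro polytime_intros)
  from polytime_comp[OF this, of "\<lambda>x. (Us x, W x, m x, Cs x, F x)"] show ?thesis
    using assms by (simp add: polytime_Pair)
qed

lemma esize_filter: "esize (filter P xs) \<le> esize xs"
  by (induction xs) auto

text \<open>Pruning only deletes entries, so its iteration meets the growth condition with allowance
  0.\<close>

lemma esize_prune_step: "esize (prune_step Us W m Cs F) \<le> esize F"
  by (auto simp: prune_step_def esize_filter split: list.split)

lemma polytime_prune [polytime_intros]:
  assumes "polytime Us" "polytime W" "polytime m" "polytime Cs" "polytime F"
  shows "polytime (\<lambda>x. prune (Us x) (W x) (m x) (Cs x) (F x))"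
proof -
  have "polytime (\<lambda>p. prune (fst p) (fst (snd p)) (fst (snd (snd p))) (fst (snd (snd (snd p))))
      (snd (snd (snd (snd p)))))"
    unfolding prune_def
    by (rule polytime_fold[where c = "\<lambda>_. 0"])
      (intro polytime_intros pbounded_intros | simp add: esize_prune_step)+
  from polytime_comp[OF this, of "\<lambda>x. (Us x, W x, m x, Cs x, F x)"] show ?thesis
    using assms by (simp add: polytime_Pair)
qed

lemma polytime_is_internal [polytime_intros]:
  assumes "polytime Us" "polytime S"
  shows "polytime (\<lambda>x. is_internal (Us x) (S x))"
  by (rule polytime_app2[OF _ assms]) (unfold is_internal_def, intro polytime_intros)

lemma polytime_max_packing [polytime_intros]:
  assumes "polytime Ss"
  shows "polytime (\<lambda>x. max_packing (Ss x))"
  unfolding max_packing_def by (intro polytime_intros assms)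

lemma polytime_hitting [polytime_intros]:
  assumes "polytime Ss"
  shows "polytime (\<lambda>x. hitting (Ss x))"
  unfolding hitting_def by (intro polytime_intros assms)

lemma polytime_concat_replicate [polytime_intros]:
  assumes "polytime l"
  shows "polytime (\<lambda>x. concat (replicate n (l x)))"
  by (induction n) (simp_all add: polytime_const polytime_append assms)

lemma polytime_reduced_internal [polytime_intros]:
  assumes "polytime Us" "polytime Ss"
  shows "polytime (\<lambda>x. reduced_internal d (Us x) (Ss x))"
  by (rule polytime_app2[OF _ assms])
    (unfold reduced_internal_def, intro polytime_intros)

lemma polytime_reduced [polytime_intros]:
  assumes "polytime Us" "polytime Ss"
  shows "polytime (\<lambda>x. reduced d (Us x) (Ss x))"
  by (rule polytime_app2[OF _ assms]) (unfold reduced_def, intro polytime_intros)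

lemma enc_zero_nat: "enc (0 :: nat) = Atom"
  by (simp add: enc_nat_eq enc_nat.simps)

lemma enc_odd_nat: "enc (2 * n + 1 :: nat) = Pair (enc True) (enc n)"
  by (subst enc_nat_eq, subst enc_nat.simps) (simp add: enc_nat_eq enc_bool_def)

text \<open>With the least significant digit first, \<open>2 * n + 1\<close> is the digit one put in
  front of \<open>n\<close>, that is, the pair of \<open>True\<close> and \<open>n\<close>.\<close>

lemma polytime_odd_nat [polytime_intros]:
  assumes "polytime f"
  shows "polytime (\<lambda>x. 2 * f x + 1 :: nat)"
proof -
  obtain P T where P: "\<And>x. \<exists>t \<le> T x. runs P (enc x) t (enc (True, f x))" "pbounded esize T"
    using polytime_Pair[OF polytime_const assms] by (rule polytimeE) blast
  then show ?thesis by (intro polytimeI[of T P]) (simp_all add: enc_odd_nat[simplified])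
qed

lemma polytime_name [polytime_intros]:
  assumes "polytime E" "polytime y"
  shows "polytime (\<lambda>x. name (E x) (y x))"
proof -
  have "polytime (\<lambda>p. name (fst p) (snd p))"
    unfolding name_def
    by (rule polytime_fold[where c = "\<lambda>_. 2"])
      (intro polytime_intros pbounded_intros | simp add: enc_odd_nat[simplified] enc_zero_nat)+
  then show ?thesis by (rule polytime_app2[OF _ assms])
qed

lemma polytime_compress:
  assumes "polytime Us" "polytime G" "polytime k" "polytime H"
  shows "polytime (\<lambda>x. compress (Us x) (G x) (k x) (H x))"
proof -
  have "polytime (\<lambda>p. compress (fst p) (fst (snd p)) (fst (snd (snd p))) (snd (snd (snd p))))"
    unfolding compress_def by (intro polytime_intros)
  from polytime_comp[OF this, of "\<lambda>x. (Us x, G x, k x, H x)"] show ?thesis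
    using assms by (simp add: polytime_Pair)
qed

lemma polytime_kernel: "polytime (kernel d)"
  unfolding kernel_def by (intro polytime_intros polytime_compress)

lemma polytime_surely_yes: "polytime surely_yes"
  unfolding surely_yes_def by (intro polytime_intros)

section \<open>Rejection-proof packings\<close>

text \<open>A rejection depends on the agent only through its part, so agents are replaced by parts
  and the list of parts by a set.\<close>

definition refuses :: "'a set set \<Rightarrow> 'a set \<Rightarrow> 'a set set \<Rightarrow> bool" where
  "refuses F U X \<longleftrightarrow> (\<exists>R Y. R \<subseteq> X \<and> Y \<subseteq> F \<and> (\<forall>S \<in> Y. S \<subseteq> U) \<and>
     pairwise disjnt ((X - R) \<union> Y) \<and> card (\<Union> X \<inter> U) < card (\<Union> ((X - R) \<union> Y) \<inter> U))"

definition stable :: "'a set set \<Rightarrow> 'a set set \<Rightarrow> 'a set set \<Rightarrow> bool" where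
  "stable Ps F X \<longleftrightarrow> X \<subseteq> F \<and> pairwise disjnt X \<and> (\<forall>U \<in> Ps. \<not> refuses F U X)"

definition attainable :: "'a set set \<Rightarrow> 'a set set \<Rightarrow> int \<Rightarrow> bool" where
  "attainable Ps F k \<longleftrightarrow> (\<exists>X. stable Ps F X \<and> k \<le> int (card (\<Union> X)))"

lemma yes_instance_iff_attainable:
  "yes_instance I \<longleftrightarrow> attainable (set (parts I)) (family I) (target I)"
proof -
  have "rejects I i X \<longleftrightarrow> refuses (family I) (parts I ! i) X" for i X
    by (simp add: rejects_def refuses_def internal_def)
  then have "rejection_proof I X \<longleftrightarrow> stable (set (parts I)) (family I) X" for X
    by (simp add: rejection_proof_def stable_def packing_def all_set_conv_all_nth)
  then show ?thesis by (simp add: yes_instance_def attainable_def)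
qed

lemma refusesI:
  assumes "R \<subseteq> X" "Y \<subseteq> F" "\<And>S. S \<in> Y \<Longrightarrow> S \<subseteq> U" "pairwise disjnt ((X - R) \<union> Y)"
    "card (\<Union> X \<inter> U) < card (\<Union> ((X - R) \<union> Y) \<inter> U)"
  shows "refuses F U X"
  using assms unfolding refuses_def by blast

lemma refusesE:
  assumes "refuses F U X"
  obtains R Y where "R \<subseteq> X" "Y \<subseteq> F" "\<And>S. S \<in> Y \<Longrightarrow> S \<subseteq> U" "pairwise disjnt ((X - R) \<union> Y)"
    "card (\<Union> X \<inter> U) < card (\<Union> ((X - R) \<union> Y) \<inter> U)"
  using assms unfolding refuses_def by blast

lemma refuses_mono: "refuses F U X \<Longrightarrow> F \<subseteq> F' \<Longrightarrow> refuses F' U X"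
  unfolding refuses_def by (meson subset_trans)

lemma pairwise_disjntI:
  "(\<And>S T. S \<in> X \<Longrightarrow> T \<in> X \<Longrightarrow> S \<noteq> T \<Longrightarrow> S \<inter> T = {}) \<Longrightarrow> pairwise disjnt X"
  by (simp add: pairwise_def disjnt_def)

lemma pairwise_disjntD:
  "pairwise disjnt X \<Longrightarrow> S \<in> X \<Longrightarrow> T \<in> X \<Longrightarrow> S \<noteq> T \<Longrightarrow> S \<inter> T = {}"
  by (simp add: pairwise_def disjnt_def)

lemma stable_Diff_empty: "stable Ps F X \<Longrightarrow> stable Ps (F - {{}}) (X - {{}})"
proof -
  assume X: "stable Ps F X"
  have "\<not> refuses (F - {{}}) U (X - {{}})" if "U \<in> Ps" for U
  proof
    assume "refuses (F - {{}}) U (X - {{}})"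
    then obtain R Y where RY: "R \<subseteq> X - {{}}" "Y \<subseteq> F - {{}}" "\<And>S. S \<in> Y \<Longrightarrow> S \<subseteq> U"
      "pairwise disjnt ((X - {{}} - R) \<union> Y)"
      "card (\<Union> (X - {{}}) \<inter> U) < card (\<Union> ((X - {{}} - R) \<union> Y) \<inter> U)"
      by (rule refusesE) blast
    have "refuses F U X"
    proof (rule refusesI)
      show "pairwise disjnt (X - R \<union> Y)"
        using RY(4) unfolding pairwise_def disjnt_def by blast
      have "\<Union> (X - {{}}) = \<Union> X" "\<Union> ((X - {{}} - R) \<union> Y) = \<Union> ((X - R) \<union> Y)" by auto
      then show "card (\<Union> X \<inter> U) < card (\<Union> ((X - R) \<union> Y) \<inter> U)" using RY(5) by simp
    qed (use RY in auto)
    then show False using X that by (auto simp: stable_def)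
  qed
  then show ?thesis using X by (auto simp: stable_def pairwise_def)
qed

lemma stable_from_Diff_empty: "stable Ps (F - {{}}) X \<Longrightarrow> stable Ps F X"
proof -
  assume X: "stable Ps (F - {{}}) X"
  have "\<not> refuses F U X" if "U \<in> Ps" for U
  proof
    assume "refuses F U X"
    then obtain R Y where RY: "R \<subseteq> X" "Y \<subseteq> F" "\<And>S. S \<in> Y \<Longrightarrow> S \<subseteq> U"
      "pairwise disjnt ((X - R) \<union> Y)" "card (\<Union> X \<inter> U) < card (\<Union> ((X - R) \<union> Y) \<inter> U)"
      by (rule refusesE) blast
    have "refuses (F - {{}}) U X"
    proof (rule refusesI)
      show "pairwise disjnt (X - R \<union> (Y - {{}}))"
        using RY(4) by (rule pairwise_subset) auto
      have "\<Union> ((X - R) \<union> (Y - {{}})) = \<Union> ((X - R) \<union> Y)" by auto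
      then show "card (\<Union> X \<inter> U) < card (\<Union> ((X - R) \<union> (Y - {{}})) \<inter> U)" using RY(5) by simp
    qed (use RY in auto)
    then show False using X that by (auto simp: stable_def)
  qed
  then show ?thesis using X by (auto simp: stable_def)
qed

text \<open>An empty set covers nothing and obstructs nothing, but no hitting set could meet it; it
  is discarded in advance.\<close>

lemma attainable_Diff_empty: "attainable Ps (F - {{}}) k \<longleftrightarrow> attainable Ps F k"
proof
  assume "attainable Ps F k"
  then obtain X where "stable Ps F X" "k \<le> int (card (\<Union> X))" by (auto simp: attainable_def)
  moreover have "\<Union> (X - {{}}) = \<Union> X" by auto
  ultimately show "attainable Ps (F - {{}}) k"
    unfolding attainable_def by (metis stable_Diff_empty)
qed (auto simp: attainable_def intro: stable_from_Diff_empty)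

section \<open>Coverage, transversals and maximal packings\<close>

lemma card_Union_insert_Int:
  assumes "finite S" "finite (\<Union> Z)" "S \<inter> \<Union> Z = {}"
  shows "card (\<Union> (insert S Z) \<inter> U) = card (S \<inter> U) + card (\<Union> Z \<inter> U)"
proof -
  have "\<Union> (insert S Z) \<inter> U = (S \<inter> U) \<union> (\<Union> Z \<inter> U)" by auto
  then show ?thesis using assms by (simp add: card_Un_disjoint Int_assoc disjoint_iff)
qed

lemma pairwise_disjnt_insert:
  "pairwise disjnt Z \<Longrightarrow> S \<inter> \<Union> Z = {} \<Longrightarrow> pairwise disjnt (insert S Z)"
  by (auto simp: pairwise_insert disjnt_def)

lemma disjoint_Union_Diff:
  "pairwise disjnt X \<Longrightarrow> S \<in> X \<Longrightarrow> S \<inter> \<Union> (X - {S}) = {}"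
  using pairwise_disjntD[of X S] by blast

text \<open>A choice of points in \<open>g T \<inter> W\<close> is injective because the sets
  \<open>g T\<close> are disjoint. For packings \<open>g\<close> is the identity, for sunflowers it
  removes the core.\<close>

lemma card_le_transversal:
  assumes "finite W" "\<And>T. T \<in> A \<Longrightarrow> g T \<inter> W \<noteq> {}"
    "\<And>T T'. T \<in> A \<Longrightarrow> T' \<in> A \<Longrightarrow> T \<noteq> T' \<Longrightarrow> g T \<inter> g T' = {}"
  shows "finite A" "card A \<le> card W"
proof -
  obtain f where f: "\<And>T. T \<in> A \<Longrightarrow> f T \<in> g T \<inter> W"
    using bchoice[of A "\<lambda>T x. x \<in> g T \<inter> W"] assms(2) by blast
  have "inj_on f A"
  proof (rule inj_onI, rule ccontr)
    fix T T' assume "T \<in> A" "T' \<in> A" "f T = f T'" "T \<noteq> T'"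
    then show False using f[of T] f[of T'] assms(3)[of T T'] by auto
  qed
  moreover have "f ` A \<subseteq> W" using f by auto
  ultimately show "finite A" "card A \<le> card W"
    using assms(1) by (auto intro: inj_on_finite card_inj_on_le)
qed

lemma card_packing_le_hitting:
  assumes "finite H" "pairwise disjnt Z" "\<And>S. S \<in> Z \<Longrightarrow> S \<inter> H \<noteq> {}"
  shows "finite Z" "card Z \<le> card H"
  using card_le_transversal[of H Z "\<lambda>S. S"] assms by (auto simp: pairwise_def disjnt_def)

lemma finite_has_maximal_value:
  fixes f :: "'a \<Rightarrow> nat"
  assumes "finite A" "A \<noteq> {}"
  shows "\<exists>x \<in> A. \<forall>y \<in> A. f y \<le> f x"
proof -
  have "Max (f ` A) \<in> f ` A" using assms by simp
  then obtain x where "x \<in> A" "f x = Max (f ` A)" by auto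
  then show ?thesis using assms by (intro bexI[of _ x]) auto
qed

lemma finite_Union_subfamily:
  "finite F \<Longrightarrow> (\<And>S. S \<in> F \<Longrightarrow> finite S) \<Longrightarrow> Z \<subseteq> F \<Longrightarrow> finite (\<Union> Z)"
  by (rule finite_Union) (auto intro: finite_subset)

text \<open>Among the packings by internal sets, one with maximal coverage is rejection-proof.\<close>

lemma stable_exists:
  assumes "finite F" "\<And>S. S \<in> F \<Longrightarrow> finite S" "pairwise disjnt Ps"
  shows "\<exists>X. stable Ps F X"
proof -
  let ?A = "{X. X \<subseteq> F \<and> pairwise disjnt X \<and> (\<forall>S \<in> X. \<exists>U \<in> Ps. S \<subseteq> U)}"
  have "finite ?A" using assms(1) by simp
  moreover have "?A \<noteq> {}" by (auto intro: exI[of _ "{}"])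
  ultimately have "\<exists>X \<in> ?A. \<forall>Z \<in> ?A. card (\<Union> Z) \<le> card (\<Union> X)"
    by (intro finite_has_maximal_value)
  then obtain X where X: "X \<in> ?A" and max: "\<forall>Z \<in> ?A. card (\<Union> Z) \<le> card (\<Union> X)"
    by (elim bexE)
  have fin: "finite (\<Union> Z)" if "Z \<subseteq> F" for Z
    using assms(1,2) that by (rule finite_Union_subfamily)
  have "\<not> refuses F U X" if U: "U \<in> Ps" for U
  proof
    assume "refuses F U X"
    then obtain R Y where RY: "R \<subseteq> X" "Y \<subseteq> F" "\<And>S. S \<in> Y \<Longrightarrow> S \<subseteq> U"
      "pairwise disjnt ((X - R) \<union> Y)" "card (\<Union> X \<inter> U) < card (\<Union> ((X - R) \<union> Y) \<inter> U)"
      by (rule refusesE) blast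
    \<comment> \<open>Rejected sets that avoid \<open>U\<close> are put back. They cannot collide
      with \<open>Y\<close>, whose members lie in \<open>U\<close>, and they preserve the coverage
      outside \<open>U\<close>, so a gain on \<open>U\<close> becomes a gain in total.\<close>
    define Z where "Z = {S \<in> X. S \<inter> U = {}} \<union> ((X - R) \<union> Y)"
    have pwX: "pairwise disjnt X" using X by simp
    have disj: "S \<inter> T = {}" if "S \<in> X" "S \<inter> U = {}" "T \<in> Z" "S \<noteq> T" for S T
      using that pairwise_disjntD[OF pwX, of S T] RY(3)[of T] by (auto simp: Z_def)
    have "pairwise disjnt Z"
    proof (rule pairwise_disjntI)
      fix S T assume "S \<in> Z" "T \<in> Z" "S \<noteq> T"
      then show "S \<inter> T = {}"
        using disj[of S T] disj[of T S] pairwise_disjntD[OF RY(4), of S T] by (auto simp: Z_def)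
    qed
    moreover have "Z \<subseteq> F" using X RY(2) by (auto simp: Z_def)
    ultimately have Z: "Z \<in> ?A" using X RY(3) U by (auto simp: Z_def)
    have S: "S \<subseteq> U \<or> S \<inter> U = {}" if SX: "S \<in> X" for S
    proof -
      obtain V where "V \<in> Ps" "S \<subseteq> V" using SX X by auto
      then show ?thesis using pairwise_disjntD[OF assms(3) _ U, of V] by auto
    qed
    have "\<Union> Z \<inter> U = \<Union> ((X - R) \<union> Y) \<inter> U" by (auto simp: Z_def)
    moreover have "\<Union> X - U \<subseteq> \<Union> Z - U" using S by (fastforce simp: Z_def)
    then have "card (\<Union> X - U) \<le> card (\<Union> Z - U)"
      using \<open>Z \<subseteq> F\<close> by (intro card_mono finite_Diff fin)
    moreover have "card (\<Union> W) = card (\<Union> W \<inter> U) + card (\<Union> W - U)" if "W \<subseteq> F" for W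
      using that by (metis card_Un_disjoint Int_Diff_Un Int_Diff_disjoint fin finite_Diff finite_Int)
    ultimately have "card (\<Union> X) < card (\<Union> Z)"
      using RY(5) X \<open>Z \<subseteq> F\<close> by simp
    then show False using bspec[OF max Z] by simp
  qed
  then show ?thesis using X by (auto simp: stable_def)
qed

text \<open>A rejection of the larger packing yields one of \<open>X\<close>. If \<open>S\<close> is
  kept, its share cancels on both sides; if \<open>S\<close> is dropped or played anew, the outcome
  is the same and \<open>X\<close> starts from no more coverage.\<close>

lemma stable_insert:
  assumes "finite F" "\<And>S. S \<in> F \<Longrightarrow> finite S"
    and X: "stable Ps F X" and S: "S \<in> F" "S \<inter> \<Union> X = {}"
  shows "stable Ps F (insert S X)"
proof -
  have fin: "finite (\<Union> Z)" if "Z \<subseteq> F" for Z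
    using assms(1,2) that by (rule finite_Union_subfamily)
  have XF: "X \<subseteq> F" using X by (simp add: stable_def)
  have card_X: "card (\<Union> (insert S X) \<inter> U) = card (S \<inter> U) + card (\<Union> X \<inter> U)" for U
    using S assms(2) fin[OF XF] by (intro card_Union_insert_Int) auto
  have "\<not> refuses F U (insert S X)" if U: "U \<in> Ps" for U
  proof
    assume "refuses F U (insert S X)"
    then obtain R Y where RY: "R \<subseteq> insert S X" "Y \<subseteq> F" "\<And>S. S \<in> Y \<Longrightarrow> S \<subseteq> U"
      "pairwise disjnt ((insert S X - R) \<union> Y)"
      "card (\<Union> (insert S X) \<inter> U) < card (\<Union> ((insert S X - R) \<union> Y) \<inter> U)"
      by (rule refusesE) blast
    let ?Z = "(X - (R \<inter> X)) \<union> Y"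
    have pw: "pairwise disjnt ?Z" using RY(4) by (rule pairwise_subset) auto
    have "card (\<Union> X \<inter> U) < card (\<Union> ?Z \<inter> U)"
    proof (cases "S \<in> R \<or> S \<in> ?Z")
      case True
      then have "(insert S X - R) \<union> Y = ?Z" by auto
      then show ?thesis using RY(5) card_X by simp
    next
      case False
      then have eq: "(insert S X - R) \<union> Y = insert S ?Z" by auto
      then have "S \<inter> \<Union> ?Z = {}"
        using RY(4) False disjoint_Union_Diff[of "insert S ?Z" S] by auto
      then have "card (\<Union> (insert S ?Z) \<inter> U) = card (S \<inter> U) + card (\<Union> ?Z \<inter> U)"
        using S assms(2) XF RY(2) by (intro card_Union_insert_Int fin) auto
      then show ?thesis using RY(5) card_X eq by simp
    qed
    then have "refuses F U X"
      using pw RY by (intro refusesI[of "R \<inter> X" X Y]) auto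
    then show False using X U by (auto simp: stable_def)
  qed
  moreover have "pairwise disjnt (insert S X)"
    using X S by (intro pairwise_disjnt_insert) (auto simp: stable_def)
  ultimately show ?thesis using XF S by (simp add: stable_def)
qed

text \<open>Maximal coverage stands in for inclusion-maximality: a member of \<open>M\<close>
  disjoint from the packing could be added by \<open>stable_insert\<close>. The disjoint members of
  \<open>M\<close> then claim different covered elements.\<close>

lemma attainable_if_packing:
  assumes fin: "finite F" "\<And>S. S \<in> F \<Longrightarrow> finite S" and "pairwise disjnt Ps"
    and M: "M \<subseteq> F" "{} \<notin> M" "pairwise disjnt M" "k \<le> int (card M)"
  shows "attainable Ps F k"
proof -
  let ?A = "{X. stable Ps F X}"
  have "finite ?A" by (rule finite_subset[of _ "Pow F"]) (use fin in \<open>auto simp: stable_def\<close>)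
  moreover have "?A \<noteq> {}" using stable_exists[OF fin assms(3)] by auto
  ultimately have "\<exists>X \<in> ?A. \<forall>Z \<in> ?A. card (\<Union> Z) \<le> card (\<Union> X)"
    by (intro finite_has_maximal_value)
  then obtain X where X: "stable Ps F X"
    and max: "\<And>Z. stable Ps F Z \<Longrightarrow> card (\<Union> Z) \<le> card (\<Union> X)"
    by auto
  have finX: "finite (\<Union> X)"
    using X finite_Union_subfamily[OF fin] by (simp add: stable_def)
  have "S \<inter> \<Union> X \<noteq> {}" if "S \<in> M" for S
  proof
    assume disj: "S \<inter> \<Union> X = {}"
    have S: "S \<in> F" "S \<noteq> {}" "finite S" using that M fin by auto
    then have "card (\<Union> (insert S X)) \<le> card (\<Union> X)"
      by (intro max stable_insert[OF fin] X disj)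
    moreover have "card (\<Union> (insert S X)) = card S + card (\<Union> X)"
      using card_Union_insert_Int[of S X UNIV] S finX disj by simp
    ultimately show False using S by simp
  qed
  then have "card M \<le> card (\<Union> X)"
    using card_packing_le_hitting[OF finX M(3)] by blast
  then show ?thesis using X M(4) by (auto simp: attainable_def)
qed

section \<open>Deleting redundant sets\<close>

text \<open>For the part \<open>V\<close>, a rejection after the swap is imitated by giving up
  \<open>S\<close> and, if \<open>T\<close> was kept, playing \<open>T\<close> as a further internal
  set. For every other part both sets are invisible.\<close>

lemma stable_swap_internal:
  assumes fin: "finite F" "\<And>S. S \<in> F \<Longrightarrow> finite S" and Ps: "pairwise disjnt Ps" "V \<in> Ps"
    and X: "stable Ps F X" "S \<in> X"
    and T: "T \<in> F" "T \<noteq> S" "T \<noteq> {}" "S \<subseteq> V" "T \<subseteq> V" "card S = card T" "T \<inter> \<Union> (X - {S}) = {}"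
  shows "stable Ps (F - {S}) (insert T (X - {S}))"
proof -
  define Z where "Z = X - {S}"
  have XF: "X \<subseteq> F" "Z \<subseteq> F" and SZ: "S \<inter> \<Union> Z = {}" "S \<notin> Z" and pwZ: "pairwise disjnt Z"
    using X disjoint_Union_Diff[of X S]
    by (auto simp: stable_def Z_def intro: pairwise_subset)
  have X_eq: "X = insert S Z" using X by (auto simp: Z_def)
  have TZ: "T \<inter> \<Union> Z = {}" "T \<notin> Z" using T by (auto simp: Z_def)
  have finite: "finite S" "finite T" "finite (\<Union> Z)"
    using XF X T finite_Union_subfamily[OF fin] by (auto intro: fin)
  have "\<not> refuses (F - {S}) U (insert T Z)" if U: "U \<in> Ps" for U
  proof
    assume "refuses (F - {S}) U (insert T Z)"
    then obtain R Y where RY: "R \<subseteq> insert T Z" "Y \<subseteq> F - {S}" "\<And>S. S \<in> Y \<Longrightarrow> S \<subseteq> U"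
      "pairwise disjnt ((insert T Z - R) \<union> Y)"
      "card (\<Union> (insert T Z) \<inter> U) < card (\<Union> ((insert T Z - R) \<union> Y) \<inter> U)"
      by (rule refusesE) blast
    let ?R = "insert S (R \<inter> Z)"
    have R: "X - ?R = Z - R" using SZ by (auto simp: X_eq)
    have "refuses F U X"
    proof (cases "U = V")
      case True
      have eq: "(X - ?R) \<union> (Y \<union> ({T} - R)) = (insert T Z - R) \<union> Y"
        unfolding R by auto
      have "S \<inter> U = S" "T \<inter> U = T" using T True by auto
      then have "card (\<Union> X \<inter> U) = card (\<Union> (insert T Z) \<inter> U)"
        unfolding X_eq using T(6) SZ TZ finite
          card_Union_insert_Int[of S Z U] card_Union_insert_Int[of T Z U] by simp
      then show ?thesis
        using RY T True by (intro refusesI[of ?R X "Y \<union> ({T} - R)"], unfold eq) (auto simp: X_eq)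
    next
      case False
      then have disj: "S \<inter> U = {}" "T \<inter> U = {}"
        using T pairwise_disjntD[OF Ps(1) U Ps(2)] by blast+
      have pw: "pairwise disjnt ((X - ?R) \<union> Y)"
        unfolding R using TZ by (intro pairwise_subset[OF RY(4)]) auto
      have "\<Union> X \<inter> U = \<Union> (insert T Z) \<inter> U" using disj by (auto simp: X_eq)
      moreover have "\<Union> ((X - ?R) \<union> Y) \<inter> U = \<Union> ((insert T Z - R) \<union> Y) \<inter> U"
        unfolding R using disj by auto
      ultimately show ?thesis
        using RY pw by (intro refusesI[of ?R X Y]) (auto simp: X_eq)
    qed
    then show False using X U by (auto simp: stable_def)
  qed
  then show ?thesis
    using XF T TZ pwZ unfolding stable_def Z_def[symmetric]
    by (auto simp: Z_def intro!: pairwise_disjnt_insert)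
qed

text \<open>No threat is lost with \<open>S\<close>: a rejection that plays \<open>S\<close> ends in
  a packing containing \<open>S\<close>, to which \<open>free\<close> applies and supplies a
  substitute of equal size in the same part.\<close>

lemma refuses_without_internal:
  assumes fin: "finite F" "\<And>S. S \<in> F \<Longrightarrow> finite S" and Ps: "pairwise disjnt Ps" "V \<in> Ps" "U \<in> Ps"
    and X: "X \<subseteq> F - {S}" "refuses F U X"
    and S: "S \<subseteq> V" "S \<noteq> {}"
    and free: "\<And>Z. Z \<subseteq> F \<Longrightarrow> pairwise disjnt Z \<Longrightarrow> S \<in> Z \<Longrightarrow>
      \<exists>T \<in> F. T \<noteq> S \<and> T \<subseteq> V \<and> card S = card T \<and> T \<inter> \<Union> (Z - {S}) = {}"
  shows "refuses (F - {S}) U X"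
proof -
  obtain R Y where RY: "R \<subseteq> X" "Y \<subseteq> F" "\<And>S. S \<in> Y \<Longrightarrow> S \<subseteq> U"
    "pairwise disjnt ((X - R) \<union> Y)" "card (\<Union> X \<inter> U) < card (\<Union> ((X - R) \<union> Y) \<inter> U)"
    using X(2) by (rule refusesE) blast
  show ?thesis
  proof (cases "S \<in> Y")
    case False
    then show ?thesis using RY by (intro refusesI[of R X Y]) auto
  next
    case True
    define Z where "Z = (X - R) \<union> (Y - {S})"
    have Z: "Z = ((X - R) \<union> Y) - {S}" "(X - R) \<union> Y = insert S Z"
      using X True by (auto simp: Z_def)
    obtain T where T: "T \<in> F" "T \<noteq> S" "T \<subseteq> V" "card S = card T" "T \<inter> \<Union> Z = {}"
      using free[of "(X - R) \<union> Y"] RY(2,4) X(1) True unfolding Z(1)[symmetric] by blast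
    have "U = V" using RY(3)[OF True] S pairwise_disjntD[OF Ps(1,3,2)] by blast
    have eq: "(X - R) \<union> insert T (Y - {S}) = insert T Z" by (auto simp: Z_def)
    have SZ: "S \<inter> \<Union> Z = {}" using disjoint_Union_Diff[OF RY(4), of S] True Z(1) by simp
    have finite: "finite S" "finite T" "finite (\<Union> Z)"
      using RY X True T by (auto simp: Z_def intro!: finite_Union_subfamily[OF fin] intro: fin)
    have "S \<inter> U = S" "T \<inter> U = T" using S T \<open>U = V\<close> by auto
    then have "card (\<Union> (insert T Z) \<inter> U) = card (\<Union> (insert S Z) \<inter> U)"
      using T SZ finite card_Union_insert_Int[of S Z U] card_Union_insert_Int[of T Z U] by simp
    moreover have "pairwise disjnt (insert T Z)"
      using T RY(4) unfolding Z(2) by (intro pairwise_disjnt_insert) (auto intro: pairwise_subset)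
    ultimately show ?thesis
      using RY X T \<open>U = V\<close> unfolding Z(2)
      by (intro refusesI[of R X "insert T (Y - {S})"], unfold eq) auto
  qed
qed

lemma attainable_delete_internal:
  assumes fin: "finite F" "\<And>S. S \<in> F \<Longrightarrow> finite S" and Ps: "pairwise disjnt Ps" "V \<in> Ps"
    and S: "S \<subseteq> V" "S \<noteq> {}" "S \<in> F"
    and free: "\<And>Z. Z \<subseteq> F \<Longrightarrow> pairwise disjnt Z \<Longrightarrow> S \<in> Z \<Longrightarrow>
      \<exists>T \<in> F. T \<noteq> S \<and> T \<subseteq> V \<and> card S = card T \<and> T \<inter> \<Union> (Z - {S}) = {}"
  shows "attainable Ps (F - {S}) k \<longleftrightarrow> attainable Ps F k"
proof
  assume "attainable Ps (F - {S}) k"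
  then obtain X where X: "stable Ps (F - {S}) X" "k \<le> int (card (\<Union> X))"
    by (auto simp: attainable_def)
  then have "stable Ps F X"
    using refuses_without_internal[OF fin Ps _ _ _ S(1,2) free] unfolding stable_def by blast
  then show "attainable Ps F k" using X by (auto simp: attainable_def)
next
  assume "attainable Ps F k"
  then obtain X where X: "stable Ps F X" "k \<le> int (card (\<Union> X))"
    by (auto simp: attainable_def)
  show "attainable Ps (F - {S}) k"
  proof (cases "S \<in> X")
    case False
    then have "stable Ps (F - {S}) X"
      using X refuses_mono[of "F - {S}" _ X F] by (auto simp: stable_def)
    then show ?thesis using X by (auto simp: attainable_def)
  next
    case True
    then obtain T where T: "T \<in> F" "T \<noteq> S" "T \<subseteq> V" "card S = card T" "T \<inter> \<Union> (X - {S}) = {}"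
      using free[of X] X by (auto simp: stable_def)
    have "T \<noteq> {}" using T S fin by (metis card_0_eq card.empty)
    then have "stable Ps (F - {S}) (insert T (X - {S}))"
      using stable_swap_internal[OF fin Ps X(1) True T(1,2)] T S by blast
    moreover have "card (\<Union> (insert T (X - {S}))) = card (\<Union> X)"
    proof -
      have "finite (\<Union> (X - {S}))"
        using X by (intro finite_Union_subfamily[OF fin]) (auto simp: stable_def)
      moreover have "S \<inter> \<Union> (X - {S}) = {}" "X = insert S (X - {S})"
        using X True disjoint_Union_Diff by (auto simp: stable_def)
      ultimately show ?thesis
        using T S fin card_Union_insert_Int[of T "X - {S}" UNIV] card_Union_insert_Int[of S "X - {S}" UNIV]
        by simp
    qed
    ultimately show ?thesis using X by (auto simp: attainable_def)
  qed
qed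

text \<open>Played sets lie in \<open>W\<close>, which \<open>S\<close> and \<open>T\<close> meet
  only within the core. So if \<open>T\<close> is kept, the played sets avoid the core and thereby
  \<open>S\<close>, which can be kept as well.\<close>

lemma stable_swap_external:
  fixes F Ps :: "'a set set"
  defines "W \<equiv> \<Union> {S \<in> F. \<exists>U \<in> Ps. S \<subseteq> U}"
  assumes fin: "finite F" "\<And>S. S \<in> F \<Longrightarrow> finite S"
    and X: "stable Ps F X" "S \<in> X"
    and T: "T \<in> F" "T \<noteq> S" "T \<noteq> {}" "card S = card T" "T \<inter> \<Union> (X - {S}) = {}"
    and C: "C \<subseteq> S" "C \<subseteq> T" "(S - C) \<inter> W = {}" "(T - C) \<inter> W = {}"
      "\<And>U. U \<in> Ps \<Longrightarrow> C \<inter> U \<noteq> {} \<Longrightarrow> card (S \<inter> U) = card (T \<inter> U)"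
  shows "stable Ps (F - {S}) (insert T (X - {S}))"
proof -
  define Z where "Z = X - {S}"
  have XF: "X \<subseteq> F" "Z \<subseteq> F" and SZ: "S \<inter> \<Union> Z = {}" "S \<notin> Z" and pwZ: "pairwise disjnt Z"
    using X disjoint_Union_Diff[of X S]
    by (auto simp: stable_def Z_def intro: pairwise_subset)
  have X_eq: "X = insert S Z" using X by (auto simp: Z_def)
  have TZ: "T \<inter> \<Union> Z = {}" "T \<notin> Z" using T by (auto simp: Z_def)
  have finite: "finite S" "finite T" "finite (\<Union> Z)"
    using XF X T finite_Union_subfamily[OF fin] by (auto intro: fin)
  have "\<not> refuses (F - {S}) U (insert T Z)" if U: "U \<in> Ps" for U
  proof
    assume "refuses (F - {S}) U (insert T Z)"
    then obtain R Y where RY: "R \<subseteq> insert T Z" "Y \<subseteq> F - {S}" "\<And>S. S \<in> Y \<Longrightarrow> S \<subseteq> U"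
      "pairwise disjnt ((insert T Z - R) \<union> Y)"
      "card (\<Union> (insert T Z) \<inter> U) < card (\<Union> ((insert T Z - R) \<union> Y) \<inter> U)"
      by (rule refusesE) blast
    define P where "P = (Z - R) \<union> Y"
    have pwP: "pairwise disjnt P"
      unfolding P_def using RY(4) by (rule pairwise_subset) auto
    have finP: "finite (\<Union> P)"
      using XF RY(2) by (intro finite_Union_subfamily[OF fin]) (auto simp: P_def)
    have YW: "\<Union> Y \<subseteq> W" using RY(2,3) U unfolding W_def by blast
    have cX: "card (\<Union> X \<inter> U) = card (S \<inter> U) + card (\<Union> Z \<inter> U)"
      unfolding X_eq using finite SZ by (intro card_Union_insert_Int)
    have cX': "card (\<Union> (insert T Z) \<inter> U) = card (T \<inter> U) + card (\<Union> Z \<inter> U)"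
      using finite TZ by (intro card_Union_insert_Int)
    \<comment> \<open>Here the rejection is imitated with \<open>S\<close> retained: its share on
      \<open>U\<close> cancels, so only the gain of \<open>P\<close> over \<open>Z\<close>
      counts.\<close>
    have keep: "refuses F U X" if SY: "S \<inter> \<Union> Y = {}" and less: "card (\<Union> Z \<inter> U) < card (\<Union> P \<inter> U)"
    proof -
      have SP: "S \<inter> \<Union> P = {}" using SY SZ by (auto simp: P_def)
      have eq: "(X - (R \<inter> Z)) \<union> Y = insert S P"
        using SZ(2) by (auto simp: X_eq P_def)
      have "card (\<Union> (insert S P) \<inter> U) = card (S \<inter> U) + card (\<Union> P \<inter> U)"
        using finite finP SP by (intro card_Union_insert_Int)
      then show ?thesis
        using RY(2,3) less cX pairwise_disjnt_insert[OF pwP SP]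
        by (intro refusesI[of "R \<inter> Z" X Y], unfold eq) (auto simp: X_eq)
    qed
    have "refuses F U X"
    proof (cases "T \<in> R")
      case False
      \<comment> \<open>An internal \<open>T\<close> would lie inside the core, hence inside
        \<open>S\<close>, and equal sizes would force \<open>T = S\<close>.\<close>
      have "T \<notin> Y"
      proof
        assume "T \<in> Y"
        then have "T \<subseteq> C" using YW C(4) by blast
        then have "T \<subseteq> S" using C(1) by blast
        then show False using T(2,4) finite(1) card_subset_eq by metis
      qed
      have eq: "(insert T Z - R) \<union> Y = insert T P"
        using False by (auto simp: P_def)
      have "T \<inter> \<Union> P = {}"
        using disjoint_Union_Diff[of "insert T P" T] RY(4) \<open>T \<notin> Y\<close> TZ(2)
        unfolding eq by (auto simp: P_def)
      moreover from this have "card (\<Union> (insert T P) \<inter> U) = card (T \<inter> U) + card (\<Union> P \<inter> U)"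
        using finite finP by (intro card_Union_insert_Int)
      ultimately show ?thesis
        using YW C(2,3) RY(5) cX' by (intro keep) (auto simp: P_def eq)
    next
      case True
      have eq: "(insert T Z - R) \<union> Y = P" using True by (auto simp: P_def)
      show ?thesis
      proof (cases "C \<inter> U = {}")
        case True
        \<comment> \<open>Played sets lie in both \<open>U\<close> and \<open>W\<close>; within
          \<open>W\<close> the set \<open>S\<close> has only core elements, none of which is in
          \<open>U\<close>.\<close>
        then have "S \<inter> \<Union> Y = {}" using YW RY(3) C(3) by blast
        then show ?thesis using RY(5) cX' by (intro keep) (auto simp: eq)
      next
        case False
        have "X - insert S (R \<inter> Z) = Z - R" using SZ(2) by (auto simp: X_eq)
        then have "(X - insert S (R \<inter> Z)) \<union> Y = P" by (simp add: P_def)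
        then show ?thesis
          using RY(2,3,5) cX cX' C(5)[OF U False] pwP
          by (intro refusesI[of "insert S (R \<inter> Z)" X Y]) (auto simp: eq X_eq simp del: Union_Un_distrib)
      qed
    qed
    then show False using X U by (auto simp: stable_def)
  qed
  then show ?thesis
    using XF T TZ pwZ unfolding stable_def Z_def[symmetric]
    by (auto simp: Z_def intro!: pairwise_disjnt_insert)
qed

text \<open>Returning to the larger family requires no substitute: \<open>S\<close> is internal to
  no part, so it is never played in a rejection.\<close>

lemma attainable_delete_external:
  fixes F Ps :: "'a set set"
  defines "W \<equiv> \<Union> {S \<in> F. \<exists>U \<in> Ps. S \<subseteq> U}"
  assumes fin: "finite F" "\<And>S. S \<in> F \<Longrightarrow> finite S"
    and S: "S \<in> F" "\<not> S \<subseteq> C" "C \<subseteq> S" "(S - C) \<inter> W = {}"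
    and free: "\<And>Z. Z \<subseteq> F \<Longrightarrow> pairwise disjnt Z \<Longrightarrow> S \<in> Z \<Longrightarrow>
      \<exists>T \<in> F. T \<noteq> S \<and> card S = card T \<and> C \<subseteq> T \<and> (T - C) \<inter> W = {} \<and>
        (\<forall>U \<in> Ps. C \<inter> U \<noteq> {} \<longrightarrow> card (S \<inter> U) = card (T \<inter> U)) \<and> T \<inter> \<Union> (Z - {S}) = {}"
  shows "attainable Ps (F - {S}) k \<longleftrightarrow> attainable Ps F k"
proof
  assume "attainable Ps (F - {S}) k"
  then obtain X where X: "stable Ps (F - {S}) X" "k \<le> int (card (\<Union> X))"
    by (auto simp: attainable_def)
  have not_internal: "\<not> S \<subseteq> U" if "U \<in> Ps" for U
    using that S by (auto simp: W_def)
  have "\<not> refuses F U X" if U: "U \<in> Ps" for U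
  proof
    assume "refuses F U X"
    then obtain R Y where RY: "R \<subseteq> X" "Y \<subseteq> F" "\<And>S. S \<in> Y \<Longrightarrow> S \<subseteq> U"
      "pairwise disjnt ((X - R) \<union> Y)" "card (\<Union> X \<inter> U) < card (\<Union> ((X - R) \<union> Y) \<inter> U)"
      by (rule refusesE) blast
    then have "S \<notin> Y" using not_internal[OF U] by blast
    then have "refuses (F - {S}) U X" using RY by (intro refusesI[of R X Y]) auto
    then show False using X U by (simp add: stable_def)
  qed
  then have "stable Ps F X" using X by (auto simp: stable_def)
  then show "attainable Ps F k" using X by (auto simp: attainable_def)
next
  assume "attainable Ps F k"
  then obtain X where X: "stable Ps F X" "k \<le> int (card (\<Union> X))"
    by (auto simp: attainable_def)
  show "attainable Ps (F - {S}) k"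
  proof (cases "S \<in> X")
    case False
    then have "stable Ps (F - {S}) X"
      using X refuses_mono[of "F - {S}" _ X F] by (auto simp: stable_def)
    then show ?thesis using X by (auto simp: attainable_def)
  next
    case True
    have "X \<subseteq> F" "pairwise disjnt X" using X(1) by (simp_all add: stable_def)
    from free[OF this True] obtain T where T: "T \<in> F" "T \<noteq> S" "card S = card T" "C \<subseteq> T"
      "(T - C) \<inter> W = {}" "\<forall>U \<in> Ps. C \<inter> U \<noteq> {} \<longrightarrow> card (S \<inter> U) = card (T \<inter> U)"
      "T \<inter> \<Union> (X - {S}) = {}"
      by (elim bexE conjE)
    have "S \<noteq> {}" using S by auto
    then have "T \<noteq> {}" using T(3) S(1) fin by (metis card_0_eq card.empty)
    then have "stable Ps (F - {S}) (insert T (X - {S}))"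
      using stable_swap_external[OF fin X(1) True T(1,2) _ T(3,7) S(3) T(4)] S(4) T(5,6)
      by (simp add: W_def)
    moreover have "card (\<Union> (insert T (X - {S}))) = card (\<Union> X)"
    proof -
      have "finite (\<Union> (X - {S}))"
        using X by (intro finite_Union_subfamily[OF fin]) (auto simp: stable_def)
      moreover have "S \<inter> \<Union> (X - {S}) = {}" "X = insert S (X - {S})"
        using X True disjoint_Union_Diff by (auto simp: stable_def)
      ultimately show ?thesis
        using T S fin card_Union_insert_Int[of T "X - {S}" UNIV] card_Union_insert_Int[of S "X - {S}" UNIV]
        by simp
    qed
    ultimately show ?thesis using X by (auto simp: attainable_def)
  qed
qed

section \<open>Sunflowers: free petals and counting\<close>

lemma free_petal:
  assumes fin: "\<And>S. S \<in> F \<Longrightarrow> finite S \<and> card S \<le> d"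
    and H: "finite H" "\<And>S. S \<in> F \<Longrightarrow> S \<inter> H \<noteq> {}"
    and L: "S \<in> L" "d * card H < card L" "\<And>T. T \<in> L \<Longrightarrow> C \<subseteq> T"
      "\<And>T T'. T \<in> L \<Longrightarrow> T' \<in> L \<Longrightarrow> T \<noteq> T' \<Longrightarrow> T \<inter> T' \<subseteq> C"
    and Z: "Z \<subseteq> F" "pairwise disjnt Z" "S \<in> Z"
  shows "\<exists>T \<in> L. T \<noteq> S \<and> T \<inter> \<Union> (Z - {S}) = {}"
proof (rule ccontr)
  assume "\<not> ?thesis"
  then have meets: "T \<inter> \<Union> (Z - {S}) \<noteq> {}" if "T \<in> L - {S}" for T using that by blast
  have finZ: "finite Z" "card Z \<le> card H"
    using card_packing_le_hitting[OF H(1) Z(2)] H(2) Z(1) by blast+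
  have disj: "S \<inter> \<Union> (Z - {S}) = {}" by (rule disjoint_Union_Diff[OF Z(2,3)])
  have finU: "finite (\<Union> (Z - {S}))"
    using finZ Z(1) fin by (intro finite_Union) auto
  \<comment> \<open>The core lies in \<open>S\<close>, which is disjoint from the rest of
    \<open>Z\<close>. A set of \<open>L\<close> meeting that rest therefore does so in its petal,
    and disjoint petals use up different elements.\<close>
  have "card (L - {S}) \<le> card (\<Union> (Z - {S}))"
  proof (rule card_le_transversal(2)[where g = "\<lambda>T. T - C", OF finU])
    fix T assume T: "T \<in> L - {S}"
    show "(T - C) \<inter> \<Union> (Z - {S}) \<noteq> {}"
      using meets[OF T] L(3)[OF L(1)] disj by blast
  next
    fix T T' assume "T \<in> L - {S}" "T' \<in> L - {S}" "T \<noteq> T'"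
    then show "(T - C) \<inter> (T' - C) = {}" using L(4)[of T T'] by blast
  qed
  also have "\<dots> \<le> (\<Sum>T \<in> Z - {S}. card T)"
    by (rule card_Union_le_sum_card)
  also have "\<dots> \<le> card (Z - {S}) * d"
    using fin Z(1) by (intro sum_bounded_above[of _ _ d, simplified]) auto
  also have "card (Z - {S}) = card Z - 1" using Z(3) finZ by simp
  finally have "card (L - {S}) \<le> (card Z - 1) * d" .
  moreover have "card L \<le> card (L - {S}) + 1"
    using L(1) by (simp add: card_Diff_singleton)
  moreover have "card Z \<ge> 1" using finZ Z(3) card_gt_0_iff[of Z] by auto
  \<comment> \<open>A nonempty \<open>S\<close> forces \<open>1 \<le> d\<close>, which leaves room
    for \<open>S\<close> itself: \<open>(card Z - 1) * d + 1 \<le> d * card Z\<close>.\<close>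
  moreover have "S \<noteq> {}" "finite S" "card S \<le> d" using Z(1,3) H(2) fin by blast+
  then have "d \<ge> 1" using card_gt_0_iff[of S] by linarith
  moreover have "(card Z - 1) * d + d = d * card Z"
    using \<open>card Z \<ge> 1\<close> by (cases "card Z") auto
  moreover have "d * card Z \<le> d * card H" using finZ by simp
  ultimately show False using L(2) by linarith
qed

text \<open>\<open>n\<close> counts the elements missing from the core. At most \<open>t * n\<close>
  petal elements each lead to a core with \<open>n - 1\<close> missing elements, and the factors
  multiply to \<open>fact n * t ^ n\<close>.\<close>

lemma card_sunflower_free:
  fixes F :: "'a set set"
  assumes fin: "finite F" "\<And>S. S \<in> F \<Longrightarrow> finite S \<and> card S = s"
    and maximal: "\<And>C. (\<exists>S \<in> F. C \<subseteq> S) \<Longrightarrow> \<exists>L \<subseteq> {S \<in> F. C \<subseteq> S}. card L \<le> t \<and>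
      (\<forall>S \<in> F. C \<subseteq> S \<longrightarrow> S \<in> L \<or> (\<exists>T \<in> L. \<not> S \<inter> T \<subseteq> C))"
  shows "finite C \<Longrightarrow> card C + n = s \<Longrightarrow> card {S \<in> F. C \<subseteq> S} \<le> fact n * t ^ n"
proof (induction n arbitrary: C)
  case 0
  have "S = C" if "S \<in> F" "C \<subseteq> S" for S
    using card_subset_eq[of S C] that 0 fin(2)[of S] by simp
  then have "{S \<in> F. C \<subseteq> S} \<subseteq> {C}" by auto
  then have "card {S \<in> F. C \<subseteq> S} \<le> card {C}" by (rule card_mono[rotated]) simp
  then show ?case by simp
next
  case (Suc n)
  show ?case
  proof (cases "\<exists>S \<in> F. C \<subseteq> S")
    case False
    then have "{S \<in> F. C \<subseteq> S} = {}" by auto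
    then show ?thesis by (simp only: card.empty le0)
  next
    case True
    obtain L where L: "L \<subseteq> {S \<in> F. C \<subseteq> S}" "card L \<le> t"
      "\<forall>S \<in> F. C \<subseteq> S \<longrightarrow> S \<in> L \<or> (\<exists>T \<in> L. \<not> S \<inter> T \<subseteq> C)"
      using maximal[OF True] by (elim exE conjE)
    let ?V = "\<Union>T \<in> L. T - C"
    have finL: "finite L" using L(1) fin(1) by (auto intro: finite_subset)
    have "card (T - C) = Suc n" if "T \<in> L" for T
      using that L(1) fin(2) Suc.prems by (subst card_Diff_subset) auto
    then have "card ?V \<le> card L * Suc n"
      using card_UN_le[OF finL, of "\<lambda>T. T - C"] by simp
    then have V: "card ?V \<le> t * Suc n"
      using L(2) by (meson le_trans mult_le_mono1)
    have "finite ?V" using L(1) fin(2) by (intro finite_UN_I[OF finL] finite_Diff) auto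
    have cover: "{S \<in> F. C \<subseteq> S} \<subseteq> (\<Union>x \<in> ?V. {S \<in> F. insert x C \<subseteq> S})"
    proof
      fix S assume S: "S \<in> {S \<in> F. C \<subseteq> S}"
      \<comment> \<open>This also covers members of \<open>L\<close>, for which \<open>T = S\<close>
        is the witness.\<close>
      have "\<not> S \<subseteq> C"
        using S fin(2)[of S] Suc.prems card_mono[of C S] by auto
      moreover have "S \<in> L \<or> (\<exists>T \<in> L. \<not> S \<inter> T \<subseteq> C)" using L(3) S by simp
      ultimately obtain T where "T \<in> L" "\<not> S \<inter> T \<subseteq> C" by (metis Int_absorb)
      then show "S \<in> (\<Union>x \<in> ?V. {S \<in> F. insert x C \<subseteq> S})" using S by auto
    qed
    have "card {S \<in> F. C \<subseteq> S} \<le> card (\<Union>x \<in> ?V. {S \<in> F. insert x C \<subseteq> S})"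
      using fin(1) \<open>finite ?V\<close> by (intro card_mono[OF _ cover]) auto
    also have "\<dots> \<le> (\<Sum>x \<in> ?V. card {S \<in> F. insert x C \<subseteq> S})"
      by (rule card_UN_le) fact
    also have "\<dots> \<le> (\<Sum>x \<in> ?V. fact n * t ^ n)"
      using Suc.prems by (intro sum_mono Suc.IH) auto
    also have "\<dots> = card ?V * (fact n * t ^ n)" by simp
    also have "\<dots> \<le> (t * Suc n) * (fact n * t ^ n)" using V by (rule mult_le_mono1)
    finally show ?thesis by (simp add: algebra_simps)
  qed
qed

text \<open>The share vector of a petal on the parts meeting the core takes at most \<open>d ^ (d - 1)\<close> values.\<close>

lemma card_similarity_classes:
  fixes A :: "'a set set"
  assumes A: "finite A" "\<And>S. S \<in> A \<Longrightarrow> finite S \<and> card S = s \<and> C \<subseteq> S"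
    and "s \<le> d" "1 \<le> d" "pairwise disjnt Ps"
    and classes: "\<And>S. S \<in> A \<Longrightarrow>
      card {T \<in> A. \<forall>U \<in> Ps. C \<inter> U \<noteq> {} \<longrightarrow> card (S \<inter> U) = card (T \<inter> U)} \<le> m"
  shows "card A \<le> d ^ (d - 1) * m"
proof (cases "A = {}")
  case False
  then obtain S0 where "S0 \<in> A" by blast
  then have C: "finite C" "card C \<le> s" using A(2) by (auto intro: finite_subset card_mono)
  \<comment> \<open>Indexing by core elements instead of parts gives \<open>card C\<close>
    coordinates, however many parts there are. As parts are disjoint, the union is the part
    containing \<open>c\<close>, if there is one.\<close>
  define share where "share S = (\<lambda>c \<in> C. card ((S - C) \<inter> \<Union> {U \<in> Ps. c \<in> U}))" for S
  have eq: "card (S \<inter> U) = card (T \<inter> U)"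
    if "S \<in> A" "T \<in> A" "share S = share T" "U \<in> Ps" "C \<inter> U \<noteq> {}" for S T U
  proof -
    obtain c where c: "c \<in> C" "c \<in> U" using \<open>C \<inter> U \<noteq> {}\<close> by blast
    have "{U \<in> Ps. c \<in> U} = {U}"
      using c \<open>U \<in> Ps\<close> pairwise_disjntD[OF assms(5), of U] by auto
    then have "card ((S - C) \<inter> U) = card ((T - C) \<inter> U)"
      using fun_cong[OF \<open>share S = share T\<close>, of c] c by (simp add: share_def)
    moreover have "card (V \<inter> U) = card (C \<inter> U) + card ((V - C) \<inter> U)" if "V \<in> A" for V
    proof -
      have "V \<inter> U = (C \<inter> U) \<union> ((V - C) \<inter> U)" using A(2)[OF that] by auto
      moreover have "(C \<inter> U) \<inter> ((V - C) \<inter> U) = {}" by auto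
      ultimately show ?thesis using A(2)[OF that] C by (metis card_Un_disjoint finite_Int finite_Diff)
    qed
    ultimately show ?thesis using that by simp
  qed
  have "share ` A \<subseteq> C \<rightarrow>\<^sub>E {0..s - card C}"
  proof
    fix v assume "v \<in> share ` A"
    then obtain S where S: "S \<in> A" "v = share S" by blast
    have "card ((S - C) \<inter> V) \<le> s - card C" for V
    proof -
      have "card ((S - C) \<inter> V) \<le> card (S - C)" using A(2)[OF S(1)] by (intro card_mono) auto
      then show ?thesis using A(2)[OF S(1)] C by (simp add: card_Diff_subset)
    qed
    then show "v \<in> C \<rightarrow>\<^sub>E {0..s - card C}" by (auto simp: S(2) share_def)
  qed
  then have "card (share ` A) \<le> card (C \<rightarrow>\<^sub>E {0..s - card C})"
    using C by (intro card_mono finite_PiE) auto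
  also have "\<dots> = (s - card C + 1) ^ card C" using C by (simp add: card_PiE)
  also have "\<dots> \<le> d ^ (d - 1)"
  \<comment> \<open>At these extremes the exponent is zero or the base is one. In between, core and
    petal are both nonempty, so the base is at most \<open>d\<close> and the exponent at most
    \<open>d - 1\<close>.\<close>
  proof (cases "card C = 0 \<or> card C = s")
    case True
    then show ?thesis using \<open>1 \<le> d\<close> by auto
  next
    case False
    then have "s - card C + 1 \<le> d" using C \<open>s \<le> d\<close> by linarith
    then have "(s - card C + 1) ^ card C \<le> d ^ card C" by (intro power_mono) auto
    also have "\<dots> \<le> d ^ (d - 1)"
      using False C(2) \<open>s \<le> d\<close> \<open>1 \<le> d\<close> by (intro power_increasing) linarith+
    finally show ?thesis .
  qed
  finally have img: "card (share ` A) \<le> d ^ (d - 1)" .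
  have "A = (\<Union>v \<in> share ` A. {T \<in> A. share T = v})" by auto
  then have "card A \<le> (\<Sum>v \<in> share ` A. card {T \<in> A. share T = v})"
    using card_UN_le[of "share ` A" "\<lambda>v. {T \<in> A. share T = v}"] A(1) by simp
  also have "\<dots> \<le> (\<Sum>v \<in> share ` A. m)"
  proof (rule sum_mono)
    fix v assume "v \<in> share ` A"
    then obtain S where S: "S \<in> A" "v = share S" by blast
    have "card {T \<in> A. share T = v} \<le>
        card {T \<in> A. \<forall>U \<in> Ps. C \<inter> U \<noteq> {} \<longrightarrow> card (S \<inter> U) = card (T \<inter> U)}"
    proof (rule card_mono)
      show "{T \<in> A. share T = v} \<subseteq>
          {T \<in> A. \<forall>U \<in> Ps. C \<inter> U \<noteq> {} \<longrightarrow> card (S \<inter> U) = card (T \<inter> U)}"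
      proof (intro subsetI CollectI conjI ballI impI)
        fix T U assume T: "T \<in> {T \<in> A. share T = v}" "U \<in> Ps" "C \<inter> U \<noteq> {}"
        then show "card (S \<inter> U) = card (T \<inter> U)" using S by (intro eq) auto
      qed auto
    qed (use A(1) in simp)
    then show "card {T \<in> A. share T = v} \<le> m" using classes[OF S(1)] by simp
  qed
  also have "\<dots> = card (share ` A) * m" by simp
  also have "\<dots> \<le> d ^ (d - 1) * m" using img by simp
  finally show ?thesis .
qed simp

section \<open>Correctness of pruning\<close>

definition proper :: "nat \<Rightarrow> nat list list \<Rightarrow> bool" where
  "proper d F \<longleftrightarrow> (\<forall>S \<in> set F. S \<noteq> [] \<and> distinct S \<and> length S \<le> d) \<and> distinct (map set F)"

abbreviation sets_of :: "nat list list \<Rightarrow> nat set set" where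
  "sets_of F \<equiv> set ` set F"

lemma proper_filter: "proper d F \<Longrightarrow> proper d (filter P F)"
  by (auto simp: proper_def distinct_map inj_on_def)

lemma proper_inj: "proper d F \<Longrightarrow> inj_on set (set F)"
  by (simp add: proper_def distinct_map)

lemma sets_of_delete:
  "proper d F \<Longrightarrow> S \<in> set F \<Longrightarrow> sets_of (filter (\<lambda>T. T \<noteq> S) F) = sets_of F - {set S}"
  using proper_inj[of d F] by (auto dest: inj_onD)

section \<open>Greedy sunflowers, cores and pruning of lists\<close>

lemma greedy_Nil: "greedy C [] = []"
  by (simp add: greedy_def)

lemma greedy_snoc: "greedy C (F @ [S]) = (if set C \<subseteq> set S \<and>
    (\<forall>T \<in> set (greedy C F). \<forall>x \<in> set S. x \<in> set T \<longrightarrow> x \<in> set C) then S # greedy C F else greedy C F)"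
  by (simp add: greedy_def)

lemma set_greedy: "S \<in> set (greedy C F) \<Longrightarrow> S \<in> set F \<and> set C \<subseteq> set S"
  by (induction F rule: rev_induct) (auto simp: greedy_Nil greedy_snoc split: if_splits)

lemma distinct_greedy: "distinct F \<Longrightarrow> distinct (greedy C F)"
proof (induction F rule: rev_induct)
  case (snoc S F)
  then show ?case using set_greedy[of S C F] by (auto simp: greedy_snoc)
qed (simp add: greedy_Nil)

lemma greedy_petals:
  "S \<in> set (greedy C F) \<Longrightarrow> T \<in> set (greedy C F) \<Longrightarrow> S \<noteq> T \<Longrightarrow> set S \<inter> set T \<subseteq> set C"
  by (induction F rule: rev_induct) (auto simp: greedy_Nil greedy_snoc split: if_splits)

lemma greedy_maximal:
  "S \<in> set F \<Longrightarrow> set C \<subseteq> set S \<Longrightarrow>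
    S \<in> set (greedy C F) \<or> (\<exists>T \<in> set (greedy C F). \<not> set S \<inter> set T \<subseteq> set C)"
  by (induction F rule: rev_induct) (auto simp: greedy_Nil greedy_snoc split: if_splits)

lemma cores_complete: "set C \<subseteq> set E \<Longrightarrow> length C \<le> n \<Longrightarrow> C \<in> set (cores n E)"
proof (induction n arbitrary: C)
  case (Suc n)
  show ?case
  proof (cases C)
    case Nil
    then show ?thesis using Suc.IH[of "[]"] by simp
  next
    case (Cons x C')
    then show ?thesis using Suc.prems Suc.IH[of C'] by auto
  qed
qed simp

lemma prune_step_cases:
  obtains "prune_step Us W m Cs F = F" "\<forall>S \<in> set F. \<not> redundant Us W m Cs F S"
  | S where "S \<in> set F" "redundant Us W m Cs F S"
      "prune_step Us W m Cs F = filter (\<lambda>T. T \<noteq> S) F"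
proof (cases "filter (\<lambda>S. redundant Us W m Cs F S) F")
  case Nil
  then show ?thesis using that(1) by (simp add: prune_step_def filter_empty_conv)
next
  case (Cons S Ss)
  then have "S \<in> set F" "redundant Us W m Cs F S" by (auto dest: filter_eq_ConsD)
  then show ?thesis using that(2)[of S] Cons by (simp add: prune_step_def)
qed

lemma prune_induct:
  assumes "P F"
    and step: "\<And>F S. P F \<Longrightarrow> S \<in> set F \<Longrightarrow> redundant Us W m Cs F S \<Longrightarrow> P (filter (\<lambda>T. T \<noteq> S) F)"
  shows "P (prune Us W m Cs F)"
proof -
  have "P (prune_step Us W m Cs G)" if "P G" for G
    using that step by (cases rule: prune_step_cases[of Us W m Cs G]) auto
  then have "P (fold (\<lambda>_ G. prune_step Us W m Cs G) xs G)" if "P G" for xs :: "nat list list" and G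
    using that by (induction xs arbitrary: G) auto
  then show ?thesis using assms(1) by (simp add: prune_def)
qed

text \<open>Either a round changed nothing, after which nothing changes any more, or every round
  shortened the list. In the second case the list ends up empty, which is stable too.\<close>

lemma prune_irredundant:
  "S \<in> set (prune Us W m Cs F) \<Longrightarrow> \<not> redundant Us W m Cs (prune Us W m Cs F) S"
proof -
  let ?s = "prune_step Us W m Cs"
  have shrink: "?s G = G \<or> length (?s G) < length G" for G
    by (cases rule: prune_step_cases[of Us W m Cs G]) (auto simp: length_filter_less)
  have fixp: "fold (\<lambda>_ G. ?s G) xs G = G" if "?s G = G" for xs :: "nat list list" and G
    using that by (induction xs) auto
  have "?s (fold (\<lambda>_ G. ?s G) xs G) = fold (\<lambda>_ G. ?s G) xs G \<or>
      length (fold (\<lambda>_ G. ?s G) xs G) + length xs \<le> length G" for xs :: "nat list list" and G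
  proof (induction xs arbitrary: G)
    case (Cons x xs)
    show ?case using shrink[of G]
    proof
      assume "?s G = G"
      then show ?thesis using fixp[of G "x # xs"] by simp
    next
      assume "length (?s G) < length G"
      then show ?thesis using Cons[of "?s G"] by auto
    qed
  qed simp
  from this[of F F] have "?s (prune Us W m Cs F) = prune Us W m Cs F"
    by (auto simp: prune_def prune_step_def)
  moreover assume "S \<in> set (prune Us W m Cs F)"
  ultimately show ?thesis
    by (cases rule: prune_step_cases[of Us W m Cs "prune Us W m Cs F"]) (auto simp: filter_id_conv)
qed

lemma set_candidates:
  "T \<in> set (candidates W C S F) \<longleftrightarrow>
    T \<in> set (greedy C (filter (\<lambda>T. length T = length S) F)) \<and> (set T - set C) \<inter> set W = {}"
  by (auto simp: candidates_def)

lemma similar_iff: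
  assumes "distinct S" "distinct T"
  shows "similar Us C S T \<longleftrightarrow>
    (\<forall>U \<in> sets_of Us. set C \<inter> U \<noteq> {} \<longrightarrow> card (set S \<inter> U) = card (set T \<inter> U))"
proof -
  have "length (filter (\<lambda>x. x \<in> set U) V) = card (set V \<inter> set U)" if "distinct V" for U V :: "nat list"
  proof -
    have "set (filter (\<lambda>x. x \<in> set U) V) = set V \<inter> set U" by auto
    then show ?thesis using that by (metis distinct_card distinct_filter)
  qed
  then show ?thesis using assms by (auto simp: similar_def disjoint_iff)
qed

text \<open>The executable test is turned into a sunflower of sets; \<open>S\<close> itself belongs
  to it because similarity is reflexive.\<close>

lemma redundantE:
  assumes F: "proper d F" and red: "redundant Us W m Cs F S"
  obtains L C where "set S \<in> L" "L \<subseteq> sets_of F" "length m < card L"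
    "\<And>T. T \<in> L \<Longrightarrow> set C \<subseteq> T" "\<And>T. T \<in> L \<Longrightarrow> card (set S) = card T"
    "\<And>T T'. T \<in> L \<Longrightarrow> T' \<in> L \<Longrightarrow> T \<noteq> T' \<Longrightarrow> T \<inter> T' \<subseteq> set C"
    "\<And>T. T \<in> L \<Longrightarrow> (T - set C) \<inter> set W = {}"
    "\<And>T U. T \<in> L \<Longrightarrow> U \<in> sets_of Us \<Longrightarrow> set C \<inter> U \<noteq> {} \<Longrightarrow> card (set S \<inter> U) = card (T \<inter> U)"
proof -
  obtain C where C: "S \<in> set (candidates W C S F)"
      "length m < length (filter (\<lambda>T. similar Us C S T) (candidates W C S F))"
    using red by (auto simp: redundant_def)
  define K where "K = filter (\<lambda>T. similar Us C S T) (candidates W C S F)"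
  have cand: "T \<in> set F" "set C \<subseteq> set T" "length T = length S" "(set T - set C) \<inter> set W = {}"
    if "T \<in> set (candidates W C S F)" for T
    using that set_greedy[of T C "filter (\<lambda>T. length T = length S) F"] by (auto simp: set_candidates)
  have dist: "distinct T" if "T \<in> set F" for T using that F by (simp add: proper_def)
  have "distinct F" using F by (simp add: proper_def distinct_map)
  then have "distinct K" by (simp add: K_def candidates_def distinct_greedy)
  moreover have "inj_on set (set K)"
    using proper_inj[OF F] cand(1) by (auto simp: K_def intro: inj_on_subset)
  ultimately have card: "card (sets_of K) = length K"
    by (simp add: card_image distinct_card)
  show thesis
  proof (rule that[of "sets_of K" C])
    show "set S \<in> sets_of K" using C(1) by (auto simp: K_def similar_def)
    show "sets_of K \<subseteq> sets_of F" using cand(1) by (auto simp: K_def)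
    show "length m < card (sets_of K)" using C(2) card by (simp add: K_def)
    show "T \<inter> T' \<subseteq> set C" if T: "T \<in> sets_of K" "T' \<in> sets_of K" "T \<noteq> T'" for T T'
    proof -
      obtain R R' where "T = set R" "T' = set R'" "R \<in> set K" "R' \<in> set K" using T by auto
      then show ?thesis
        using T(3) greedy_petals[of R C "filter (\<lambda>T. length T = length S) F" R']
        by (auto simp: K_def set_candidates)
    qed
    show "card (set S) = card T" if T: "T \<in> sets_of K" for T
    proof -
      obtain R where R: "T = set R" "R \<in> set (candidates W C S F)" using T by (auto simp: K_def)
      show ?thesis
        using cand(3)[OF R(2)] dist[OF cand(1)[OF R(2)]] dist[OF cand(1)[OF C(1)]] R(1)
        by (simp add: distinct_card)
    qed
    show "card (set S \<inter> U) = card (T \<inter> U)"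
      if T: "T \<in> sets_of K" and U: "U \<in> sets_of Us" "set C \<inter> U \<noteq> {}" for T U
    proof -
      obtain R where R: "T = set R" "R \<in> set (candidates W C S F)" "similar Us C S R"
        using T by (auto simp: K_def)
      show ?thesis
        using similar_iff[of S R Us C] R dist[OF cand(1)[OF R(2)]] dist[OF cand(1)[OF C(1)]] U
        by auto
    qed
    show "set C \<subseteq> T" "(T - set C) \<inter> set W = {}" if T: "T \<in> sets_of K" for T
    proof -
      obtain R where R: "T = set R" "R \<in> set (candidates W C S F)" using T by (auto simp: K_def)
      show "set C \<subseteq> T" "(T - set C) \<inter> set W = {}" using cand(2,4)[OF R(2)] R(1) by simp_all
    qed
  qed
qed

text \<open>\<open>N\<close> holds the rest of the family, which occurs in packings while only the
  internal sets are being pruned.\<close>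

lemma attainable_delete_redundant_internal:
  assumes Ps: "pairwise disjnt (sets_of Us)"
    and F: "proper d F" "\<And>S. S \<in> set F \<Longrightarrow> is_internal Us S"
    and N: "finite N" "\<And>S. S \<in> N \<Longrightarrow> finite S \<and> card S \<le> d" "sets_of F \<inter> N = {}"
    and H: "finite H" "\<And>S. S \<in> sets_of F \<union> N \<Longrightarrow> S \<inter> H \<noteq> {}" "length m = d * card H"
    and S: "S \<in> set F" "redundant Us W m Cs F S"
  shows "attainable (sets_of Us) (sets_of (filter (\<lambda>T. T \<noteq> S) F) \<union> N) k \<longleftrightarrow>
    attainable (sets_of Us) (sets_of F \<union> N) k"
proof (rule redundantE[OF F(1) S(2)])
  let ?G = "sets_of F \<union> N"
  fix L C
  assume L: "set S \<in> L" "L \<subseteq> sets_of F" "length m < card L"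
    "\<And>T. T \<in> L \<Longrightarrow> set C \<subseteq> T" "\<And>T. T \<in> L \<Longrightarrow> card (set S) = card T"
    "\<And>T T'. T \<in> L \<Longrightarrow> T' \<in> L \<Longrightarrow> T \<noteq> T' \<Longrightarrow> T \<inter> T' \<subseteq> set C"
    "\<And>T. T \<in> L \<Longrightarrow> (T - set C) \<inter> set W = {}"
    "\<And>T U. T \<in> L \<Longrightarrow> U \<in> sets_of Us \<Longrightarrow> set C \<inter> U \<noteq> {} \<Longrightarrow> card (set S \<inter> U) = card (T \<inter> U)"
  have size: "finite T \<and> card T \<le> d" if "T \<in> ?G" for T
    using that F(1) N(2) by (auto simp: proper_def distinct_card)
  have S': "S \<noteq> []" "length S \<le> d" using S(1) F(1) by (auto simp: proper_def)
  \<comment> \<open>With an empty core the sunflower would be a packing larger than the hitting set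
    permits. A core element then ties all its members to a single part.\<close>
  have "set C \<noteq> {}"
  proof
    assume "set C = {}"
    then have "pairwise disjnt L" using L(6) by (auto intro!: pairwise_disjntI)
    then have "card L \<le> card H"
      by (rule card_packing_le_hitting(2)[OF H(1)]) (use H(2) L(2) in auto)
    moreover have "card H \<le> d * card H" using S' by (cases d) auto
    ultimately show False using L(3) H(3) by simp
  qed
  then obtain c where c: "c \<in> set C" by (meson ex_in_conv)
  obtain U where U: "U \<in> set Us" "set S \<subseteq> set U" using F(2)[OF S(1)] by (auto simp: is_internal_def)
  have LU: "T \<subseteq> set U" if T: "T \<in> L" for T
  proof -
    obtain R where R: "T = set R" "R \<in> set F" using T L(2) by blast
    obtain V where V: "V \<in> sets_of Us" "T \<subseteq> V"
      using F(2)[OF R(2)] R(1) by (auto simp: is_internal_def)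
    have "c \<in> V \<inter> set U" using V U c L(4)[OF T] L(4)[OF L(1)] by blast
    then have "V = set U" using pairwise_disjntD[OF Ps V(1), of "set U"] U by auto
    then show ?thesis using V by simp
  qed
  have "attainable (sets_of Us) (?G - {set S}) k \<longleftrightarrow> attainable (sets_of Us) ?G k"
  proof (rule attainable_delete_internal[OF _ _ Ps _ U(2)])
    show "finite ?G" using N by simp
    fix Z assume Z: "Z \<subseteq> ?G" "pairwise disjnt Z" "set S \<in> Z"
    have "\<exists>T \<in> L. T \<noteq> set S \<and> T \<inter> \<Union> (Z - {set S}) = {}"
      by (rule free_petal[of ?G d H "set S" L "set C"]) (use size H L Z in auto)
    then obtain T where T: "T \<in> L" "T \<noteq> set S" "T \<inter> \<Union> (Z - {set S}) = {}" by blast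
    then show "\<exists>T \<in> ?G. T \<noteq> set S \<and> T \<subseteq> set U \<and> card (set S) = card T \<and> T \<inter> \<Union> (Z - {set S}) = {}"
      using L(2) L(5)[OF T(1)] LU[OF T(1)] by (intro bexI[of _ T]) auto
  qed (use size S S' U in auto)
  moreover have "?G - {set S} = sets_of (filter (\<lambda>T. T \<noteq> S) F) \<union> N"
  proof -
    have "set S \<notin> N" using N(3) S(1) by blast
    then show ?thesis unfolding sets_of_delete[OF F(1) S(1)] by blast
  qed
  ultimately show ?thesis by simp
qed

text \<open>That \<open>S\<close> is not internal is recorded in the conclusion because it preserves
  the equation for \<open>W\<close> along the iteration.\<close>

lemma attainable_delete_redundant_external:
  assumes F: "proper d F"
    and W: "set W = \<Union> {S \<in> sets_of F. \<exists>U \<in> sets_of Us. S \<subseteq> U}"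
    and H: "finite H" "\<And>S. S \<in> sets_of F \<Longrightarrow> S \<inter> H \<noteq> {}" "length m = d * card H"
    and S: "S \<in> set F" "redundant Us W m Cs F S"
  shows "(attainable (sets_of Us) (sets_of (filter (\<lambda>T. T \<noteq> S) F)) k \<longleftrightarrow>
      attainable (sets_of Us) (sets_of F) k) \<and> \<not> is_internal Us S"
proof (rule redundantE[OF F S(2)])
  fix L C
  assume L: "set S \<in> L" "L \<subseteq> sets_of F" "length m < card L"
    "\<And>T. T \<in> L \<Longrightarrow> set C \<subseteq> T" "\<And>T. T \<in> L \<Longrightarrow> card (set S) = card T"
    "\<And>T T'. T \<in> L \<Longrightarrow> T' \<in> L \<Longrightarrow> T \<noteq> T' \<Longrightarrow> T \<inter> T' \<subseteq> set C"
    "\<And>T. T \<in> L \<Longrightarrow> (T - set C) \<inter> set W = {}"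
    "\<And>T U. T \<in> L \<Longrightarrow> U \<in> sets_of Us \<Longrightarrow> set C \<inter> U \<noteq> {} \<Longrightarrow> card (set S \<inter> U) = card (T \<inter> U)"
  have size: "finite T \<and> card T \<le> d" if "T \<in> sets_of F" for T
    using that F by (auto simp: proper_def distinct_card)
  have S': "S \<noteq> []" "length S \<le> d" using S(1) F by (auto simp: proper_def)
  have "finite L" using L(2) by (auto intro: finite_subset)
  \<comment> \<open>If the core were all of \<open>S\<close>, equal sizes would collapse the
    sunflower to \<open>S\<close> alone, too few for a threshold of at least one.\<close>
  have notsub: "\<not> set S \<subseteq> set C"
  proof
    assume sub: "set S \<subseteq> set C"
    have "T = set S" if "T \<in> L" for T
      using card_subset_eq[of T "set S"] L(4,5)[OF that] sub that L(2) by force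
    then have "card L \<le> card {set S}" by (intro card_mono) auto
    moreover have "H \<noteq> {}" using H(2) S(1) by blast
    then have "1 \<le> d * card H" using H(1) S' by (cases d) (auto simp: Suc_le_eq card_gt_0_iff)
    ultimately show False using L(3) H(3) by simp
  qed
  have "attainable (sets_of Us) (sets_of F - {set S}) k \<longleftrightarrow> attainable (sets_of Us) (sets_of F) k"
  proof (rule attainable_delete_external[where C = "set C"], unfold W[symmetric])
    fix Z assume Z: "Z \<subseteq> sets_of F" "pairwise disjnt Z" "set S \<in> Z"
    have "\<exists>T \<in> L. T \<noteq> set S \<and> T \<inter> \<Union> (Z - {set S}) = {}"
      by (rule free_petal[of "sets_of F" d H "set S" L "set C"]) (use size H L Z in auto)
    then obtain T where "T \<in> L" "T \<noteq> set S" "T \<inter> \<Union> (Z - {set S}) = {}" by blast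
    then show "\<exists>T \<in> sets_of F. T \<noteq> set S \<and> card (set S) = card T \<and> set C \<subseteq> T \<and>
        (T - set C) \<inter> set W = {} \<and> (\<forall>U \<in> sets_of Us. set C \<inter> U \<noteq> {} \<longrightarrow>
        card (set S \<inter> U) = card (T \<inter> U)) \<and> T \<inter> \<Union> (Z - {set S}) = {}"
      using L(2) L(4,5,7,8)[of T] by (intro bexI[of _ T] conjI ballI impI) auto
  qed (use size S L(4)[OF L(1)] L(7)[OF L(1)] notsub in auto)
  moreover have "\<not> is_internal Us S"
  proof
    assume "is_internal Us S"
    then have "set S \<subseteq> set W" using W S(1) unfolding is_internal_def by blast
    then show False using L(7)[OF L(1)] notsub by blast
  qed
  ultimately show ?thesis using sets_of_delete[OF F S(1)] by simp
qed

section \<open>Size of irredundant families\<close>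

lemma length_le_if_greedy_bounded:
  assumes F: "proper d F" "set (concat F) \<subseteq> set E" and t: "1 \<le> t"
    and greedy: "\<And>C s. C \<in> set (cores d E) \<Longrightarrow> length (greedy C (filter (\<lambda>T. length T = s) F)) \<le> t"
  shows "length F \<le> d * fact d * t ^ d"
proof -
  let ?F = "\<lambda>s. filter (\<lambda>T. length T = s) F"
  have dF: "distinct F" using F(1) by (simp add: proper_def distinct_map)
  \<comment> \<open>The counting starts from the empty core and treats each set size separately;
    summing over the sizes \<open>1..d\<close> produces the factor \<open>d\<close>.\<close>
  have bound: "length (?F s) \<le> fact d * t ^ d" if s: "s \<le> d" for s
  proof -
    have "card {S \<in> sets_of (?F s). {} \<subseteq> S} \<le> fact s * t ^ s"
    proof (rule card_sunflower_free)
      fix A assume "\<exists>S \<in> sets_of (?F s). A \<subseteq> S"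
      then obtain R where R: "R \<in> set F" "length R = s" "A \<subseteq> set R" by auto
      then have "finite A" "card A \<le> d"
        using s card_mono[of "set R" A] card_length[of R] by (auto intro: finite_subset)
      then obtain C where C: "set C = A" "distinct C" using finite_distinct_list by blast
      have "C \<in> set (cores d E)"
        using C R F(2) \<open>card A \<le> d\<close> by (intro cores_complete) (auto simp: distinct_card[symmetric])
      let ?L = "greedy C (?F s)"
      show "\<exists>L \<subseteq> {S \<in> sets_of (?F s). A \<subseteq> S}. card L \<le> t \<and>
          (\<forall>S \<in> sets_of (?F s). A \<subseteq> S \<longrightarrow> S \<in> L \<or> (\<exists>T \<in> L. \<not> S \<inter> T \<subseteq> A))"
      proof (intro exI[of _ "sets_of ?L"] conjI ballI impI)
        show "sets_of ?L \<subseteq> {S \<in> sets_of (?F s). A \<subseteq> S}"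
        proof
          fix S assume "S \<in> sets_of ?L"
          then obtain R where "S = set R" "R \<in> set ?L" by blast
          then show "S \<in> {S \<in> sets_of (?F s). A \<subseteq> S}" using set_greedy[of R C "?F s"] C by simp
        qed
        have "card (sets_of ?L) \<le> card (set ?L)" by (rule card_image_le) simp
        also have "\<dots> \<le> length ?L" by (rule card_length)
        also have "\<dots> \<le> t" by (rule greedy) fact
        finally show "card (sets_of ?L) \<le> t" .
        fix S assume "S \<in> sets_of (?F s)" "A \<subseteq> S"
        then obtain R where "S = set R" "R \<in> set (?F s)" "A \<subseteq> set R" by auto
        then show "S \<in> sets_of ?L \<or> (\<exists>T \<in> sets_of ?L. \<not> S \<inter> T \<subseteq> A)"
          using greedy_maximal[of R "?F s" C] C by auto
      qed
    next
      fix S assume "S \<in> sets_of (?F s)"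
      then show "finite S \<and> card S = s" using F(1) by (auto simp: proper_def distinct_card)
    qed auto
    moreover have "card (sets_of (?F s)) = length (?F s)"
      using dF by (simp only: card_image[OF proper_inj[OF proper_filter[OF F(1)]]] distinct_card distinct_filter)
    moreover have "fact s * t ^ s \<le> fact d * t ^ d"
      using s t by (intro mult_mono fact_mono power_increasing) auto
    ultimately show ?thesis by simp
  qed
  have "set F \<subseteq> (\<Union>s \<in> {1..d}. set (?F s))"
  proof
    fix S assume "S \<in> set F"
    moreover from this have "length S \<in> {1..d}"
      using F(1) by (auto simp: proper_def Suc_le_eq)
    ultimately show "S \<in> (\<Union>s \<in> {1..d}. set (?F s))" by auto
  qed
  then have "card (set F) \<le> card (\<Union>s \<in> {1..d}. set (?F s))" by (intro card_mono) auto
  also have "\<dots> \<le> (\<Sum>s \<in> {1..d}. card (set (?F s)))" by (rule card_UN_le) simp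
  also have "\<dots> \<le> (\<Sum>s \<in> {1..d}. fact d * t ^ d)"
    using bound by (intro sum_mono order_trans[OF card_length]) auto
  finally show ?thesis using dF by (simp add: distinct_card algebra_simps)
qed

text \<open>With nothing forbidden all greedy sets are candidates, and they are pairwise similar,
  since a part meeting the core contains each of them entirely. A long greedy family would make its
  members redundant.\<close>

lemma greedy_bound_internal:
  assumes Ps: "pairwise disjnt (sets_of Us)"
    and F: "proper d F" "\<And>S. S \<in> set F \<Longrightarrow> is_internal Us S"
    and irr: "\<And>S. S \<in> set F \<Longrightarrow> \<not> redundant Us [] m Cs F S" and C: "C \<in> set Cs"
  shows "length (greedy C (filter (\<lambda>T. length T = s) F)) \<le> length m"
proof (rule ccontr)
  let ?L = "greedy C (filter (\<lambda>T. length T = s) F)"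
  assume "\<not> ?thesis"
  then have len: "length m < length ?L" by simp
  then obtain S where S: "S \<in> set ?L" by (cases ?L) auto
  have L: "T \<in> set F" "length T = s" "set C \<subseteq> set T" if "T \<in> set ?L" for T
    using set_greedy[OF that] by auto
  have cand: "candidates [] C S F = ?L"
    using L(2)[OF S] by (simp add: candidates_def)
  have in_part: "length (filter (\<lambda>x. x \<in> set U) T) = s"
    if T: "T \<in> set ?L" and U: "U \<in> set Us" "x \<in> set C" "x \<in> set U" for T U x
  proof -
    obtain V where V: "V \<in> set Us" "set T \<subseteq> set V"
      using F(2)[OF L(1)[OF T]] by (auto simp: is_internal_def)
    have "x \<in> set V" using V U L(3)[OF T] by auto
    then have "set V = set U" using pairwise_disjntD[OF Ps, of "set V" "set U"] U V by auto
    then have "filter (\<lambda>x. x \<in> set U) T = T" using V by (auto simp: filter_id_conv)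
    then show ?thesis using L(2)[OF T] by simp
  qed
  have "filter (\<lambda>T. similar Us C S T) ?L = ?L"
    using in_part S by (auto simp: similar_def filter_id_conv)
  then have "redundant Us [] m Cs F S"
    unfolding redundant_def using C S len cand by (intro bexI[of _ C]) auto
  then show False using irr L(1)[OF S] by blast
qed

text \<open>Petals are disjoint, so at most \<open>length W\<close> of them meet \<open>W\<close>.
  The others fall into at most \<open>d ^ (d - 1)\<close> similarity classes, none of which exceeds
  the threshold.\<close>

lemma greedy_bound:
  assumes Ps: "pairwise disjnt (sets_of Us)" and d: "1 \<le> d"
    and F: "proper d F"
    and irr: "\<And>S. S \<in> set F \<Longrightarrow> \<not> redundant Us W m Cs F S" and C: "C \<in> set Cs"
  shows "length (greedy C (filter (\<lambda>T. length T = s) F)) \<le> length W + d ^ (d - 1) * length m"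
proof -
  let ?L = "greedy C (filter (\<lambda>T. length T = s) F)"
  let ?G = "filter (\<lambda>T. \<forall>x \<in> set T. x \<in> set W \<longrightarrow> x \<in> set C) ?L"
  let ?B = "filter (\<lambda>T. \<not> (\<forall>x \<in> set T. x \<in> set W \<longrightarrow> x \<in> set C)) ?L"
  have dF: "distinct F" using F by (simp add: proper_def distinct_map)
  then have dL: "distinct ?L" by (simp add: distinct_greedy)
  have L: "T \<in> set F" "length T = s" "set C \<subseteq> set T" "distinct T" "length T \<le> d" if "T \<in> set ?L" for T
    using set_greedy[OF that] F by (auto simp: proper_def)
  have "card (set ?B) \<le> card (set W)"
  proof (rule card_le_transversal(2)[where g = "\<lambda>T. set T - set C"])
    fix T T' assume "T \<in> set ?B" "T' \<in> set ?B" "T \<noteq> T'"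
    then show "(set T - set C) \<inter> (set T' - set C) = {}"
      using greedy_petals[of T C "filter (\<lambda>T. length T = s) F" T'] by auto
  qed auto
  then have B: "length ?B \<le> length W"
    using dL card_length[of W] distinct_card[of ?B] by simp
  have inj: "inj_on set (set ?G)"
    by (rule inj_on_subset[OF proper_inj[OF F]]) (use L(1) in auto)
  have "card (sets_of ?G) \<le> d ^ (d - 1) * length m"
  proof (cases "?G = []")
    case False
    then obtain S0 where "S0 \<in> set ?G" by (meson last_in_set)
    then have "s \<le> d" using L(2,5)[of S0] by auto
    show ?thesis
    proof (rule card_similarity_classes[of _ s "set C" d "sets_of Us"])
      fix S' assume "S' \<in> sets_of ?G"
      then obtain S where S: "S' = set S" "S \<in> set ?G" by auto
      let ?K = "filter (\<lambda>T. similar Us C S T) ?G"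
      have SL: "S \<in> set ?L" using S by simp
      have "candidates W C S F = ?G" using L(2)[OF SL] by (simp add: candidates_def)
      then have K: "length ?K \<le> length m"
        using irr[OF L(1)[OF SL]] C S(2) unfolding redundant_def by (metis not_le)
      have "{T \<in> sets_of ?G. \<forall>U \<in> sets_of Us. set C \<inter> U \<noteq> {} \<longrightarrow> card (S' \<inter> U) = card (T \<inter> U)}
          \<subseteq> sets_of ?K"
      proof
        fix T' assume T': "T' \<in> {T \<in> sets_of ?G. \<forall>U \<in> sets_of Us. set C \<inter> U \<noteq> {} \<longrightarrow>
          card (S' \<inter> U) = card (T \<inter> U)}"
        then obtain T where T: "T' = set T" "T \<in> set ?G" by auto
        then have "similar Us C S T"
          using T' L(4)[of S] L(4)[of T] S by (subst similar_iff) auto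
        then show "T' \<in> sets_of ?K" using T by auto
      qed
      then have "card {T \<in> sets_of ?G. \<forall>U \<in> sets_of Us. set C \<inter> U \<noteq> {} \<longrightarrow> card (S' \<inter> U) = card (T \<inter> U)}
          \<le> card (sets_of ?K)" by (rule card_mono[rotated]) simp
      also have "\<dots> \<le> card (set ?K)" by (rule card_image_le) simp
      also have "\<dots> \<le> length ?K" by (rule card_length)
      finally show "card {T \<in> sets_of ?G. \<forall>U \<in> sets_of Us. set C \<inter> U \<noteq> {} \<longrightarrow>
          card (S' \<inter> U) = card (T \<inter> U)} \<le> length m" using K by simp
    next
      fix S assume "S \<in> sets_of ?G"
      then obtain R where "S = set R" "R \<in> set ?L" by auto
      then show "finite S \<and> card S = s \<and> set C \<subseteq> S"
        using L(2-4)[of R] by (simp add: distinct_card)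
    qed (use d Ps \<open>s \<le> d\<close> in auto)
  qed simp
  then have "length ?G \<le> d ^ (d - 1) * length m"
    using dL inj by (simp only: card_image distinct_card distinct_filter)
  then show ?thesis using B sum_length_filter_compl[of "\<lambda>T. \<forall>x \<in> set T. x \<in> set W \<longrightarrow> x \<in> set C" ?L]
    by linarith
qed

section \<open>The pruned families of an input instance\<close>

locale description =
  fixes d :: nat and Us Ss :: "nat list list"
  assumes parts_disjoint: "sorted_wrt (\<lambda>U V. disjnt (set U) (set V)) Us"
    and distinct_parts: "\<And>U. U \<in> set Us \<Longrightarrow> distinct U"
    and proper: "proper d (filter (\<lambda>S. S \<noteq> []) Ss)"
    and covered: "\<And>S. S \<in> set Ss \<Longrightarrow> set S \<subseteq> \<Union> (sets_of Us)"
begin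

abbreviation "Fs \<equiv> filter (\<lambda>S. S \<noteq> []) Ss"

text \<open>Disjointness is assumed by position, which admits repeated empty parts; in the set of
  parts they merge.\<close>

lemma pairwise_disjnt_parts: "pairwise disjnt (sets_of Us)"
  using parts_disjoint
proof (induction Us)
  case (Cons U Us)
  then show ?case by (auto simp: pairwise_insert disjnt_sym)
qed simp

lemma sets_of_Fs: "sets_of Fs = sets_of Ss - {{}}"
  by auto

lemma attainable_Fs: "attainable Ps (sets_of Fs) k \<longleftrightarrow> attainable Ps (sets_of Ss) k"
  unfolding sets_of_Fs by (rule attainable_Diff_empty)

lemma set_max_packing: "S \<in> set (max_packing Ss) \<Longrightarrow> S \<in> set Fs"
  using set_greedy[of S "[]" Fs] by (simp add: max_packing_def)

lemma distinct_Fs: "distinct Fs"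
  using proper by (simp add: proper_def distinct_map)

lemma distinct_max_packing: "distinct (max_packing Ss)"
  unfolding max_packing_def by (rule distinct_greedy[OF distinct_Fs])

lemma max_packing_disjoint:
  "S \<in> set (max_packing Ss) \<Longrightarrow> T \<in> set (max_packing Ss) \<Longrightarrow> S \<noteq> T \<Longrightarrow> set S \<inter> set T = {}"
  using greedy_petals[of S "[]" Fs T] by (simp add: max_packing_def)

lemma hitting_hits:
  assumes "S \<in> set Fs"
  shows "set S \<inter> set (hitting Ss) \<noteq> {}"
proof -
  have "S \<in> set (max_packing Ss) \<or> (\<exists>T \<in> set (max_packing Ss). set S \<inter> set T \<noteq> {})"
    using greedy_maximal[OF assms, of "[]"] by (simp add: max_packing_def)
  moreover have "set S \<inter> set S \<noteq> {}" using assms by simp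
  ultimately obtain T where "T \<in> set (max_packing Ss)" "set S \<inter> set T \<noteq> {}" by blast
  then show ?thesis by (auto simp: hitting_def)
qed

lemma distinct_hitting: "distinct (hitting Ss)"
  unfolding hitting_def
proof (rule distinct_concat)
  show "distinct (max_packing Ss)" by (rule distinct_max_packing)
  show "distinct T" if "T \<in> set (max_packing Ss)" for T
    using set_max_packing[OF that] proper by (simp add: proper_def)
  show "set T \<inter> set T' = {}" if "T \<in> set (max_packing Ss)" "T' \<in> set (max_packing Ss)" "T \<noteq> T'" for T T'
    using that by (rule max_packing_disjoint)
qed

lemma length_hitting: "length (hitting Ss) \<le> d * length (max_packing Ss)"
proof -
  have "length T \<le> d" if "T \<in> set (max_packing Ss)" for T
    using set_max_packing[OF that] proper by (simp add: proper_def)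
  then have "sum_list (map length (max_packing Ss)) \<le> sum_list (map (\<lambda>_. d) (max_packing Ss))"
    by (rule sum_list_mono)
  then show ?thesis by (simp add: hitting_def length_concat sum_list_triv mult.commute)
qed

lemma attainable_if_surely_yes:
  assumes "k \<le> int (length (max_packing Ss))"
  shows "attainable (sets_of Us) (sets_of Ss) k"
proof -
  have "inj_on set (set (max_packing Ss))"
    by (rule inj_on_subset[OF proper_inj[OF proper]]) (use set_max_packing in blast)
  then have "card (sets_of (max_packing Ss)) = length (max_packing Ss)"
    by (simp add: card_image distinct_card distinct_max_packing)
  moreover have "pairwise disjnt (sets_of (max_packing Ss))"
  proof (rule pairwise_disjntI)
    fix S T assume "S \<in> sets_of (max_packing Ss)" "T \<in> sets_of (max_packing Ss)" "S \<noteq> T"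
    then obtain S' T' where "S = set S'" "T = set T'" "S' \<in> set (max_packing Ss)"
      "T' \<in> set (max_packing Ss)" "S' \<noteq> T'" by auto
    then show "S \<inter> T = {}" using max_packing_disjoint by simp
  qed
  moreover have "sets_of (max_packing Ss) \<subseteq> sets_of Fs" using set_max_packing by blast
  moreover have "{} \<notin> sets_of (max_packing Ss)" using set_max_packing[of "[]"] by auto
  ultimately have "attainable (sets_of Us) (sets_of Fs) k"
    using assms pairwise_disjnt_parts by (intro attainable_if_packing[where M = "sets_of (max_packing Ss)"]) auto
  then show ?thesis by (simp only: attainable_Fs)
qed

abbreviation "threshold \<equiv> concat (replicate d (hitting Ss))"
abbreviation "Cs \<equiv> cores d (concat Ss)"
abbreviation "external \<equiv> filter (\<lambda>S. S \<noteq> [] \<and> \<not> is_internal Us S) Ss"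
abbreviation "RI \<equiv> reduced_internal d Us Ss"
abbreviation "RF \<equiv> reduced d Us Ss"

lemma length_threshold: "length threshold = d * length (hitting Ss)"
  by (simp add: length_concat sum_list_replicate)

lemma card_hitting: "card (set (hitting Ss)) = length (hitting Ss)"
  by (rule distinct_card[OF distinct_hitting])

text \<open>Attainability is tracked for the surviving internal sets together with all external
  ones, since packings mix the two kinds.\<close>

lemma RI_invariant:
  "proper d RI \<and> (\<forall>S \<in> set RI. is_internal Us S) \<and> set RI \<subseteq> set Fs \<and>
    (attainable (sets_of Us) (sets_of RI \<union> sets_of external) k \<longleftrightarrow> attainable (sets_of Us) (sets_of Ss) k)"
  unfolding reduced_internal_def
proof (rule prune_induct, goal_cases)
  case 1
  let ?I = "filter (\<lambda>S. S \<noteq> [] \<and> is_internal Us S) Ss"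
  have I: "?I = filter (is_internal Us) Fs" by (simp add: conj_commute)
  have "proper d ?I" unfolding I by (rule proper_filter[OF proper])
  moreover have "sets_of ?I \<union> sets_of external = sets_of Fs" by auto
  ultimately show ?case by (auto simp only: attainable_Fs) auto
next
  case (2 F S)
  let ?F = "filter (\<lambda>T. T \<noteq> S) F"
  have F: "proper d F" "\<And>S. S \<in> set F \<Longrightarrow> is_internal Us S" "set F \<subseteq> set Fs" using 2(1) by auto
  have "attainable (sets_of Us) (sets_of ?F \<union> sets_of external) k \<longleftrightarrow>
    attainable (sets_of Us) (sets_of F \<union> sets_of external) k"
  proof (rule attainable_delete_redundant_internal[OF pairwise_disjnt_parts F(1,2) _ _ _ _ _ _ 2(2,3)])
    show "length threshold = d * card (set (hitting Ss))"
      by (simp only: length_threshold card_hitting)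
    show "finite T \<and> card T \<le> d" if "T \<in> sets_of external" for T
      using that proper by (auto simp: proper_def distinct_card)
    show "T \<inter> set (hitting Ss) \<noteq> {}" if T: "T \<in> sets_of F \<union> sets_of external" for T
    proof -
      obtain R where "T = set R" "R \<in> set Fs" using T F(3) by auto
      then show ?thesis using hitting_hits by simp
    qed
    show "sets_of F \<inter> sets_of external = {}"
      using F(2) by (fastforce simp: is_internal_def)
  qed auto
  moreover have "proper d ?F" by (rule proper_filter[OF F(1)])
  ultimately show ?case using 2(1) by auto
qed

lemmas RI = RI_invariant[THEN conjunct1] RI_invariant[THEN conjunct2, THEN conjunct1, THEN bspec]
  RI_invariant[THEN conjunct2, THEN conjunct2, THEN conjunct1]
  RI_invariant[THEN conjunct2, THEN conjunct2, THEN conjunct2]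

lemma proper_RI_external: "proper d (RI @ external)"
proof -
  have E: "external = filter (\<lambda>S. \<not> is_internal Us S) Fs" by (simp add: conj_commute)
  have "proper d external" unfolding E by (rule proper_filter[OF proper])
  moreover have "sets_of RI \<inter> sets_of external = {}"
    using RI(2) by (fastforce simp: is_internal_def)
  ultimately show ?thesis using RI(1) by (auto simp: proper_def)
qed

lemma is_internal_iff: "is_internal Us S \<longleftrightarrow> (\<exists>U \<in> sets_of Us. set S \<subseteq> U)"
  by (auto simp: is_internal_def)

text \<open>The forbidden elements are computed only once. The third conjunct keeps them valid, as
  this pass deletes no internal set.\<close>

lemma RF_invariant:
  "proper d RF \<and> set RF \<subseteq> set Fs \<and>
    set (concat RI) = \<Union> {S \<in> sets_of RF. \<exists>U \<in> sets_of Us. S \<subseteq> U} \<and>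
    (attainable (sets_of Us) (sets_of RF) k \<longleftrightarrow> attainable (sets_of Us) (sets_of Ss) k)"
  unfolding reduced_def
proof (rule prune_induct, goal_cases)
  case 1
  have "sets_of (RI @ external) = sets_of RI \<union> sets_of external" by auto
  moreover have "set (RI @ external) \<subseteq> set Fs" using RI(3) by auto
  moreover have "set (concat RI) = \<Union> {S \<in> sets_of (RI @ external). \<exists>U \<in> sets_of Us. S \<subseteq> U}"
    (is "_ = \<Union> ?W")
  proof -
    have "?W = sets_of RI" using RI(2) by (fastforce simp: is_internal_def)
    then show ?thesis by simp
  qed
  ultimately show ?case using RI(4) proper_RI_external by simp
next
  case (2 F S)
  let ?F = "filter (\<lambda>T. T \<noteq> S) F"
  let ?W = "\<lambda>F. {S \<in> sets_of F. \<exists>U \<in> sets_of Us. S \<subseteq> U}"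
  have F: "proper d F" "set F \<subseteq> set Fs" "set (concat RI) = \<Union> (?W F)"
    "attainable (sets_of Us) (sets_of F) k \<longleftrightarrow> attainable (sets_of Us) (sets_of Ss) k" using 2(1) by auto
  have del: "(attainable (sets_of Us) (sets_of ?F) k \<longleftrightarrow> attainable (sets_of Us) (sets_of F) k) \<and>
      \<not> is_internal Us S"
  proof (rule attainable_delete_redundant_external[OF F(1,3) _ _ _ 2(2,3)])
    show "length threshold = d * card (set (hitting Ss))"
      by (simp only: length_threshold card_hitting)
    show "T \<inter> set (hitting Ss) \<noteq> {}" if T: "T \<in> sets_of F" for T
    proof -
      obtain R where "T = set R" "R \<in> set Fs" using T F(2) by auto
      then show ?thesis using hitting_hits by simp
    qed
  qed auto
  then have "?W ?F = ?W F"
    unfolding sets_of_delete[OF F(1) 2(2)] is_internal_iff by blast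
  then show ?case using F proper_filter[OF F(1)] del by auto
qed

lemmas RF = RF_invariant[THEN conjunct1] RF_invariant[THEN conjunct2, THEN conjunct1]
  RF_invariant[THEN conjunct2, THEN conjunct2, THEN conjunct2]

lemma length_RI:
  assumes "1 \<le> t" "d * length (hitting Ss) \<le> t"
  shows "length RI \<le> d * fact d * t ^ d"
proof (rule length_le_if_greedy_bounded[OF RI(1) _ assms(1)])
  show "set (concat RI) \<subseteq> set (concat Ss)" using RI(3) by auto
  fix C s assume C: "C \<in> set Cs"
  have "length (greedy C (filter (\<lambda>T. length T = s) RI)) \<le> length threshold"
    by (rule greedy_bound_internal[OF pairwise_disjnt_parts RI(1) RI(2) _ C])
      (simp_all add: reduced_internal_def prune_irredundant)
  then show "length (greedy C (filter (\<lambda>T. length T = s) RI)) \<le> t"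
    using assms(2) by (simp only: length_threshold)
qed

lemma length_concat_RI: "length (concat RI) \<le> d * length RI"
proof -
  have "sum_list (map length RI) \<le> sum_list (map (\<lambda>_. d) RI)"
    using RI(1) by (intro sum_list_mono) (simp add: proper_def)
  then show ?thesis by (simp add: length_concat sum_list_triv mult.commute)
qed

lemma length_RF:
  assumes "1 \<le> d" "1 \<le> t" "d * length RI + d ^ (d - 1) * (d * length (hitting Ss)) \<le> t"
  shows "length RF \<le> d * fact d * t ^ d"
proof (rule length_le_if_greedy_bounded[OF RF(1) _ assms(2)])
  show "set (concat RF) \<subseteq> set (concat Ss)" using RF(2) by auto
  fix C s assume C: "C \<in> set Cs"
  have "length (greedy C (filter (\<lambda>T. length T = s) RF)) \<le>
      length (concat RI) + d ^ (d - 1) * length threshold"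
    by (rule greedy_bound[OF pairwise_disjnt_parts assms(1) RF(1) _ C])
      (simp add: reduced_def prune_irredundant)
  then show "length (greedy C (filter (\<lambda>T. length T = s) RF)) \<le> t"
    using assms(3) length_concat_RI unfolding length_threshold by linarith
qed

end

section \<open>Renaming the elements\<close>

lemma refuses_Int:
  assumes "\<Union> F \<subseteq> E" "X \<subseteq> F"
  shows "refuses F (U \<inter> E) X \<longleftrightarrow> refuses F U X"
proof -
  have "(\<forall>S \<in> Y. S \<subseteq> U \<inter> E) \<longleftrightarrow> (\<forall>S \<in> Y. S \<subseteq> U)" if "Y \<subseteq> F" for Y
    using that assms(1) by blast
  moreover have cov: "\<Union> Z \<inter> (U \<inter> E) = \<Union> Z \<inter> U" if "Z \<subseteq> F" for Z
    using that assms(1) by blast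
  moreover have "\<Union> (X - R \<union> Y) \<inter> (U \<inter> E) = \<Union> (X - R \<union> Y) \<inter> U" if "Y \<subseteq> F" for R Y
    using that assms(2) by (intro cov) auto
  ultimately show ?thesis
    unfolding refuses_def cov[OF assms(2)] by (metis (no_types, lifting))
qed

text \<open>Only the traces of the parts on \<open>E\<close> matter for internality and coverage,
  and a part with empty trace can never gain.\<close>

lemma attainable_restrict:
  assumes "\<Union> F \<subseteq> E"
  shows "attainable {U \<inter> E |U. U \<in> Ps \<and> U \<inter> E \<noteq> {}} F k \<longleftrightarrow> attainable Ps F k"
proof -
  have "stable {U \<inter> E |U. U \<in> Ps \<and> U \<inter> E \<noteq> {}} F X \<longleftrightarrow> stable Ps F X" for X
  proof (cases "X \<subseteq> F")
    case True
    have "\<not> refuses F {} X" by (simp add: refuses_def)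
    then have "(\<forall>V \<in> {U \<inter> E |U. U \<in> Ps \<and> U \<inter> E \<noteq> {}}. \<not> refuses F V X) \<longleftrightarrow>
        (\<forall>U \<in> Ps. \<not> refuses F (U \<inter> E) X)"
      by (smt (verit, best) mem_Collect_eq)
    then have "(\<forall>V \<in> {U \<inter> E |U. U \<in> Ps \<and> U \<inter> E \<noteq> {}}. \<not> refuses F V X) \<longleftrightarrow>
        (\<forall>U \<in> Ps. \<not> refuses F U X)"
      by (simp only: refuses_Int[OF assms True])
    then show ?thesis by (simp add: stable_def)
  qed (simp add: stable_def)
  then show ?thesis by (simp add: attainable_def)
qed

lemma refuses_image:
  assumes \<rho>: "inj_on \<rho> E" and sub: "\<Union> F \<subseteq> E" "U \<subseteq> E" "X \<subseteq> F" and ref: "refuses F U X"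
  shows "refuses ((`) \<rho> ` F) (\<rho> ` U) ((`) \<rho> ` X)"
proof -
  obtain R Y where RY: "R \<subseteq> X" "Y \<subseteq> F" "\<And>S. S \<in> Y \<Longrightarrow> S \<subseteq> U"
    "pairwise disjnt ((X - R) \<union> Y)" "card (\<Union> X \<inter> U) < card (\<Union> ((X - R) \<union> Y) \<inter> U)"
    using ref by (rule refusesE) blast
  have "inj_on ((`) \<rho>) (Pow E)" using \<rho> by (rule inj_on_image_Pow)
  then have diff: "(`) \<rho> ` (X - R) = (`) \<rho> ` X - (`) \<rho> ` R"
    by (rule inj_on_image_set_diff) (use RY sub in blast)+
  then have eq: "((`) \<rho> ` X - (`) \<rho> ` R) \<union> (`) \<rho> ` Y = (`) \<rho> ` ((X - R) \<union> Y)"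
    by (simp add: image_Un)
  have card: "card (\<Union> ((`) \<rho> ` Z) \<inter> \<rho> ` U) = card (\<Union> Z \<inter> U)" if Z: "Z \<subseteq> F" for Z
  proof -
    have "\<Union> ((`) \<rho> ` Z) \<inter> \<rho> ` U = \<rho> ` (\<Union> Z) \<inter> \<rho> ` U" by auto
    also have "\<dots> = \<rho> ` (\<Union> Z \<inter> U)"
      by (rule inj_on_image_Int[OF \<rho>, symmetric]) (use Z sub in blast)+
    also have "card \<dots> = card (\<Union> Z \<inter> U)"
      by (rule card_image, rule inj_on_subset[OF \<rho>]) (use sub in blast)
    finally show ?thesis .
  qed
  show ?thesis
  proof (rule refusesI[of "(`) \<rho> ` R" _ "(`) \<rho> ` Y"], unfold eq)
    show "pairwise disjnt ((`) \<rho> ` ((X - R) \<union> Y))"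
    proof (rule pairwise_disjntI)
      fix S T assume "S \<in> (`) \<rho> ` ((X - R) \<union> Y)" "T \<in> (`) \<rho> ` ((X - R) \<union> Y)" "S \<noteq> T"
      then obtain S' T' where *: "S = \<rho> ` S'" "T = \<rho> ` T'" "S' \<in> (X - R) \<union> Y" "T' \<in> (X - R) \<union> Y" "S' \<noteq> T'"
        by auto
      have "S' \<subseteq> E" "T' \<subseteq> E" using * RY(2) sub by blast+
      moreover have "S' \<inter> T' = {}" using pairwise_disjntD[OF RY(4) *(3,4,5)] .
      ultimately show "S \<inter> T = {}" unfolding *(1,2) by (metis inj_on_image_Int[OF \<rho>] image_empty)
    qed
    show "card (\<Union> ((`) \<rho> ` X) \<inter> \<rho> ` U) < card (\<Union> ((`) \<rho> ` ((X - R) \<union> Y)) \<inter> \<rho> ` U)"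
      using RY(2,5) sub(3) by (subst (1 2) card) auto
    show "S \<subseteq> \<rho> ` U" if "S \<in> (`) \<rho> ` Y" for S using that RY(3) by blast
  qed (use RY(1,2) in auto)
qed

lemma inv_into_image_family:
  assumes "inj_on \<rho> E" "\<Union> A \<subseteq> E"
  shows "(`) (inv_into E \<rho>) ` (`) \<rho> ` A = A"
proof -
  have "inv_into E \<rho> ` \<rho> ` S = S" if "S \<in> A" for S
    using assms that by (intro inv_into_image_cancel) auto
  then have "(\<lambda>S. inv_into E \<rho> ` \<rho> ` S) ` A = (\<lambda>S. S) ` A" by (rule image_cong[OF refl])
  then show ?thesis by (simp add: image_image)
qed

text \<open>A rejection of the renamed packing is pulled back along the inverse renaming, to which
  \<open>refuses_image\<close> applies as well.\<close>

lemma attainable_imageI: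
  assumes \<rho>: "inj_on \<rho> E" and sub: "\<Union> F \<subseteq> E" "\<Union> Ps \<subseteq> E" and att: "attainable Ps F k"
  shows "attainable ((`) ((`) \<rho>) Ps) ((`) ((`) \<rho>) F) k"
proof -
  obtain X where X: "stable Ps F X" "k \<le> int (card (\<Union> X))"
    using att by (auto simp: attainable_def)
  let ?\<sigma> = "inv_into E \<rho>"
  have XF: "X \<subseteq> F" using X by (simp add: stable_def)
  have "\<not> refuses ((`) \<rho> ` F) (\<rho> ` U) ((`) \<rho> ` X)" if U: "U \<in> Ps" for U
  proof
    assume ref: "refuses ((`) \<rho> ` F) (\<rho> ` U) ((`) \<rho> ` X)"
    have "inj_on ?\<sigma> (\<rho> ` E)" by (rule inj_on_inv_into) simp
    then have "refuses ((`) ?\<sigma> ` (`) \<rho> ` F) (?\<sigma> ` \<rho> ` U) ((`) ?\<sigma> ` (`) \<rho> ` X)"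
      by (rule refuses_image[OF _ _ _ _ ref]) (use sub U XF in auto)
    moreover have "\<Union> X \<subseteq> E" "U \<subseteq> E" using XF U sub by auto
    ultimately have "refuses F U X"
      using inv_into_image_family[OF \<rho>] inv_into_image_cancel[OF \<rho>] sub(1) by simp
    then show False using X U by (simp add: stable_def)
  qed
  moreover have "pairwise disjnt ((`) \<rho> ` X)"
  proof (rule pairwise_disjntI)
    fix S T assume "S \<in> (`) \<rho> ` X" "T \<in> (`) \<rho> ` X" "S \<noteq> T"
    then obtain S' T' where *: "S = \<rho> ` S'" "T = \<rho> ` T'" "S' \<in> X" "T' \<in> X" "S' \<noteq> T'"
      by auto
    have "S' \<subseteq> E" "T' \<subseteq> E" using * XF sub by blast+
    moreover have "S' \<inter> T' = {}" using pairwise_disjntD[OF _ *(3,4,5)] X by (simp add: stable_def)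
    ultimately show "S \<inter> T = {}" unfolding *(1,2) by (metis inj_on_image_Int[OF \<rho>] image_empty)
  qed
  ultimately have "stable ((`) \<rho> ` Ps) ((`) \<rho> ` F) ((`) \<rho> ` X)"
    using XF by (auto simp: stable_def)
  moreover have "card (\<Union> ((`) \<rho> ` X)) = card (\<Union> X)"
  proof -
    have "inj_on \<rho> (\<Union> X)" by (rule inj_on_subset[OF \<rho>]) (use XF sub in blast)
    then show ?thesis by (simp add: card_image image_Union[symmetric])
  qed
  ultimately show ?thesis using X(2) unfolding attainable_def by metis
qed

lemma attainable_image:
  assumes \<rho>: "inj_on \<rho> E" and sub: "\<Union> F \<subseteq> E" "\<Union> Ps \<subseteq> E"
  shows "attainable ((`) \<rho> ` Ps) ((`) \<rho> ` F) k \<longleftrightarrow> attainable Ps F k"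
proof
  let ?\<sigma> = "inv_into E \<rho>"
  have inj: "inj_on ?\<sigma> (\<rho> ` E)" by (rule inj_on_inv_into) simp
  assume att: "attainable ((`) \<rho> ` Ps) ((`) \<rho> ` F) k"
  have "attainable ((`) ?\<sigma> ` (`) \<rho> ` Ps) ((`) ?\<sigma> ` (`) \<rho> ` F) k"
    by (rule attainable_imageI[OF inj _ _ att]) (use sub in auto)
  then show "attainable Ps F k" using inv_into_image_family[OF \<rho>] sub by simp
qed (rule attainable_imageI[OF assms])

section \<open>Short names and encoding lengths\<close>

lemma name_snoc: "name (E @ [y]) x = (if y = x then 0 else 2 * name E x + 1)"
  by (simp add: name_def)

text \<open>The name of an element of \<open>E\<close> is \<open>2 ^ i - 1\<close>, with
  \<open>i\<close> the number of entries after its last occurrence; different elements have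
  different last positions.\<close>

lemma inj_on_name: "inj_on (name E) (set E)"
proof (induction E rule: rev_induct)
  case (snoc y E)
  show ?case
  proof (rule inj_onI)
    fix u v assume "u \<in> set (E @ [y])" "v \<in> set (E @ [y])" "name (E @ [y]) u = name (E @ [y]) v"
    then show "u = v" using inj_onD[OF snoc, of u v] by (auto simp: name_snoc split: if_splits)
  qed
qed simp

lemma esize_name: "esize (name E x) \<le> 2 * length E"
proof (induction E rule: rev_induct)
  case Nil
  show ?case by (simp add: name_def enc_zero_nat)
next
  case (snoc y E)
  then show ?case by (simp add: name_snoc enc_zero_nat enc_odd_nat[simplified])
qed

lemma esize_nat: "esize (n :: nat) \<le> 2 * n"
proof (induction n rule: less_induct)
  case (less n)
  show ?case
  proof (cases "n = 0")
    case False
    then have "esize n \<le> 2 + esize (n div 2)"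
      by (subst enc_nat_eq, subst enc_nat.simps) (simp add: enc_nat_eq enc_bool_def)
    also have "\<dots> \<le> 2 + 2 * (n div 2)" using less.IH[of "n div 2"] False by simp
    also have "\<dots> \<le> 2 * n" using False by presburger
    finally show ?thesis .
  qed (simp add: enc_zero_nat)
qed

lemma esize_int: "0 \<le> k \<Longrightarrow> esize k \<le> 2 * nat k + 2"
  using esize_nat[of "nat k"] by (simp add: enc_int_eq enc_int_def enc_nat_eq enc_bool_def)

lemma esize_list_le:
  assumes "\<And>x. x \<in> set xs \<Longrightarrow> esize x \<le> b"
  shows "esize xs \<le> length xs * Suc b"
  using assms
proof (induction xs)
  case (Cons x xs)
  then have "esize xs \<le> length xs * Suc b" "esize x \<le> b" by auto
  then show ?case by simp
qed simp

lemma sets_of_map: "sets_of (map (map f) F) = (`) ((`) f) (sets_of F)"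
  by (simp add: image_image)

text \<open>Finiteness is automatic for lists, and disjointness is symmetric, so comparing earlier
  with later parts suffices.\<close>

lemma descriptions_iff:
  "(Us, Ss, k) \<in> descriptions d \<longleftrightarrow>
    sorted_wrt (\<lambda>U V. disjnt (set U) (set V)) Us \<and> (\<forall>U \<in> set Us. distinct U) \<and>
    (\<forall>S \<in> set Ss. distinct S \<and> length S \<le> d \<and> set S \<subseteq> \<Union> (sets_of Us)) \<and> distinct (map set Ss)"
proof -
  have "(\<forall>i < length Us. \<forall>j < length Us. i \<noteq> j \<longrightarrow> map set Us ! i \<inter> map set Us ! j = {}) \<longleftrightarrow>
    sorted_wrt (\<lambda>U V. disjnt (set U) (set V)) Us"
    unfolding sorted_wrt_iff_nth_less disjnt_def
    by (smt (verit) Int_commute linorder_neqE_nat nth_map order_less_trans less_irrefl)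
  then show ?thesis
    unfolding descriptions_def rpsp_instance_def inst_of_def universe_def
    by (auto simp: distinct_card)
qed

lemma description_if:
  assumes "(Us, Ss, k) \<in> descriptions d"
  shows "description d Us Ss"
proof
  have "proper d (filter (\<lambda>S. S \<noteq> []) Ss)"
    using assms by (auto simp: descriptions_iff proper_def distinct_map inj_on_def)
  then show "proper d (filter (\<lambda>S. S \<noteq> []) Ss)" .
qed (use assms in \<open>auto simp: descriptions_iff\<close>)

lemma yes_instance_inst_of:
  "yes_instance (inst_of (Us, Ss, k)) \<longleftrightarrow> attainable (sets_of Us) (sets_of Ss) k"
  by (simp add: yes_instance_iff_attainable inst_of_def)

section \<open>Correctness of the kernel\<close>

lemma distinct_concat_if_disjoint:
  assumes "sorted_wrt (\<lambda>U V. disjnt (set U) (set V)) xs" "\<And>U. U \<in> set xs \<Longrightarrow> distinct U"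
  shows "distinct (concat xs)"
  using assms by (induction xs) (auto simp: disjnt_def)

context description
begin

abbreviation "E \<equiv> concat RF"
abbreviation "\<rho> \<equiv> name E"
abbreviation "Vs \<equiv> filter (\<lambda>U. U \<noteq> []) (map (\<lambda>U. filter (\<lambda>x. x \<in> set E) U) Us)"

lemma kernel_eq:
  "kernel d (Us, Ss, k) = ((map (map \<rho>) Vs, map (map \<rho>) RF, k),
    map \<rho> (filter (\<lambda>x. x \<in> set E) (hitting Ss)))"
  by (simp add: kernel_def compress_def)

lemma set_Vs: "V \<in> set Vs \<Longrightarrow> set V \<subseteq> set E \<and> V \<noteq> [] \<and> distinct V"
  using distinct_parts by auto

lemma sets_of_Vs: "sets_of Vs = {U \<inter> set E |U. U \<in> sets_of Us \<and> U \<inter> set E \<noteq> {}}"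
proof -
  have set_eq: "set (filter (\<lambda>x. x \<in> set E) U) = set U \<inter> set E" for U by auto
  show ?thesis
  proof (intro equalityI subsetI)
    fix A assume "A \<in> sets_of Vs"
    then obtain V where V: "A = set V" "V \<in> set Vs" by blast
    then obtain U where "U \<in> set Us" "V = filter (\<lambda>x. x \<in> set E) U" "V \<noteq> []"
      by (auto simp del: set_concat)
    then show "A \<in> {U \<inter> set E |U. U \<in> sets_of Us \<and> U \<inter> set E \<noteq> {}}"
      using V(1) set_eq[of U] by (metis (mono_tags, lifting) CollectI imageI set_empty)
  next
    fix A assume "A \<in> {U \<inter> set E |U. U \<in> sets_of Us \<and> U \<inter> set E \<noteq> {}}"
    then obtain U where U: "U \<in> set Us" "A = set U \<inter> set E" "A \<noteq> {}" by blast
    then have "filter (\<lambda>x. x \<in> set E) U \<noteq> []" using set_eq[of U] by (metis set_empty)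
    then have "filter (\<lambda>x. x \<in> set E) U \<in> set Vs" using U(1) by simp
    then show "A \<in> sets_of Vs" using U(2) set_eq[of U] by (metis imageI)
  qed
qed

lemma covered_E: "set E \<subseteq> \<Union> (sets_of Vs)"
proof
  fix x assume x: "x \<in> set E"
  then obtain S where "S \<in> set RF" "x \<in> set S" by auto
  then have "x \<in> \<Union> (sets_of Us)" using RF(2) covered[of S] by auto
  then show "x \<in> \<Union> (sets_of Vs)" using x unfolding sets_of_Vs by blast
qed

lemma disjoint_Vs: "sorted_wrt (\<lambda>U V. disjnt (set U) (set V)) Vs"
proof -
  have "sorted_wrt (\<lambda>U V. disjnt (set (filter (\<lambda>x. x \<in> set E) U)) (set (filter (\<lambda>x. x \<in> set E) V))) Us"
    by (rule sorted_wrt_mono_rel[OF _ parts_disjoint]) (auto simp: disjnt_def)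
  then show ?thesis by (intro sorted_wrt_filter) (simp only: sorted_wrt_map)
qed

lemma RF_subset: "S \<in> set RF \<Longrightarrow> set S \<subseteq> set E"
  by auto

lemma kernel_in_descriptions: "fst (kernel d (Us, Ss, k)) \<in> descriptions d"
proof -
  have inj: "inj_on \<rho> A" if "A \<subseteq> set E" for A
    using inj_on_subset[OF inj_on_name that] .
  have "disjnt (\<rho> ` A) (\<rho> ` B)" if "A \<subseteq> set E" "B \<subseteq> set E" "disjnt A B" for A B
    using that inj_on_image_Int[OF inj_on_name that(1,2)] by (simp add: disjnt_def)
  then have "sorted_wrt (\<lambda>U V. disjnt (set (map \<rho> U)) (set (map \<rho> V))) Vs"
    by (intro sorted_wrt_mono_rel[OF _ disjoint_Vs]) (use set_Vs in \<open>simp only: set_map\<close>)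
  then have 1: "sorted_wrt (\<lambda>U V. disjnt (set U) (set V)) (map (map \<rho>) Vs)"
    by (simp only: sorted_wrt_map)
  have 2: "distinct U" if U: "U \<in> set (map (map \<rho>) Vs)" for U
  proof -
    obtain V where "U = map \<rho> V" "V \<in> set Vs" using U by (auto simp del: set_filter set_concat)
    then show ?thesis using set_Vs[of V] inj[of "set V"] by (simp only: distinct_map)
  qed
  have 3: "distinct S \<and> length S \<le> d \<and> set S \<subseteq> \<Union> (sets_of (map (map \<rho>) Vs))"
    if S: "S \<in> set (map (map \<rho>) RF)" for S
  proof -
    obtain R where R: "S = map \<rho> R" "R \<in> set RF" using S by (auto simp del: set_concat)
    have "set S \<subseteq> \<rho> ` \<Union> (sets_of Vs)"
      unfolding R(1) set_map by (intro image_mono subset_trans[OF RF_subset[OF R(2)] covered_E])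
    also have "\<dots> = \<Union> (sets_of (map (map \<rho>) Vs))" unfolding sets_of_map by blast
    finally show ?thesis
      using R RF(1) inj[OF RF_subset[OF R(2)]] by (simp add: distinct_map proper_def)
  qed
  have "inj_on ((`) \<rho>) (sets_of RF)"
    by (rule inj_on_subset[OF inj_on_image_Pow[OF inj_on_name]]) (use RF_subset in blast)
  then have "distinct (map ((`) \<rho>) (map set RF))"
    using RF(1) by (simp only: distinct_map[of "(`) \<rho>"] proper_def set_map)
  then have 4: "distinct (map set (map (map \<rho>) RF))"
    by (simp add: comp_def)
  show ?thesis unfolding kernel_eq fst_conv descriptions_iff using 1 2 3 4 by blast
qed

lemma kernel_equivalent:
  "equivalent (inst_of (Us, Ss, k)) (inst_of (fst (kernel d (Us, Ss, k))))"
proof -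
  have sub: "\<Union> (sets_of RF) \<subseteq> set E" by auto
  have "attainable (sets_of (map (map \<rho>) Vs)) (sets_of (map (map \<rho>) RF)) k \<longleftrightarrow>
      attainable (sets_of Vs) (sets_of RF) k"
    unfolding sets_of_map by (rule attainable_image[OF inj_on_name sub]) (use set_Vs in blast)
  also have "\<dots> \<longleftrightarrow> attainable (sets_of Us) (sets_of RF) k"
    unfolding sets_of_Vs by (rule attainable_restrict[OF sub])
  also have "\<dots> \<longleftrightarrow> attainable (sets_of Us) (sets_of Ss) k" by (rule RF(3))
  finally show ?thesis
    unfolding kernel_eq fst_conv equivalent_def yes_instance_inst_of by simp
qed

lemma kernel_hitting_set:
  "hitting_set (inst_of (fst (kernel d (Us, Ss, k)))) (set (snd (kernel d (Us, Ss, k))))"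
  unfolding hitting_set_def
proof
  let ?H = "filter (\<lambda>x. x \<in> set E) (hitting Ss)"
  have "set ?H \<subseteq> set E" by auto
  then have "\<rho> ` set ?H \<subseteq> \<rho> ` \<Union> (sets_of Vs)" using covered_E by blast
  also have "\<dots> = \<Union> (sets_of (map (map \<rho>) Vs))" unfolding sets_of_map by blast
  finally show "set (snd (kernel d (Us, Ss, k))) \<subseteq> universe (inst_of (fst (kernel d (Us, Ss, k))))"
    unfolding kernel_eq by (simp add: universe_def inst_of_def)
  show "\<forall>S \<in> family (inst_of (fst (kernel d (Us, Ss, k)))). S \<inter> set (snd (kernel d (Us, Ss, k))) \<noteq> {}"
  proof
    fix S assume "S \<in> family (inst_of (fst (kernel d (Us, Ss, k))))"
    then have "S \<in> sets_of (map (map \<rho>) RF)" unfolding kernel_eq by (simp add: inst_of_def)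
    then obtain R where R: "S = \<rho> ` set R" "R \<in> set RF" unfolding sets_of_map by blast
    then obtain x where x: "x \<in> set R" "x \<in> set (hitting Ss)"
      using hitting_hits[of R] RF(2) by blast
    then have "x \<in> set ?H" using RF_subset[OF R(2)] by auto
    then have "\<rho> x \<in> S \<inter> \<rho> ` set ?H" using x R by blast
    then show "S \<inter> set (snd (kernel d (Us, Ss, k))) \<noteq> {}" unfolding kernel_eq snd_conv set_map by blast
  qed
qed

lemma kernel_hitting_distinct: "distinct (snd (kernel d (Us, Ss, k)))"
  unfolding kernel_eq snd_conv distinct_map
  using distinct_hitting by (auto intro: inj_on_subset[OF inj_on_name] simp del: set_concat)

lemma length_kernel_hitting: "length (snd (kernel d (Us, Ss, k))) \<le> d * length (max_packing Ss)"
  unfolding kernel_eq snd_conv length_map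
  using order_trans[OF length_filter_le length_hitting] .

lemma card_kernel: "card (family (inst_of (fst (kernel d (Us, Ss, k))))) \<le> length RF"
proof -
  have "card (family (inst_of (fst (kernel d (Us, Ss, k))))) = card (sets_of (map (map \<rho>) RF))"
    unfolding kernel_eq by (simp add: inst_of_def)
  also have "\<dots> \<le> card (set (map (map \<rho>) RF))" by (rule card_image_le) simp
  also have "\<dots> \<le> length RF" using card_length[of "map (map \<rho>) RF"] by simp
  finally show ?thesis .
qed

lemma length_RF_le_g_bound:
  assumes k: "int (length (max_packing Ss)) < k"
  shows "int (length RF) \<le> g_bound d k"
proof (cases "d = 0")
  case True
  then have "RF = []" using RF(1) by (auto simp: proper_def) (metis last_in_set)
  then show ?thesis by (simp add: g_bound_def True)
next
  case False
  \<comment> \<open>These are the constants as natural numbers; \<open>1 \<le> K * d\<close> below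
    ensures that the subtraction in \<open>M\<close> is not truncated.\<close>
  define K where "K = nat k"
  define M where "M = d * (K * d - 1) + 1"
  define f where "f = d * fact d * M ^ d"
  define t where "t = d ^ (d - 1) * M + d * K * f"
  have K: "k = int K" "length (max_packing Ss) \<le> K - 1" "1 \<le> K" using k by (auto simp: K_def)
  have d: "1 \<le> d" using False by simp
  then have Kd: "1 \<le> K * d" using K(3) by simp
  then have "int M = int d * (k * int d - 1) + 1"
    unfolding M_def K(1) by (simp add: of_nat_diff)
  moreover from this have "int f = f_bound d k" by (simp add: f_def f_bound_def)
  ultimately have g: "g_bound d k = int (d * fact d * t ^ d)"
    by (simp add: g_bound_def t_def K(1))
  \<comment> \<open>At most \<open>K - 1\<close> packed sets give \<open>K * d - d\<close> elements,
    and \<open>1 \<le> d\<close> leads to the \<open>K * d - 1\<close> of the formula.\<close>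
  have "length (hitting Ss) \<le> d * (K - 1)"
    using length_hitting mult_le_mono2[OF K(2), of d] by linarith
  also have "\<dots> = K * d - d" by (simp add: diff_mult_distrib2 mult.commute)
  also have "\<dots> \<le> K * d - 1" using d by simp
  finally have h: "d * length (hitting Ss) \<le> M"
    unfolding M_def by (intro trans_le_add1 mult_le_mono2)
  have "length RI \<le> f"
    unfolding f_def by (rule length_RI[OF _ h]) (simp add: M_def)
  \<comment> \<open>The left side bounds the number of forbidden elements; \<open>1 \<le> K\<close>
    passes from \<open>d * f\<close> to the summand of \<open>g_bound\<close>.\<close>
  then have "d * length RI \<le> d * K * f"
    using K(3) by (metis mult.assoc mult_le_mono mult_1 order_refl mult.commute)
  moreover have "d ^ (d - 1) * (d * length (hitting Ss)) \<le> d ^ (d - 1) * M"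
    using h by (rule mult_le_mono2)
  ultimately have "d * length RI + d ^ (d - 1) * (d * length (hitting Ss)) \<le> t"
    unfolding t_def by linarith
  moreover have "1 \<le> d ^ (d - 1) * M" using d by (simp add: M_def Suc_le_eq)
  then have "1 \<le> t" unfolding t_def by linarith
  ultimately have "length RF \<le> d * fact d * t ^ d" using d by (intro length_RF)
  then show ?thesis unfolding g by (simp only: of_nat_le_iff)
qed

lemma length_E: "length E \<le> d * length RF"
proof -
  have "sum_list (map length RF) \<le> sum_list (map (\<lambda>_. d) RF)"
    using RF(1) by (intro sum_list_mono) (simp add: proper_def)
  then show ?thesis by (simp add: length_concat sum_list_triv mult.commute)
qed

lemma length_concat_Vs: "length (concat Vs) \<le> length E"
proof -
  have "distinct (concat Vs)"
    using disjoint_Vs set_Vs by (intro distinct_concat_if_disjoint) blast+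
  then have "length (concat Vs) = card (set (concat Vs))" by (simp only: distinct_card)
  also have "\<dots> \<le> card (set E)" by (rule card_mono) auto
  also have "\<dots> \<le> length E" by (rule card_length)
  finally show ?thesis .
qed

text \<open>The parts are nonempty, disjoint and made of used elements, so there are at most
  \<open>n\<close> of them; each name has size at most \<open>2 * n\<close>. The target is output
  unchanged, which is where \<open>nat k\<close> enters.\<close>

lemma esize_kernel:
  assumes "0 \<le> k"
  defines "n \<equiv> d * length RF"
  shows "esize (fst (kernel d (Us, Ss, k))) \<le>
    n * Suc (n * Suc (2 * n)) + (length RF * Suc (d * Suc (2 * n)) + (2 * nat k + 2)) + 2"
proof -
  have name: "esize (\<rho> x) \<le> 2 * n" for x
    using esize_name[of E x] length_E by (simp add: n_def)
  have list: "esize (map \<rho> V) \<le> l * Suc (2 * n)" if "length V \<le> l" for V l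
  proof -
    have "esize (map \<rho> V) \<le> length (map \<rho> V) * Suc (2 * n)"
      by (rule esize_list_le) (use name in auto)
    also have "\<dots> \<le> l * Suc (2 * n)" using that by (intro mult_le_mono1) simp
    finally show ?thesis .
  qed
  have Vs: "length Vs \<le> n \<and> (\<forall>V \<in> set Vs. length V \<le> n)"
  proof -
    have "length xs \<le> length (concat xs)" if "\<forall>V \<in> set xs. V \<noteq> []" for xs :: "nat list list"
      using that
    proof (induction xs)
      case (Cons x xs)
      then have "1 \<le> length x" "length xs \<le> length (concat xs)" by (auto simp: Suc_le_eq)
      then show ?case by simp
    qed simp
    moreover have "length V \<le> length (concat xs)" if "V \<in> set xs" for V and xs :: "nat list list"
      using that by (induction xs) auto
    ultimately show ?thesis
      using set_Vs length_concat_Vs length_E unfolding n_def by (meson order_trans)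
  qed
  have "esize (map (map \<rho>) Vs) \<le> length (map (map \<rho>) Vs) * Suc (n * Suc (2 * n))"
  proof (rule esize_list_le)
    fix U assume "U \<in> set (map (map \<rho>) Vs)"
    then obtain V where "U = map \<rho> V" "V \<in> set Vs" unfolding set_map by blast
    then show "esize U \<le> n * Suc (2 * n)" using Vs list by blast
  qed
  also have "\<dots> \<le> n * Suc (n * Suc (2 * n))" using Vs by (intro mult_le_mono1) simp
  finally have 1: "esize (map (map \<rho>) Vs) \<le> n * Suc (n * Suc (2 * n))" .
  have "esize (map (map \<rho>) RF) \<le> length (map (map \<rho>) RF) * Suc (d * Suc (2 * n))"
  proof (rule esize_list_le)
    fix U assume "U \<in> set (map (map \<rho>) RF)"
    then obtain V where "U = map \<rho> V" "V \<in> set RF" unfolding set_map by blast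
    then show "esize U \<le> d * Suc (2 * n)" using RF(1) list[of V d] by (simp add: proper_def)
  qed
  then have 2: "esize (map (map \<rho>) RF) \<le> length RF * Suc (d * Suc (2 * n))" by simp
  show ?thesis unfolding kernel_eq fst_conv enc_simps val.size using 1 2 esize_int[OF assms(1)] by simp
qed

end

section \<open>From polynomial-time functions to search problems\<close>

lemma polytime_solvesI:
  assumes "polytime f" "\<And>x. x \<in> D \<Longrightarrow> R x (f x)"
  shows "\<exists>P. polytime_solves P enc enc D R"
proof -
  obtain P T where P: "\<And>x. \<exists>t \<le> T x. runs P (enc x) t (enc (f x))" "pbounded esize T"
    using assms(1) by (rule polytimeE) blast
  obtain q where q: "\<And>x. T x \<le> poly q (esize x)" using P(2) unfolding pbounded_def by blast
  have "\<exists>t y. runs P (enc x) t (enc y) \<and> t \<le> poly q (esize x) \<and> R x y" if "x \<in> D" for x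
    using P(1)[of x] q[of x] assms(2)[OF that] by (meson order_trans)
  then show ?thesis unfolding polytime_solves_def by blast
qed

lemma enc_desc_eq: "enc_desc = enc"
  by (simp add: enc_desc_def enc_prod_eq enc_list_eq enc_nat_eq enc_int_eq)

lemma enc_outcome_eq: "enc_outcome = enc"
  unfolding enc_outcome_def enc_desc_eq
  by (simp add: enc_option_eq enc_prod_eq enc_list_eq enc_nat_eq)

lemma kernel_admissible: "admits_kernel d (g_bound d)"
proof -
  \<comment> \<open>A kernel must be an instance, so the verdict YES is expressed by one without
    parts and sets and with target 0, which the empty packing meets.\<close>
  let ?trivial = "([], [], 0) :: desc"
  let ?f = "\<lambda>D. if surely_yes D then ?trivial else fst (kernel d D)"
  let ?b = "\<lambda>n :: nat. d * n * Suc (d * n * Suc (2 * (d * n))) +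
    (n * Suc (d * Suc (2 * (d * n))) + (2 * n + 2)) + 2"
  have "polytime ?f" by (intro polytime_intros polytime_surely_yes polytime_kernel)
  have "pbounded (\<lambda>n. n) ?b" by (intro pbounded_intros)
  then obtain q where q: "\<And>n. ?b n \<le> poly q n" unfolding pbounded_def by blast
  let ?R = "\<lambda>D D'. D' \<in> descriptions d \<and> equivalent (inst_of D) (inst_of D') \<and>
    card (family (inst_of D')) \<le> nat (g_bound d (target (inst_of D))) \<and>
    size (enc_desc D') \<le> poly q (nat (g_bound d (target (inst_of D))) + nat (target (inst_of D)))"
  have "?R D (?f D)" if D: "D \<in> descriptions d" for D
  proof -
    obtain Us Ss k where D_eq: "D = (Us, Ss, k)" by (cases D)
    then interpret description d Us Ss using D by (intro description_if[of Us Ss k]) simp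
    let ?n = "nat (g_bound d k) + nat k"
    have target: "target (inst_of D) = k" by (simp add: inst_of_def D_eq)
    show ?thesis
    proof (cases "surely_yes D")
      case True
      have "yes_instance (inst_of D)"
        using True unfolding D_eq yes_instance_inst_of
        by (intro attainable_if_surely_yes) (simp add: surely_yes_def)
      moreover have "stable {} {} {}" by (simp add: stable_def)
      then have "yes_instance (inst_of ?trivial)"
        unfolding yes_instance_inst_of attainable_def by auto
      moreover have "?trivial \<in> descriptions d" by (simp add: descriptions_iff)
      moreover have "size (enc_desc ?trivial) \<le> poly q ?n"
        by (rule order_trans[OF _ q]) (simp add: enc_desc_eq enc_int_eq enc_int_def enc_bool_def enc_nat.simps)
      ultimately show ?thesis using True by (simp add: equivalent_def target) (simp add: inst_of_def)
    next
      case False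
      then have k: "int (length (max_packing Ss)) < k" by (simp add: surely_yes_def D_eq)
      \<comment> \<open>The failed test makes \<open>k\<close> positive, so \<open>nat\<close> loses
        nothing; \<open>?n\<close> dominates both quantities on which the encoding length
        depends.\<close>
      then have RF_n: "length RF \<le> nat (g_bound d k)" "length RF \<le> ?n" "0 \<le> k" "nat k \<le> ?n"
        using length_RF_le_g_bound[OF k] by linarith+
      have "esize (fst (kernel d D)) \<le> ?b ?n"
      proof -
        have "d * length RF \<le> d * ?n" using RF_n(2) by (rule mult_le_mono2)
        then show ?thesis unfolding D_eq
          by (intro order_trans[OF esize_kernel[OF RF_n(3)]] add_mono mult_mono Suc_le_mono[THEN iffD2] RF_n) auto
      qed
      also have "\<dots> \<le> poly q ?n" by (rule q)
      finally show ?thesis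
        using False kernel_in_descriptions kernel_equivalent order_trans[OF card_kernel RF_n(1)]
        by (simp add: D_eq target[unfolded D_eq] enc_desc_eq)
    qed
  qed
  then have "\<exists>P. polytime_solves P enc enc (descriptions d) ?R"
    by (rule polytime_solvesI[OF \<open>polytime ?f\<close>])
  then show ?thesis unfolding admits_kernel_def enc_desc_eq by blast
qed

lemma kernel_with_hitting_set:
  "\<exists>P. polytime_solves P enc_desc enc_outcome (descriptions d)
            (\<lambda>D outcome. case outcome of
               None \<Rightarrow> yes_instance (inst_of D)
             | Some (D', H) \<Rightarrow>
                 D' \<in> descriptions d \<and>
                 equivalent (inst_of D) (inst_of D') \<and>
                 int (card (family (inst_of D'))) \<le> g_bound d (target (inst_of D)) \<and>
                 distinct H \<and> hitting_set (inst_of D') (set H) \<and>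
                 int (length H) \<le> target (inst_of D) * int d)"
  unfolding enc_desc_eq enc_outcome_eq
proof (rule polytime_solvesI)
  let ?f = "\<lambda>D. if surely_yes D then None else Some (kernel d D)"
  show "polytime ?f" by (intro polytime_intros polytime_surely_yes polytime_kernel)
  fix D assume D: "D \<in> descriptions d"
  obtain Us Ss k where D_eq: "D = (Us, Ss, k)" by (cases D)
  then interpret description d Us Ss using D by (intro description_if[of Us Ss k]) simp
  have target: "target (inst_of D) = k" by (simp add: inst_of_def D_eq)
  show "case ?f D of None \<Rightarrow> yes_instance (inst_of D)
     | Some (D', H) \<Rightarrow>
         D' \<in> descriptions d \<and>
         equivalent (inst_of D) (inst_of D') \<and>
         int (card (family (inst_of D'))) \<le> g_bound d (target (inst_of D)) \<and>
         distinct H \<and> hitting_set (inst_of D') (set H) \<and>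
         int (length H) \<le> target (inst_of D) * int d"
  proof (cases "surely_yes D")
    case True
    then have "yes_instance (inst_of D)"
      unfolding D_eq yes_instance_inst_of
      by (intro attainable_if_surely_yes) (simp add: surely_yes_def)
    then show ?thesis using True by simp
  next
    case False
    then have k: "int (length (max_packing Ss)) < k" by (simp add: surely_yes_def D_eq)
    have "int (card (family (inst_of (fst (kernel d D))))) \<le> g_bound d k"
      using card_kernel[of k] length_RF_le_g_bound[OF k] unfolding D_eq by linarith
    moreover have "int (length (snd (kernel d D))) \<le> k * int d"
    proof -
      have "int (length (snd (kernel d D))) \<le> int (d * length (max_packing Ss))"
        unfolding D_eq of_nat_le_iff by (rule length_kernel_hitting)
      also have "\<dots> \<le> int d * k" using k by (simp add: mult_left_mono)
      finally show ?thesis by (simp add: mult.commute)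
    qed
    ultimately show ?thesis
      using False kernel_in_descriptions[of k] kernel_equivalent[of k] kernel_hitting_set[of k]
        kernel_hitting_distinct[of k]
      unfolding D_eq[symmetric] target by (simp add: case_prod_beta)
  qed
qed

lemma g_bound_bigo: "(\<lambda>k :: nat. real_of_int (g_bound d (int k))) \<in> O(\<lambda>k. (real k ^ (d + 1)) ^ d)"
proof (cases "d = 0")
  case True
  then show ?thesis by (simp add: g_bound_def)
next
  case False
  \<comment> \<open>\<open>c1\<close> and \<open>c2\<close> collect the factors free of
    \<open>k\<close>: the innermost term is at most \<open>d ^ 2 * k\<close>, hence
    \<open>f_bound\<close> at most \<open>c1 * k ^ d\<close> and the base of the power in
    \<open>g_bound\<close> at most \<open>c2 * k ^ (d + 1)\<close>.\<close>
  define c where "c = real d * fact d"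
  define c1 where "c1 = c * (real d ^ 2) ^ d"
  define c2 where "c2 = real d ^ (d - 1) * real d ^ 2 + real d * c1"
  have nonneg: "0 \<le> c" "0 \<le> c1" "0 \<le> c2" by (simp_all add: c_def c1_def c2_def)
  have "\<bar>real_of_int (g_bound d (int k))\<bar> \<le> c * c2 ^ d * \<bar>(real k ^ (d + 1)) ^ d\<bar>" if k: "1 \<le> k" for k
  proof -
    define a where "a = real d * (real k * real d - 1) + 1"
    define b where "b = c * a ^ d"
    have d: "1 \<le> real d" "1 \<le> real k" using False k by auto
    then have "1 \<le> real k * real d" by (metis mult_1 mult_mono order_trans zero_le_one)
    then have a: "0 \<le> a" "a \<le> real d ^ 2 * real k"
      using d mult_nonneg_nonneg[of "real d" "real k * real d - 1"]
      by (simp_all add: a_def power2_eq_square right_diff_distrib mult.commute mult.left_commute)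
    have "a ^ d \<le> (real d ^ 2 * real k) ^ d" using a by (intro power_mono)
    then have b: "0 \<le> b" "b \<le> c1 * real k ^ d"
      unfolding b_def c1_def using nonneg a by (auto simp: power_mult_distrib mult.assoc intro!: mult_left_mono)
    have "real d ^ (d - 1) * a + real d * real k * b \<le>
        real d ^ (d - 1) * (real d ^ 2 * real k) + real d * real k * (c1 * real k ^ d)"
      using a b by (intro add_mono mult_left_mono) auto
    also have "\<dots> \<le> real d ^ (d - 1) * (real d ^ 2 * real k ^ (d + 1)) + real d * real k * (c1 * real k ^ d)"
      using d by (intro add_mono mult_left_mono order_refl) (auto intro: self_le_power)
    also have "\<dots> = c2 * real k ^ (d + 1)" by (simp add: c2_def algebra_simps)
    finally have t: "real d ^ (d - 1) * a + real d * real k * b \<le> c2 * real k ^ (d + 1)" .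
    have t0: "0 \<le> real d ^ (d - 1) * a + real d * real k * b" using a b by simp
    have g: "real_of_int (g_bound d (int k)) = c * (real d ^ (d - 1) * a + real d * real k * b) ^ d"
      by (simp add: g_bound_def f_bound_def a_def b_def c_def)
    have "(real d ^ (d - 1) * a + real d * real k * b) ^ d \<le> (c2 * real k ^ (d + 1)) ^ d"
      using t t0 by (rule power_mono)
    then have "c * (real d ^ (d - 1) * a + real d * real k * b) ^ d \<le> c * (c2 * real k ^ (d + 1)) ^ d"
      using nonneg by (intro mult_left_mono)
    then show ?thesis unfolding g using nonneg t0 by (simp add: power_mult_distrib mult.assoc)
  qed
  then show ?thesis
    by (intro bigoI[of _ "c * c2 ^ d"] eventually_sequentiallyI[of 1]) simp
qed

theorem theorem12:
  fixes d :: nat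
  shows "(\<exists>P. polytime_solves P enc_desc enc_outcome (descriptions d)
            (\<lambda>D outcome. case outcome of
               None \<Rightarrow> yes_instance (inst_of D)
             | Some (D', H) \<Rightarrow>
                 D' \<in> descriptions d \<and>
                 equivalent (inst_of D) (inst_of D') \<and>
                 int (card (family (inst_of D'))) \<le> g_bound d (target (inst_of D)) \<and>
                 distinct H \<and> hitting_set (inst_of D') (set H) \<and>
                 int (length H) \<le> target (inst_of D) * int d))
         \<and> admits_kernel d (g_bound d)
         \<and> (\<lambda>k :: nat. real_of_int (g_bound d (int k))) \<in> O(\<lambda>k. (real k ^ (d + 1)) ^ d)"
  by (intro conjI kernel_with_hitting_set kernel_admissible g_bound_bigo)

end
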